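(* For a noiseless wiretap network as described in the context, define $$\mathcal{R}_{0,o}=\Lambda\Big(\mathrm{Proj}_{\mathcal{S}}\big(\overline{\mathrm{con}}(\Gamma_N^*\cap\Gamma_1\cap\Gamma_2\cap\Gamma_3\cap\Gamma_4)\cap\Gamma_5\cap\Gamma_6\big)\Big).$$ Then $\mathcal{R}_0^{(w)}\subseteq\mathcal{R}_{0,o}$.
   Context: Network: an acyclic directed graph $G=(\mathcal{V},\mathcal{E})$, each edge $e$ an error-free bit pipe of finite capacity $c_e$; $\mathrm{In}(v)$, $\mathrm{Out}(v)$ denote incoming/outgoing edges of $v$. Sources $\mathcal{S}$ and terminals $\mathcal{T}$ are disjoint; sources have no incoming edges, terminals no outgoing edges, only sources generate keys; terminal $t$ demands the messages of $\beta(t)\subseteq\mathcal{S}$; $\mathcal{A}_s\subset2^{\mathcal{E}}$ is the collection of possibly wiretapped edge sets. A code of blocklength $n$: source $s$ has message $M_s$ uniform on $[1:2^{\lfloor nr_{m_s}\rfloor}]$ and key $K_s$ uniform on $[1:2^{\lfloor nr_{k_s}\rfloor}]$, all mutually independent; edge $e$ carries $W_e\in\mathcal{W}_e$ (finite), with $W_e=\eta_e(M_s,K_s)$ for $e\in\mathrm{Out}(s)$, $s\in\mathcal{S}$, and $W_e=\eta_e(W_{e'}:e'\in\mathrm{In}(v))$ for $e\in\mathrm{Out}(v)$, $v\notin\mathcal{S}\cup\mathcal{T}$; terminal $t$ outputs $\hat M_{s\to t}=\eta_{t,s}(W_e:e\in\mathrm{In}(t))$ for $s\in\beta(t)$. The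 variable-length rate of edge $e$ is $r_e^{(v)}=n^{-1}H(W_e)$ (logs base 2). A rate vector $\mathbf r=(r_s:s\in\mathcal{S})$ is achievable at zero error subject to weak secrecy if for every $\epsilon>0$ there is a code of sufficiently large blocklength $n$ with (i) $r_{m_s}^{(n)}\ge r_s-\epsilon$ for all $s$; (ii) $r_e^{(v)}\le c_e$ for all $e$; (iii) $n^{-1}I(M_{\mathcal{S}};W_\alpha)\le\epsilon$ for all $\alpha\in\mathcal{A}_s$, where $M_{\mathcal S}=(M_s:s\in\mathcal S)$, $W_\alpha=(W_e:e\in\alpha)$; (iv) $\Pr(\hat M_{s\to t}\ne M_s)=0$ for all $t\in\mathcal{T}$, $s\in\beta(t)$. $\mathcal{R}_0^{(w)}$ is the set of such rate vectors. Entropy region: let $N=2|\mathcal{S}|+|\mathcal{E}|$ and index $N$ random variables by the labels $m_s,k_s$ ($s\in\mathcal S$) and $e$ ($e\in\mathcal E$). $\mathcal{H}_N$ is the set of real vectors $\mathbf h$ with coordinates $h_\gamma$ indexed by subsets $\gamma$ of these labels ($h_\emptyset=0$); for sets of labels we write e.g. $h_{m_s,k_s,\mathrm{Out}(s)}$ for the coordinate of the union. $\mathbf h$ is entropic if $h_\gamma=H(U_\gamma)$ for some jointly distributed finite-alphabet random variables $(U_{m_s},U_{k_s})_{s},(U_e)_e$, and $\Gamma_N^*$ is the set of entropic vectors. Define: $\Gamma_1=\{\mathbf h: h_{\{m_s,k_s:s\in\mathcal S\}}=\sum_{s\in\mathcal S}(h_{m_s}+h_{k_s})\}$; $\Gamma_2=\{\mathbf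 h: h_{m_s,k_s,\mathrm{Out}(s)}=h_{m_s,k_s}\ \forall s\in\mathcal S\}$; $\Gamma_3=\{\mathbf h: h_{\mathrm{In}(v)\cup\mathrm{Out}(v)}=h_{\mathrm{In}(v)}\ \forall v\in\mathcal V\setminus(\mathcal S\cup\mathcal T)\}$; $\Gamma_4=\{\mathbf h: h_{m_{\beta(t)},\mathrm{In}(t)}=h_{\mathrm{In}(t)}\ \forall t\in\mathcal T\}$ where $m_{\beta(t)}=\{m_s:s\in\beta(t)\}$; $\Gamma_5=\{\mathbf h: h_e\le c_e\ \forall e\in\mathcal E\}$; $\Gamma_6=\{\mathbf h: h_{m_{\mathcal S},\alpha}=h_{m_{\mathcal S}}+h_\alpha\ \forall\alpha\in\mathcal A_s\}$ where $m_{\mathcal S}=\{m_s:s\in\mathcal S\}$. $\overline{\mathrm{con}}(\mathcal A)$ is the smallest closed convex set containing $\mathcal A$. $\mathrm{Proj}_{\mathcal S}:\mathcal H_N\to\mathbb R^{|\mathcal S|}$ maps $\mathbf h$ to $(h_{m_s}:s\in\mathcal S)$. For $\mathcal A\subset\mathbb R^n$, $\Lambda(\mathcal A)=\{\mathbf x\in\mathbb R^n:\mathbf x\le\mathbf y\text{ componentwise for some }\mathbf y\in\mathcal A\}$. *)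

theory Defs
  imports "HOL-Probability.Probability"
begin

text \<open>A network: finite vertex set V, finite edge set E (edges are elements of a type,
  so parallel edges are allowed), tail/head maps, sources S, terminals T, demands beta,
  capacities c, and the collection A of possibly wiretapped edge sets.\<close>

definition Out :: "'e set \<Rightarrow> ('e \<Rightarrow> 'v) \<Rightarrow> 'v \<Rightarrow> 'e set" where
  "Out E tail v = {e \<in> E. tail e = v}"

definition In :: "'e set \<Rightarrow> ('e \<Rightarrow> 'v) \<Rightarrow> 'v \<Rightarrow> 'e set" where
  "In E head v = {e \<in> E. head e = v}"

definition wiretap_network ::
  "'v set \<Rightarrow> 'e set \<Rightarrow> ('e \<Rightarrow> 'v) \<Rightarrow> ('e \<Rightarrow> 'v) \<Rightarrow> 'v set \<Rightarrow> 'v set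
   \<Rightarrow> ('v \<Rightarrow> 'v set) \<Rightarrow> ('e \<Rightarrow> real) \<Rightarrow> 'e set set \<Rightarrow> bool" where
  "wiretap_network V E tail head S T beta c A \<longleftrightarrow>
     finite V \<and> finite E \<and> (\<forall>e\<in>E. tail e \<in> V \<and> head e \<in> V) \<and>
     acyclic {(tail e, head e) | e. e \<in> E} \<and>
     S \<subseteq> V \<and> T \<subseteq> V \<and> S \<inter> T = {} \<and>
     (\<forall>s\<in>S. In E head s = {}) \<and> (\<forall>t\<in>T. Out E tail t = {}) \<and>
     (\<forall>t\<in>T. beta t \<subseteq> S) \<and> (\<forall>\<alpha>\<in>A. \<alpha> \<subseteq> E)"

definition entropy_pmf :: "'a pmf \<Rightarrow> real" where
  "entropy_pmf p = - (\<Sum>x\<in>set_pmf p. pmf p x * log 2 (pmf p x))"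

definition H_unif :: "'w set \<Rightarrow> ('w \<Rightarrow> 'a) \<Rightarrow> real" where
  "H_unif \<Omega> X = entropy_pmf (map_pmf X (pmf_of_set \<Omega>))"

definition MI_unif :: "'w set \<Rightarrow> ('w \<Rightarrow> 'a) \<Rightarrow> ('w \<Rightarrow> 'b) \<Rightarrow> real" where
  "MI_unif \<Omega> X Y = H_unif \<Omega> X + H_unif \<Omega> Y - H_unif \<Omega> (\<lambda>w. (X w, Y w))"

text \<open>Outcome space of (messages, keys): message of source s uniform on a set of size
  2^floor(n rm_s), key uniform on a set of size 2^floor(n rk_s), all independent:
  the uniform distribution on the product set below.\<close>
definition code_space :: "'v set \<Rightarrow> nat \<Rightarrow> ('v \<Rightarrow> real) \<Rightarrow> ('v \<Rightarrow> real)
    \<Rightarrow> (('v \<Rightarrow> nat) \<times> ('v \<Rightarrow> nat)) set" where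
  "code_space S n rm rk =
     (PiE S (\<lambda>s. {..< 2 ^ nat \<lfloor>real n * rm s\<rfloor>})) \<times> (PiE S (\<lambda>s. {..< 2 ^ nat \<lfloor>real n * rk s\<rfloor>}))"

text \<open>A code of blocklength n: W e \<omega> is the symbol on edge e (finite alphabet, encoded in nat)
  as a function of the outcome \<omega> = (messages, keys).  Local encoding constraints at sources
  and intermediate nodes, and zero-error decoding at terminals.  Since the graph is acyclic,
  this is equivalent to specifying the local encoding functions eta.\<close>
definition is_code ::
  "'v set \<Rightarrow> 'e set \<Rightarrow> ('e \<Rightarrow> 'v) \<Rightarrow> ('e \<Rightarrow> 'v) \<Rightarrow> 'v set \<Rightarrow> 'v set
   \<Rightarrow> ('v \<Rightarrow> 'v set) \<Rightarrow> nat \<Rightarrow> ('v \<Rightarrow> real) \<Rightarrow> ('v \<Rightarrow> real)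
   \<Rightarrow> ('e \<Rightarrow> ('v \<Rightarrow> nat) \<times> ('v \<Rightarrow> nat) \<Rightarrow> nat) \<Rightarrow> bool" where
  "is_code V E tail head S T beta n rm rk W \<longleftrightarrow>
     n > 0 \<and> (\<forall>s\<in>S. rm s \<ge> 0 \<and> rk s \<ge> 0) \<and>
     (\<forall>s\<in>S. \<forall>e\<in>Out E tail s. \<exists>eta. \<forall>\<omega>\<in>code_space S n rm rk.
         W e \<omega> = eta (fst \<omega> s, snd \<omega> s)) \<and>
     (\<forall>v\<in>V - (S \<union> T). \<forall>e\<in>Out E tail v. \<exists>eta. \<forall>\<omega>\<in>code_space S n rm rk.
         W e \<omega> = eta (\<lambda>e'. if e' \<in> In E head v then W e' \<omega> else 0)) \<and>
     (\<forall>t\<in>T. \<forall>s\<in>beta t. \<exists>dec. \<forall>\<omega>\<in>code_space S n rm rk.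
         dec (\<lambda>e. if e \<in> In E head t then W e \<omega> else 0) = fst \<omega> s)"

text \<open>Achievability at zero error subject to weak secrecy (conditions (i)-(iv)).
  Condition (iv) (zero error) is part of is_code.\<close>
definition achievable_w ::
  "'v set \<Rightarrow> 'e set \<Rightarrow> ('e \<Rightarrow> 'v) \<Rightarrow> ('e \<Rightarrow> 'v) \<Rightarrow> 'v set \<Rightarrow> 'v set
   \<Rightarrow> ('v \<Rightarrow> 'v set) \<Rightarrow> ('e \<Rightarrow> real) \<Rightarrow> 'e set set \<Rightarrow> ('v \<Rightarrow> real) \<Rightarrow> bool" where
  "achievable_w V E tail head S T beta c A r \<longleftrightarrow>
     (\<forall>\<epsilon>>0. \<exists>N. \<forall>n\<ge>N. \<exists>rm rk W.
        is_code V E tail head S T beta n rm rk W \<and>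
        (\<forall>s\<in>S. real (nat \<lfloor>real n * rm s\<rfloor>) / real n \<ge> r s - \<epsilon>) \<and>
        (\<forall>e\<in>E. H_unif (code_space S n rm rk) (W e) / real n \<le> c e) \<and>
        (\<forall>\<alpha>\<in>A. MI_unif (code_space S n rm rk) fst
                   (\<lambda>\<omega>. (\<lambda>e. if e \<in> \<alpha> then W e \<omega> else 0)) / real n \<le> \<epsilon>))"

text \<open>Rate vectors are indexed by S; they are represented as functions vanishing off S.\<close>
definition R0w ::
  "'v set \<Rightarrow> 'e set \<Rightarrow> ('e \<Rightarrow> 'v) \<Rightarrow> ('e \<Rightarrow> 'v) \<Rightarrow> 'v set \<Rightarrow> 'v set
   \<Rightarrow> ('v \<Rightarrow> 'v set) \<Rightarrow> ('e \<Rightarrow> real) \<Rightarrow> 'e set set \<Rightarrow> ('v \<Rightarrow> real) set" where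
  "R0w V E tail head S T beta c A =
     {r. (\<forall>s. s \<notin> S \<longrightarrow> r s = 0) \<and> achievable_w V E tail head S T beta c A r}"

datatype ('v, 'e) label = Msg 'v | Key 'v | Edge 'e

definition labels :: "'v set \<Rightarrow> 'e set \<Rightarrow> ('v, 'e) label set" where
  "labels S E = Msg ` S \<union> Key ` S \<union> Edge ` E"

definition HN :: "('v, 'e) label set \<Rightarrow> (('v, 'e) label set \<Rightarrow> real) set" where
  "HN L = {h. h {} = 0 \<and> (\<forall>\<gamma>. \<not> \<gamma> \<subseteq> L \<longrightarrow> h \<gamma> = 0)}"

text \<open>Entropic vectors: jointly distributed finite-alphabet random variables U_l (l in L),
  given by a finitely supported joint pmf on tuples (alphabets encoded in nat).\<close>
definition Gamma_star :: "('v, 'e) label set \<Rightarrow> (('v, 'e) label set \<Rightarrow> real) set" where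
  "Gamma_star L = {h \<in> HN L. \<exists>p :: (('v, 'e) label \<Rightarrow> nat) pmf. finite (set_pmf p) \<and>
      (\<forall>\<gamma>. \<gamma> \<subseteq> L \<longrightarrow> h \<gamma> = entropy_pmf (map_pmf (\<lambda>u l. if l \<in> \<gamma> then u l else 0) p))}"

definition Gamma1 :: "'v set \<Rightarrow> 'e set \<Rightarrow> (('v, 'e) label set \<Rightarrow> real) set" where
  "Gamma1 S E = {h \<in> HN (labels S E).
      h (Msg ` S \<union> Key ` S) = (\<Sum>s\<in>S. h {Msg s} + h {Key s})}"

definition Gamma2 :: "'v set \<Rightarrow> 'e set \<Rightarrow> ('e \<Rightarrow> 'v) \<Rightarrow> (('v, 'e) label set \<Rightarrow> real) set" where
  "Gamma2 S E tail = {h \<in> HN (labels S E). \<forall>s\<in>S.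
      h ({Msg s, Key s} \<union> Edge ` Out E tail s) = h {Msg s, Key s}}"

definition Gamma3 :: "'v set \<Rightarrow> 'e set \<Rightarrow> ('e \<Rightarrow> 'v) \<Rightarrow> ('e \<Rightarrow> 'v) \<Rightarrow> 'v set \<Rightarrow> 'v set
    \<Rightarrow> (('v, 'e) label set \<Rightarrow> real) set" where
  "Gamma3 V E tail head S T = {h \<in> HN (labels S E). \<forall>v\<in>V - (S \<union> T).
      h (Edge ` (In E head v \<union> Out E tail v)) = h (Edge ` In E head v)}"

definition Gamma4 :: "'v set \<Rightarrow> 'e set \<Rightarrow> ('e \<Rightarrow> 'v) \<Rightarrow> 'v set \<Rightarrow> ('v \<Rightarrow> 'v set)
    \<Rightarrow> (('v, 'e) label set \<Rightarrow> real) set" where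
  "Gamma4 S E head T beta = {h \<in> HN (labels S E). \<forall>t\<in>T.
      h (Msg ` beta t \<union> Edge ` In E head t) = h (Edge ` In E head t)}"

definition Gamma5 :: "'v set \<Rightarrow> 'e set \<Rightarrow> ('e \<Rightarrow> real) \<Rightarrow> (('v, 'e) label set \<Rightarrow> real) set" where
  "Gamma5 S E c = {h \<in> HN (labels S E). \<forall>e\<in>E. h {Edge e} \<le> c e}"

definition Gamma6 :: "'v set \<Rightarrow> 'e set \<Rightarrow> 'e set set \<Rightarrow> (('v, 'e) label set \<Rightarrow> real) set" where
  "Gamma6 S E A = {h \<in> HN (labels S E). \<forall>\<alpha>\<in>A.
      h (Msg ` S \<union> Edge ` \<alpha>) = h (Msg ` S) + h (Edge ` \<alpha>)}"

definition convex_vec :: "('i \<Rightarrow> real) set \<Rightarrow> bool" where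
  "convex_vec C \<longleftrightarrow> (\<forall>x\<in>C. \<forall>y\<in>C. \<forall>u::real. 0 \<le> u \<and> u \<le> 1 \<longrightarrow>
      (\<lambda>i. u * x i + (1 - u) * y i) \<in> C)"

text \<open>Smallest closed (product topology, i.e. coordinatewise) convex set containing X.\<close>
definition cl_con :: "('i \<Rightarrow> real) set \<Rightarrow> ('i \<Rightarrow> real) set" where
  "cl_con X = \<Inter> {C. X \<subseteq> C \<and> closed C \<and> convex_vec C}"

definition ProjS :: "'v set \<Rightarrow> (('v, 'e) label set \<Rightarrow> real) \<Rightarrow> ('v \<Rightarrow> real)" where
  "ProjS S h = (\<lambda>s. if s \<in> S then h {Msg s} else 0)"

definition Lambda_low :: "'v set \<Rightarrow> ('v \<Rightarrow> real) set \<Rightarrow> ('v \<Rightarrow> real) set" where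
  "Lambda_low S X = {x. (\<forall>s. s \<notin> S \<longrightarrow> x s = 0) \<and> (\<exists>y\<in>X. \<forall>s\<in>S. x s \<le> y s)}"

definition R0o ::
  "'v set \<Rightarrow> 'e set \<Rightarrow> ('e \<Rightarrow> 'v) \<Rightarrow> ('e \<Rightarrow> 'v) \<Rightarrow> 'v set \<Rightarrow> 'v set
   \<Rightarrow> ('v \<Rightarrow> 'v set) \<Rightarrow> ('e \<Rightarrow> real) \<Rightarrow> 'e set set \<Rightarrow> ('v \<Rightarrow> real) set" where
  "R0o V E tail head S T beta c A =
     Lambda_low S (ProjS S ` (cl_con (Gamma_star (labels S E) \<inter> Gamma1 S E \<inter> Gamma2 S E tail
        \<inter> Gamma3 V E tail head S T \<inter> Gamma4 S E head T beta) \<inter> Gamma5 S E c \<inter> Gamma6 S E A))"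

end

theory Submission
  imports Defs
begin

text \<open>
  The entropy vector of a good code of blocklength \<open>n\<close>, divided by \<open>n\<close>, satisfies the constraints up
  to \<open>\<epsilon>\<close>, and one wants a limit as \<open>\<epsilon> \<rightarrow> 0\<close>. The obstacle is compactness: key rates and rates
  of messages that nobody demands are unbounded. Excess message bits are moved into the key, which
  only decreases the leakage. For the keys, the code is repeated \<open>L\<close> times, and the \<open>L\<close> keys of a
  source \<open>s\<close> are replaced by a uniform index into a random codebook of size \<open>J\<close>, with \<open>log J / L\<close>
  just above the entropy of the symbols on \<open>Out s\<close>. Each codebook gives a zero-error code again, and
  the average of the entropy vectors over all codebooks lies in the convex hull. Averaging does
  not increase \<open>H(W\<^sub>\<alpha>)\<close>, and it decreases \<open>H(M, W\<^sub>\<alpha>)\<close> at most by the mean divergence between the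
  laws of the messages and source symbols with and without codebook (data processing). That
  divergence is bounded independently of \<open>L\<close>, so it vanishes after division by \<open>n * L\<close>. All vectors
  now lie in a fixed compact box, and nested closed sets have a common point.
\<close>

section \<open>Averages and entropy on uniform sample spaces\<close>

text \<open>The target asks for a single point of \<open>cl_con\<close> with exact secrecy, and
  near-solutions whose coordinates escape to infinity need not have a limit. A source may hold far
  more key than its outgoing edges can carry, but only about \<open>H(W_Out(s) | M_s)\<close> bits
  of it are visible there, and this is at most the blocklength times the sum of the capacities of
  those edges. In a single block a codebook would have to resolve rare symbols too; over many blocks
  a rate just above the conditional entropy suffices, as in soft covering. No good codebook is
  selected: with any codebook, even one with repeated codewords, the key is a uniform index, so
  \<open>Gamma1\<close> to \<open>Gamma4\<close> hold exactly. The mean over codebooks is computable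
  because a random codeword is a uniform key: the mean cross-entropy is the original entropy, and
  exactly the mean divergence is lost. Every edge symbol is a function of the source symbols, so
  this loss can be measured at the sources, where independent keys make it a sum.\<close>

definition avg :: "'a set \<Rightarrow> ('a \<Rightarrow> real) \<Rightarrow> real" where
  "avg A f = (\<Sum>a\<in>A. f a) / real (card A)"

lemma avg_cong: "(\<And>a. a \<in> A \<Longrightarrow> f a = g a) \<Longrightarrow> avg A f = avg A g"
  unfolding avg_def by (simp cong: sum.cong)

lemma avg_mono: "(\<And>a. a \<in> A \<Longrightarrow> f a \<le> g a) \<Longrightarrow> avg A f \<le> avg A g"
  unfolding avg_def by (intro divide_right_mono sum_mono) auto

lemma avg_add: "avg A (\<lambda>a. f a + g a) = avg A f + avg A g"
  unfolding avg_def by (simp add: sum.distrib add_divide_distrib)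

lemma avg_diff: "avg A (\<lambda>a. f a - g a) = avg A f - avg A g"
  unfolding avg_def by (simp add: sum_subtractf diff_divide_distrib)

lemma avg_cmult: "avg A (\<lambda>a. c * f a) = c * avg A f"
  unfolding avg_def by (simp add: sum_distrib_left)

lemma avg_const: "finite A \<Longrightarrow> A \<noteq> {} \<Longrightarrow> avg A (\<lambda>_. c) = c"
  unfolding avg_def by simp

lemma avg_sum: "avg A (\<lambda>a. \<Sum>i\<in>I. f i a) = (\<Sum>i\<in>I. avg A (f i))"
  unfolding avg_def by (subst sum.swap) (simp add: sum_divide_distrib)

lemma avg_times: "avg (A \<times> B) f = avg A (\<lambda>a. avg B (\<lambda>b. f (a, b)))"
  unfolding avg_def
  by (simp add: sum.cartesian_product' sum_divide_distrib card_cartesian_product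
      mult.commute)

lemma avg_swap: "avg A (\<lambda>a. avg B (\<lambda>b. f a b)) = avg B (\<lambda>b. avg A (\<lambda>a. f a b))"
  unfolding avg_def sum_divide_distrib[symmetric]
  by (subst sum.swap) (simp add: mult.commute)

lemma avg_le_const:
  "finite A \<Longrightarrow> A \<noteq> {} \<Longrightarrow> (\<And>a. a \<in> A \<Longrightarrow> f a \<le> c) \<Longrightarrow> avg A f \<le> c"
  using avg_mono[of A f "\<lambda>_. c"] by (simp add: avg_const)

lemma avg_ge_const:
  "finite A \<Longrightarrow> A \<noteq> {} \<Longrightarrow> (\<And>a. a \<in> A \<Longrightarrow> c \<le> f a) \<Longrightarrow> c \<le> avg A f"
  using avg_mono[of A "\<lambda>_. c" f] by (simp add: avg_const)

text \<open>Says that \<open>f\<close> carries the uniform distribution on \<open>A\<close> to the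
  one on \<open>B\<close>. The fibre condition is a product of cardinalities so that it stays in the
  natural numbers.\<close>

definition equidist :: "'a set \<Rightarrow> ('a \<Rightarrow> 'b) \<Rightarrow> 'b set \<Rightarrow> bool" where
  "equidist A f B \<longleftrightarrow> finite A \<and> A \<noteq> {} \<and> finite B \<and> f ` A \<subseteq> B \<and>
     (\<forall>b\<in>B. card {a\<in>A. f a = b} * card B = card A)"

lemma avg_equidist:
  assumes "equidist A f B"
  shows "avg A (\<lambda>a. g (f a)) = avg B g"
proof -
  have fin: "finite A" "finite B" "f ` A \<subseteq> B" "A \<noteq> {}"
    and c: "\<And>b. b \<in> B \<Longrightarrow> card {a\<in>A. f a = b} * card B = card A"
    using assms unfolding equidist_def by auto
  have pos: "real (card A) > 0" "real (card B) > 0"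
    using fin by (auto simp: card_gt_0_iff)
  have "(\<Sum>a\<in>A. g (f a)) = (\<Sum>b\<in>B. \<Sum>a\<in>{a\<in>A. f a = b}. g (f a))"
    using sum.group[OF fin(1,2,3), of "\<lambda>a. g (f a)"] by simp
  also have "\<dots> = (\<Sum>b\<in>B. real (card {a\<in>A. f a = b}) * g b)"
    by (intro sum.cong) auto
  also have "\<dots> = (\<Sum>b\<in>B. real (card A) / real (card B) * g b)"
  proof (intro sum.cong refl)
    fix b assume "b \<in> B"
    from c[OF this] have "real (card {a\<in>A. f a = b}) * real (card B) = real (card A)"
      by (metis of_nat_mult)
    then show "real (card {a\<in>A. f a = b}) * g b = real (card A) / real (card B) * g b"
      using pos by (simp add: field_simps)
  qed
  also have "\<dots> = real (card A) / real (card B) * (\<Sum>b\<in>B. g b)"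
    by (simp add: sum_distrib_left)
  finally show ?thesis
    unfolding avg_def using pos by simp
qed

lemma equidist_bij: "bij_betw f A B \<Longrightarrow> finite A \<Longrightarrow> A \<noteq> {} \<Longrightarrow> equidist A f B"
proof -
  assume b: "bij_betw f A B" and A: "finite A" "A \<noteq> {}"
  have "card {a\<in>A. f a = y} = 1" if "y \<in> B" for y
  proof -
    obtain x where "x \<in> A" "f x = y" using b \<open>y \<in> B\<close> by (auto simp: bij_betw_def)
    then have "{a\<in>A. f a = y} = {x}" using b by (auto simp: bij_betw_def inj_on_def)
    then show ?thesis by simp
  qed
  then show ?thesis using b A unfolding equidist_def
    by (auto simp: bij_betw_def card_image)
qed

text \<open>The fibre over \<open>b\<close> is the product of the fibres over its components, so the
  counts multiply.\<close>

lemma equidist_PiE: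
  assumes S: "finite S" and e: "\<And>s. s \<in> S \<Longrightarrow> equidist (D s) (f s) (B s)"
  shows "equidist (PiE S D) (\<lambda>g. restrict (\<lambda>s. f s (g s)) S) (PiE S B)"
proof -
  have D: "\<And>s. s \<in> S \<Longrightarrow> finite (D s)" "\<And>s. s \<in> S \<Longrightarrow> D s \<noteq> {}"
    "\<And>s. s \<in> S \<Longrightarrow> finite (B s)" "\<And>s x. s \<in> S \<Longrightarrow> x \<in> D s \<Longrightarrow> f s x \<in> B s"
    using e unfolding equidist_def by auto
  have "card {g \<in> PiE S D. restrict (\<lambda>s. f s (g s)) S = b} * card (PiE S B) = card (PiE S D)"
    if b: "b \<in> PiE S B" for b
  proof -
    have "{g \<in> PiE S D. restrict (\<lambda>s. f s (g s)) S = b} = PiE S (\<lambda>s. {x\<in>D s. f s x = b s})"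
      using b by (fastforce simp: PiE_def extensional_def Pi_def restrict_def fun_eq_iff)
    then have "card {g \<in> PiE S D. restrict (\<lambda>s. f s (g s)) S = b} * card (PiE S B)
       = (\<Prod>s\<in>S. card {x\<in>D s. f s x = b s}) * (\<Prod>s\<in>S. card (B s))"
      using S by (simp add: card_PiE)
    also have "\<dots> = (\<Prod>s\<in>S. card (D s))"
      unfolding prod.distrib[symmetric]
      using e b by (intro prod.cong) (auto simp: equidist_def)
    finally show ?thesis using S by (simp add: card_PiE)
  qed
  moreover have "(\<lambda>g. restrict (\<lambda>s. f s (g s)) S) ` PiE S D \<subseteq> PiE S B"
    using D(4) by (auto simp: PiE_iff)
  ultimately show ?thesis unfolding equidist_def
    using S D(1-3) by (simp add: finite_PiE PiE_eq_empty_iff)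
qed

lemma equidist_component:
  assumes S: "finite S" "s \<in> S" and D: "\<And>s. s \<in> S \<Longrightarrow> finite (D s)" "\<And>s. s \<in> S \<Longrightarrow> D s \<noteq> {}"
  shows "equidist (PiE S D) (\<lambda>g. g s) (D s)"
proof -
  have "card {g \<in> PiE S D. g s = b} * card (D s) = card (PiE S D)" if b: "b \<in> D s" for b
  proof -
    have "{g \<in> PiE S D. g s = b} = PiE S (D(s := {b}))"
      using b S by (auto simp: PiE_def Pi_def split: if_splits)
    then have "card {g \<in> PiE S D. g s = b} = (\<Prod>x\<in>S. card ((D(s := {b})) x))"
      using S by (simp add: card_PiE)
    also have "\<dots> = (\<Prod>x\<in>S - {s}. card (D x))"
      using S by (subst prod.remove[of _ s]) (auto intro!: prod.cong)
    finally show ?thesis using S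
      by (simp add: card_PiE prod.remove[of S s] mult.commute)
  qed
  then show ?thesis unfolding equidist_def
    using S D by (auto simp: finite_PiE PiE_eq_empty_iff)
qed

text \<open>Pairwise independence of the codewords of a random codebook, the only joint law of
  distinct codewords that enters the divergence bound.\<close>

lemma equidist_two_components:
  assumes S: "finite S" "s \<in> S" "t \<in> S" "s \<noteq> t" and D: "finite D" "D \<noteq> {}"
  shows "equidist (PiE S (\<lambda>_. D)) (\<lambda>g. (g s, g t)) (D \<times> D)"
proof -
  have "card {g \<in> PiE S (\<lambda>_. D). (g s, g t) = b} * card (D \<times> D) = card (PiE S (\<lambda>_. D))"
    if b: "b \<in> D \<times> D" for b
  proof -
    let ?B = "(\<lambda>_. D)(s := {fst b}, t := {snd b})"
    have "{g \<in> PiE S (\<lambda>_. D). (g s, g t) = b} = PiE S ?B"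
    proof (intro equalityI subsetI)
      fix g assume g: "g \<in> PiE S ?B"
      have "g s = fst b" "g t = snd b"
        using PiE_mem[OF g S(2)] PiE_mem[OF g S(3)] S(4) by auto
      moreover have "g i \<in> D" if "i \<in> S" for i
        using PiE_mem[OF g that] b by (auto split: if_splits)
      moreover have "g \<in> extensional S" using g by (simp add: PiE_iff)
      ultimately show "g \<in> {g \<in> PiE S (\<lambda>_. D). (g s, g t) = b}"
        by (simp add: PiE_iff)
    qed (auto simp: PiE_iff)
    then have "card {g \<in> PiE S (\<lambda>_. D). (g s, g t) = b} = (\<Prod>x\<in>S. card (?B x))"
      using S by (simp add: card_PiE)
    also have "\<dots> = (\<Prod>x\<in>S - {s} - {t}. card D)"
      using S by (simp add: prod.remove[of S s] prod.remove[of "S - {s}" t] del: prod_constant)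
    finally show ?thesis using S
      by (simp add: card_PiE prod.remove[of S s] prod.remove[of "S - {s}" t] card_cartesian_product
          del: prod_constant)
  qed
  then show ?thesis unfolding equidist_def
    using S D by (auto simp: finite_PiE PiE_eq_empty_iff)
qed

lemma avg_PiE_component:
  assumes "finite S" "s \<in> S" "\<And>s. s \<in> S \<Longrightarrow> finite (D s)" "\<And>s. s \<in> S \<Longrightarrow> D s \<noteq> {}"
  shows "avg (PiE S D) (\<lambda>g. f (g s)) = avg (D s) f"
  by (rule avg_equidist[OF equidist_component[OF assms]])

text \<open>The probability of the value \<open>X w\<close>, attached to the sample point
  \<open>w\<close> instead of the value. Once \<open>H_unif_avg\<close> is available, entropies,
  divergences and likelihood ratios are plain averages over sample points.\<close>

definition agree_frac :: "'w set \<Rightarrow> ('w \<Rightarrow> 'a) \<Rightarrow> 'w \<Rightarrow> real" where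
  "agree_frac \<Omega> X w = real (card {w'\<in>\<Omega>. X w' = X w}) / real (card \<Omega>)"

lemma agree_frac_pos: "finite \<Omega> \<Longrightarrow> w \<in> \<Omega> \<Longrightarrow> 0 < agree_frac \<Omega> X w"
  unfolding agree_frac_def by (intro divide_pos_pos) (auto simp: card_gt_0_iff)

lemma agree_frac_le_1: "finite \<Omega> \<Longrightarrow> agree_frac \<Omega> X w \<le> 1"
  unfolding agree_frac_def
  by (cases "card \<Omega> = 0") (auto simp: divide_le_eq intro!: card_mono)

lemma agree_frac_ge: "finite \<Omega> \<Longrightarrow> w \<in> \<Omega> \<Longrightarrow> 1 / real (card \<Omega>) \<le> agree_frac \<Omega> X w"
proof -
  assume "finite \<Omega>" "w \<in> \<Omega>"
  then have "1 \<le> card {w'\<in>\<Omega>. X w' = X w}"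
    by (auto simp: Suc_le_eq card_gt_0_iff)
  then show ?thesis unfolding agree_frac_def by (intro divide_right_mono) auto
qed

lemma H_unif_avg:
  assumes "finite \<Omega>" "\<Omega> \<noteq> {}"
  shows "H_unif \<Omega> X = avg \<Omega> (\<lambda>w. - log 2 (agree_frac \<Omega> X w))"
proof -
  have p: "pmf (map_pmf X (pmf_of_set \<Omega>)) (X w) = agree_frac \<Omega> X w" for w
  proof -
    have "pmf (map_pmf X (pmf_of_set \<Omega>)) (X w) = measure (pmf_of_set \<Omega>) (X -` {X w})"
      by (simp add: pmf_map)
    also have "\<dots> = real (card (\<Omega> \<inter> X -` {X w})) / real (card \<Omega>)"
      using assms by (simp add: measure_pmf_of_set)
    also have "\<Omega> \<inter> X -` {X w} = {w'\<in>\<Omega>. X w' = X w}" by auto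
    finally show ?thesis by (simp add: agree_frac_def)
  qed
  have "(\<Sum>w\<in>\<Omega>. log 2 (agree_frac \<Omega> X w))
      = (\<Sum>x\<in>X ` \<Omega>. \<Sum>w\<in>{w\<in>\<Omega>. X w = x}. log 2 (agree_frac \<Omega> X w))"
    using assms by (intro sum.image_gen) auto
  also have "\<dots> = (\<Sum>x\<in>X ` \<Omega>. real (card \<Omega>) * (pmf (map_pmf X (pmf_of_set \<Omega>)) x
       * log 2 (pmf (map_pmf X (pmf_of_set \<Omega>)) x)))"
  proof (rule sum.cong[OF refl])
    fix x assume "x \<in> X ` \<Omega>"
    then obtain v where v: "v \<in> \<Omega>" "x = X v" by auto
    have "(\<Sum>w\<in>{w\<in>\<Omega>. X w = x}. log 2 (agree_frac \<Omega> X w))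
        = (\<Sum>w\<in>{w\<in>\<Omega>. X w = x}. log 2 (agree_frac \<Omega> X v))"
      using v by (intro sum.cong) (auto simp: agree_frac_def)
    also have "\<dots> = real (card {w\<in>\<Omega>. X w = X v}) * log 2 (agree_frac \<Omega> X v)"
      using v by simp
    also have "real (card {w\<in>\<Omega>. X w = X v}) = real (card \<Omega>) * agree_frac \<Omega> X v"
      using assms by (simp add: agree_frac_def)
    finally show "(\<Sum>w\<in>{w\<in>\<Omega>. X w = x}. log 2 (agree_frac \<Omega> X w)) = real (card \<Omega>) *
       (pmf (map_pmf X (pmf_of_set \<Omega>)) x * log 2 (pmf (map_pmf X (pmf_of_set \<Omega>)) x))"
      using v by (simp add: p)
  qed
  also have "\<dots> = real (card \<Omega>) * - H_unif \<Omega> X"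
    using assms by (simp add: H_unif_def entropy_pmf_def sum_distrib_left)
  finally show ?thesis using assms
    unfolding avg_def by (simp add: sum_negf)
qed

lemma agree_frac_cong:
  assumes "\<And>w'. w' \<in> \<Omega> \<Longrightarrow> X w' = X w \<longleftrightarrow> Y w' = Y w"
  shows "agree_frac \<Omega> X w = agree_frac \<Omega> Y w"
proof -
  have "{w'\<in>\<Omega>. X w' = X w} = {w'\<in>\<Omega>. Y w' = Y w}" using assms by auto
  then show ?thesis by (simp add: agree_frac_def)
qed

lemma H_unif_cong:
  assumes "finite \<Omega>" "\<Omega> \<noteq> {}"
    and "\<And>w w'. w \<in> \<Omega> \<Longrightarrow> w' \<in> \<Omega> \<Longrightarrow> X w' = X w \<longleftrightarrow> Y w' = Y w"
  shows "H_unif \<Omega> X = H_unif \<Omega> Y"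
  unfolding H_unif_avg[OF assms(1,2)]
  using assms(3) by (intro avg_cong arg_cong[where f = "\<lambda>x. - log 2 x"] agree_frac_cong) auto

lemma H_unif_nonneg: "finite \<Omega> \<Longrightarrow> \<Omega> \<noteq> {} \<Longrightarrow> 0 \<le> H_unif \<Omega> X"
  unfolding H_unif_avg
  by (intro avg_ge_const) (auto simp: agree_frac_pos agree_frac_le_1)

lemma H_unif_le: "finite \<Omega> \<Longrightarrow> \<Omega> \<noteq> {} \<Longrightarrow> H_unif \<Omega> X \<le> log 2 (real (card \<Omega>))"
proof -
  assume a: "finite \<Omega>" "\<Omega> \<noteq> {}"
  have "- log 2 (agree_frac \<Omega> X w) \<le> log 2 (real (card \<Omega>))" if "w \<in> \<Omega>" for w
  proof -
    have "log 2 (1 / real (card \<Omega>)) \<le> log 2 (agree_frac \<Omega> X w)"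
      using a that agree_frac_ge[OF a(1) that, of X] agree_frac_pos[OF a(1) that, of X]
      by (subst log_le_cancel_iff) (auto simp: card_gt_0_iff)
    then show ?thesis using a by (simp add: log_divide card_gt_0_iff)
  qed
  then show ?thesis unfolding H_unif_avg[OF a] using a by (intro avg_le_const)
qed

lemma H_unif_const_frac:
  assumes "finite \<Omega>" "\<Omega> \<noteq> {}" "\<And>w. w \<in> \<Omega> \<Longrightarrow> agree_frac \<Omega> X w = 1 / c"
  shows "H_unif \<Omega> X = log 2 c"
proof -
  have "H_unif \<Omega> X = avg \<Omega> (\<lambda>w. log 2 c)"
    unfolding H_unif_avg[OF assms(1,2)]
    by (intro avg_cong) (simp add: assms(3) log_recip)
  then show ?thesis using assms by (simp add: avg_const)
qed

lemma H_unif_bij: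
  assumes b: "bij_betw f \<Omega> \<Omega>'" and fin: "finite \<Omega>" "\<Omega> \<noteq> {}"
  shows "H_unif \<Omega> (\<lambda>w. X (f w)) = H_unif \<Omega>' X"
proof -
  have fin': "finite \<Omega>'" "\<Omega>' \<noteq> {}" using b fin by (auto simp: bij_betw_def)
  have "agree_frac \<Omega> (\<lambda>w. X (f w)) w = agree_frac \<Omega>' X (f w)" if "w \<in> \<Omega>" for w
  proof -
    have "bij_betw f {w'\<in>\<Omega>. X (f w') = X (f w)} {w'\<in>\<Omega>'. X w' = X (f w)}"
      using b by (auto simp: bij_betw_def inj_on_def)
    from bij_betw_same_card[OF this] show ?thesis
      by (simp add: agree_frac_def bij_betw_same_card[OF b])
  qed
  then have "H_unif \<Omega> (\<lambda>w. X (f w)) = avg \<Omega> (\<lambda>w. - log 2 (agree_frac \<Omega>' X (f w)))"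
    unfolding H_unif_avg[OF fin] by (intro avg_cong) simp
  also have "\<dots> = H_unif \<Omega>' X"
    unfolding H_unif_avg[OF fin'] by (rule avg_equidist[OF equidist_bij[OF b fin]])
  finally show ?thesis .
qed

lemma avg_of_bool: "finite A \<Longrightarrow> avg A (\<lambda>a. of_bool (P a)) = real (card {a\<in>A. P a}) / real (card A)"
  unfolding avg_def by (simp add: Int_def)

lemma agree_frac_avg: "finite \<Omega> \<Longrightarrow> agree_frac \<Omega> X w = avg \<Omega> (\<lambda>w'. of_bool (X w' = X w))"
  by (simp add: avg_of_bool agree_frac_def)

lemma avg_of_bool_div_agree_frac:
  assumes "finite \<Omega>" "v \<in> \<Omega>"
  shows "avg \<Omega> (\<lambda>w. of_bool (X w = X v) / agree_frac \<Omega> X w) = 1"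
proof -
  have "avg \<Omega> (\<lambda>w. of_bool (X w = X v) / agree_frac \<Omega> X w)
      = avg \<Omega> (\<lambda>w. (1 / agree_frac \<Omega> X v) * of_bool (X w = X v))"
    by (intro avg_cong) (auto simp: agree_frac_def)
  also have "\<dots> = (1 / agree_frac \<Omega> X v) * agree_frac \<Omega> X v"
    unfolding avg_cmult agree_frac_avg[OF assms(1), of X v, symmetric] ..
  also have "\<dots> = 1"
    using agree_frac_pos[OF assms, of X] by simp
  finally show ?thesis .
qed

text \<open>In \<open>H_unif_submodular\<close> the value \<open>x\<close> mixes coordinates of two
  sample points and may lie outside the range of \<open>X\<close>. The average is then 0, which is
  why only an inequality is claimed.\<close>

lemma avg_of_bool_div_agree_frac_le:
  assumes "finite \<Omega>"
  shows "avg \<Omega> (\<lambda>w. of_bool (X w = x) / agree_frac \<Omega> X w) \<le> 1"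
proof (cases "\<exists>v\<in>\<Omega>. X v = x")
  case True
  then show ?thesis using avg_of_bool_div_agree_frac[OF assms, of _ X] by auto
next
  case False
  then have "avg \<Omega> (\<lambda>w. of_bool (X w = x) / agree_frac \<Omega> X w) = avg \<Omega> (\<lambda>w. 0)"
    by (intro avg_cong) auto
  also have "\<dots> \<le> 1" by (simp add: avg_def)
  finally show ?thesis .
qed

section \<open>Divergence and entropy inequalities\<close>

lemma log2_le: "x > 0 \<Longrightarrow> log 2 x \<le> (x - 1) / ln 2" for x :: real
  unfolding log_def by (intro divide_right_mono ln_le_minus_one) auto

text \<open>Jensen's inequality through \<open>ln x \<le> x - 1\<close>: a claim on a mean logarithm
  reduces to the bound 1 on the mean of a likelihood ratio. Data processing, submodularity and the
  codebook bound differ only in the choice of \<open>g\<close>.\<close>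

lemma avg_log_nonpos:
  assumes "finite A" "A \<noteq> {}" "\<And>a. a \<in> A \<Longrightarrow> g a > 0" "avg A g \<le> 1"
  shows "avg A (\<lambda>a. log 2 (g a)) \<le> 0"
proof -
  have "avg A (\<lambda>a. log 2 (g a)) \<le> avg A (\<lambda>a. (1 / ln 2) * (g a - 1))"
    using assms log2_le by (intro avg_mono) fastforce
  also have "\<dots> = (1 / ln 2) * (avg A g - 1)"
    using assms by (simp add: avg_cmult avg_diff avg_const del: times_divide_eq_left mult_cancel_left1)
  also have "\<dots> \<le> 0" using assms by (simp add: divide_le_0_iff)
  finally show ?thesis .
qed

text \<open>The two averages are the divergences of the laws of \<open>X \<circ> \<Phi>\<close> and \<open>Z \<circ> \<Phi>\<close> on \<open>\<Omega>'\<close> from the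
  laws of \<open>X\<close> and \<open>Z\<close> on \<open>\<Omega>\<close>, all sample spaces being uniform.\<close>

lemma divergence_data_processing:
  assumes \<Omega>': "finite \<Omega>'" "\<Omega>' \<noteq> {}" and \<Omega>: "finite \<Omega>" and \<Phi>: "\<And>w. w \<in> \<Omega>' \<Longrightarrow> \<Phi> w \<in> \<Omega>"
    and det: "\<And>u v. u \<in> \<Omega> \<Longrightarrow> v \<in> \<Omega> \<Longrightarrow> Z u = Z v \<Longrightarrow> X u = X v"
  shows "avg \<Omega>' (\<lambda>w. log 2 (agree_frac \<Omega>' (\<lambda>w. X (\<Phi> w)) w / agree_frac \<Omega> X (\<Phi> w)))
    \<le> avg \<Omega>' (\<lambda>w. log 2 (agree_frac \<Omega>' (\<lambda>w. Z (\<Phi> w)) w / agree_frac \<Omega> Z (\<Phi> w)))"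
proof -
  define pX where "pX = (\<lambda>w. agree_frac \<Omega>' (\<lambda>w. X (\<Phi> w)) w)"
  define pZ where "pZ = (\<lambda>w. agree_frac \<Omega>' (\<lambda>w. Z (\<Phi> w)) w)"
  define qX where "qX = agree_frac \<Omega> X"
  define qZ where "qZ = agree_frac \<Omega> Z"
  have pos: "pX w > 0" "pZ w > 0" "qX (\<Phi> w) > 0" "qZ (\<Phi> w) > 0" if "w \<in> \<Omega>'" for w
    using that \<Omega> \<Omega>' \<Phi> by (auto simp: pX_def pZ_def qX_def qZ_def intro!: agree_frac_pos)
  have qpos: "qX u > 0" if "u \<in> \<Omega>" for u
    using that \<Omega> by (simp add: qX_def agree_frac_pos)
  have \<Omega>ne: "\<Omega> \<noteq> {}" using \<Omega>' \<Phi> by auto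
  \<comment> \<open>\<open>g\<close> is the likelihood ratio for \<open>X\<close> divided by that
    for \<open>Z\<close>. To bound its mean, \<open>qZ\<close> is expanded as an average over
    \<open>u\<close> and the two averages are swapped. For fixed \<open>u\<close>, the points
    \<open>w\<close> with \<open>Z (\<Phi> w) = Z u\<close> have total weight \<open>pZ\<close>,
    which cancels; if there is no such point, the contribution is 0, whence an inequality.\<close>
  define g where "g = (\<lambda>w. (pX w / qX (\<Phi> w)) / (pZ w / qZ (\<Phi> w)))"
  have "avg \<Omega>' g = avg \<Omega>' (\<lambda>w. avg \<Omega> (\<lambda>u. (pX w / (qX (\<Phi> w) * pZ w)) * of_bool (Z u = Z (\<Phi> w))))"
    unfolding avg_cmult agree_frac_avg[OF \<Omega>, symmetric]
    by (intro avg_cong) (simp add: g_def qZ_def)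
  also have "\<dots> = avg \<Omega> (\<lambda>u. avg \<Omega>' (\<lambda>w. (pX w / (qX (\<Phi> w) * pZ w)) * of_bool (Z u = Z (\<Phi> w))))"
    by (rule avg_swap)
  also have "\<dots> \<le> avg \<Omega> (\<lambda>u. avg \<Omega>' (\<lambda>w. (1 / qX u) * of_bool (X (\<Phi> w) = X u)))"
  proof (rule avg_mono)
    fix u assume u: "u \<in> \<Omega>"
    show "avg \<Omega>' (\<lambda>w. (pX w / (qX (\<Phi> w) * pZ w)) * of_bool (Z u = Z (\<Phi> w)))
      \<le> avg \<Omega>' (\<lambda>w. (1 / qX u) * of_bool (X (\<Phi> w) = X u))"
    proof (cases "\<exists>v\<in>\<Omega>'. Z u = Z (\<Phi> v)")
      case True
      then obtain v where v: "v \<in> \<Omega>'" "Z u = Z (\<Phi> v)" by auto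
      then have Xv: "X u = X (\<Phi> v)" using u \<Phi> det by blast
      have "avg \<Omega>' (\<lambda>w. (pX w / (qX (\<Phi> w) * pZ w)) * of_bool (Z u = Z (\<Phi> w)))
        = avg \<Omega>' (\<lambda>w. (pX v / (qX u * pZ v)) * of_bool (Z (\<Phi> w) = Z (\<Phi> v)))"
      proof (rule avg_cong)
        fix w assume w: "w \<in> \<Omega>'"
        show "(pX w / (qX (\<Phi> w) * pZ w)) * of_bool (Z u = Z (\<Phi> w))
          = (pX v / (qX u * pZ v)) * of_bool (Z (\<Phi> w) = Z (\<Phi> v))"
        proof (cases "Z (\<Phi> w) = Z (\<Phi> v)")
          case True
          then have "X (\<Phi> w) = X (\<Phi> v)" using w v \<Phi> det by blast
          with True Xv v have "pX w = pX v" "pZ w = pZ v" "qX (\<Phi> w) = qX u"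
            unfolding pX_def pZ_def qX_def agree_frac_def by auto
          with True v show ?thesis by simp
        qed (use v in auto)
      qed
      also have "\<dots> = pX v / qX u"
        unfolding avg_cmult agree_frac_avg[OF \<Omega>'(1), of "\<lambda>w. Z (\<Phi> w)", symmetric]
        using pos(2)[OF v(1)] by (simp add: pZ_def)
      also have "\<dots> = avg \<Omega>' (\<lambda>w. (1 / qX u) * of_bool (X (\<Phi> w) = X u))"
        unfolding avg_cmult Xv pX_def by (simp add: agree_frac_avg[OF \<Omega>'(1)])
      finally show ?thesis by simp
    next
      case False
      then have "avg \<Omega>' (\<lambda>w. (pX w / (qX (\<Phi> w) * pZ w)) * of_bool (Z u = Z (\<Phi> w)))
         = avg \<Omega>' (\<lambda>w. 0)"
        by (intro avg_cong) auto
      also have "\<dots> \<le> avg \<Omega>' (\<lambda>w. (1 / qX u) * of_bool (X (\<Phi> w) = X u))"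
        using qpos[OF u] by (intro avg_mono) auto
      finally show ?thesis .
    qed
  qed
  also have "\<dots> = avg \<Omega>' (\<lambda>w. avg \<Omega> (\<lambda>u. of_bool (X u = X (\<Phi> w)) / qX u))"
    by (subst avg_swap, intro avg_cong) auto
  also have "\<dots> = avg \<Omega>' (\<lambda>w. 1)"
    unfolding qX_def using \<Omega> \<Phi> by (intro avg_cong avg_of_bool_div_agree_frac) auto
  also have "\<dots> = 1" using \<Omega>' by (simp add: avg_const)
  finally have "avg \<Omega>' g \<le> 1" .
  then have "avg \<Omega>' (\<lambda>w. log 2 (g w)) \<le> 0"
    using \<Omega>' pos by (intro avg_log_nonpos) (auto simp: g_def)
  also have "avg \<Omega>' (\<lambda>w. log 2 (g w))
     = avg \<Omega>' (\<lambda>w. log 2 (pX w / qX (\<Phi> w)) - log 2 (pZ w / qZ (\<Phi> w)))"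
    unfolding g_def
  proof (rule avg_cong)
    fix w assume "w \<in> \<Omega>'"
    from pos[OF this] have "pX w / qX (\<Phi> w) > 0" "pZ w / qZ (\<Phi> w) > 0" by auto
    then show "log 2 (pX w / qX (\<Phi> w) / (pZ w / qZ (\<Phi> w)))
       = log 2 (pX w / qX (\<Phi> w)) - log 2 (pZ w / qZ (\<Phi> w))"
      by (rule log_divide_pos)
  qed
  finally show ?thesis
    unfolding avg_diff pX_def pZ_def qX_def qZ_def by simp
qed

text \<open>Data processing towards a constant \<open>X\<close>, for which both fractions are
  1.\<close>

lemma divergence_nonneg:
  assumes "finite \<Omega>'" "\<Omega>' \<noteq> {}" "finite \<Omega>" "\<And>w. w \<in> \<Omega>' \<Longrightarrow> \<Phi> w \<in> \<Omega>"
  shows "0 \<le> avg \<Omega>' (\<lambda>w. log 2 (agree_frac \<Omega>' (\<lambda>w. Z (\<Phi> w)) w / agree_frac \<Omega> Z (\<Phi> w)))"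
proof -
  have "card \<Omega> \<noteq> 0" using assms by (auto simp: card_eq_0_iff)
  then have "avg \<Omega>' (\<lambda>w. log 2 (agree_frac \<Omega>' (\<lambda>w. ()) w / agree_frac \<Omega> (\<lambda>w. ()) (\<Phi> w))) = 0"
    using assms by (simp add: agree_frac_def avg_def)
  then show ?thesis
    using divergence_data_processing[where \<Phi> = \<Phi> and Z = Z and X = "\<lambda>_. ()", OF assms] by simp
qed

text \<open>Nonnegativity of the mutual information of \<open>B\<close> and \<open>C\<close> given
  \<open>A\<close>. Both numerators of \<open>g\<close> are expanded as averages over points
  \<open>u\<close> and \<open>v\<close>; averaging over \<open>w\<close> first cancels
  \<open>q\<close> and leaves the indicator of \<open>A v = A u\<close> weighted by
  \<open>1 / qA v\<close>, whose mean is at most 1.\<close>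

lemma H_unif_submodular:
  assumes \<Omega>: "finite \<Omega>" "\<Omega> \<noteq> {}"
  shows "H_unif \<Omega> (\<lambda>w. (A w, B w, C w)) + H_unif \<Omega> A
    \<le> H_unif \<Omega> (\<lambda>w. (A w, B w)) + H_unif \<Omega> (\<lambda>w. (A w, C w))"
proof -
  define qA where "qA = agree_frac \<Omega> A"
  define qAB where "qAB = agree_frac \<Omega> (\<lambda>w. (A w, B w))"
  define qAC where "qAC = agree_frac \<Omega> (\<lambda>w. (A w, C w))"
  define q where "q = agree_frac \<Omega> (\<lambda>w. (A w, B w, C w))"
  have pos: "qA w > 0" "qAB w > 0" "qAC w > 0" "q w > 0" if "w \<in> \<Omega>" for w
    using that \<Omega> by (auto simp: qA_def qAB_def qAC_def q_def intro!: agree_frac_pos)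
  define g where "g = (\<lambda>w. qAB w * qAC w / (q w * qA w))"
  have "avg \<Omega> g = avg \<Omega> (\<lambda>w. avg \<Omega> (\<lambda>u. avg \<Omega> (\<lambda>v.
      (of_bool ((A u, B u) = (A w, B w)) / (q w * qA w)) * of_bool ((A v, C v) = (A w, C w)))))"
    unfolding avg_cmult agree_frac_avg[OF \<Omega>(1), of "\<lambda>w. (A w, C w)", symmetric]
  proof (rule avg_cong)
    fix w assume "w \<in> \<Omega>"
    have "avg \<Omega> (\<lambda>u. of_bool ((A u, B u) = (A w, B w)) / (q w * qA w) * agree_frac \<Omega> (\<lambda>w. (A w, C w)) w)
      = avg \<Omega> (\<lambda>u. (qAC w / (q w * qA w)) * of_bool ((A u, B u) = (A w, B w)))"
      by (intro avg_cong) (simp add: qAC_def)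
    also have "\<dots> = g w"
      unfolding avg_cmult agree_frac_avg[OF \<Omega>(1), of "\<lambda>w. (A w, B w)", symmetric]
      by (simp add: g_def qAB_def)
    finally show "g w = avg \<Omega> (\<lambda>u. of_bool ((A u, B u) = (A w, B w)) / (q w * qA w)
        * agree_frac \<Omega> (\<lambda>w. (A w, C w)) w)" by simp
  qed
  also have "\<dots> = avg \<Omega> (\<lambda>u. avg \<Omega> (\<lambda>w. avg \<Omega> (\<lambda>v.
      (of_bool ((A u, B u) = (A w, B w)) / (q w * qA w)) * of_bool ((A v, C v) = (A w, C w)))))"
    by (rule avg_swap)
  also have "\<dots> = avg \<Omega> (\<lambda>u. avg \<Omega> (\<lambda>v. avg \<Omega> (\<lambda>w.
      (of_bool ((A u, B u) = (A w, B w)) / (q w * qA w)) * of_bool ((A v, C v) = (A w, C w)))))"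
    by (subst avg_swap) (rule refl)
  also have "\<dots> \<le> avg \<Omega> (\<lambda>u. avg \<Omega> (\<lambda>v. of_bool (A v = A u) / qA v))"
  proof (intro avg_mono)
    fix u v assume uv: "u \<in> \<Omega>" "v \<in> \<Omega>"
    have "avg \<Omega> (\<lambda>w. (of_bool ((A u, B u) = (A w, B w)) / (q w * qA w)) * of_bool ((A v, C v) = (A w, C w)))
      = avg \<Omega> (\<lambda>w. (of_bool (A v = A u) / qA v) * (of_bool ((A w, B w, C w) = (A u, B u, C v)) / q w))"
      by (intro avg_cong) (auto simp: qA_def agree_frac_def)
    also have "\<dots> \<le> (of_bool (A v = A u) / qA v) * 1"
      unfolding avg_cmult q_def using pos(1)[OF uv(2)] \<Omega>(1)
      by (intro mult_left_mono avg_of_bool_div_agree_frac_le) auto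
    finally show "avg \<Omega> (\<lambda>w. (of_bool ((A u, B u) = (A w, B w)) / (q w * qA w)) * of_bool ((A v, C v) = (A w, C w)))
      \<le> of_bool (A v = A u) / qA v" by simp
  qed
  also have "\<dots> \<le> 1"
    unfolding qA_def using \<Omega> by (intro avg_le_const avg_of_bool_div_agree_frac_le) auto
  finally have "avg \<Omega> g \<le> 1" .
  then have "avg \<Omega> (\<lambda>w. log 2 (g w)) \<le> 0"
    using \<Omega> pos by (intro avg_log_nonpos) (auto simp: g_def)
  also have "avg \<Omega> (\<lambda>w. log 2 (g w))
     = avg \<Omega> (\<lambda>w. (- log 2 (q w) + - log 2 (qA w)) - (- log 2 (qAB w) + - log 2 (qAC w)))"
  proof (rule avg_cong)
    fix w assume "w \<in> \<Omega>"
    from pos[OF this] show "log 2 (g w)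
       = (- log 2 (q w) + - log 2 (qA w)) - (- log 2 (qAB w) + - log 2 (qAC w))"
      unfolding g_def by (simp add: log_divide_pos log_mult_pos)
  qed
  finally show ?thesis
    unfolding avg_diff avg_add H_unif_avg[OF \<Omega>] qA_def qAB_def qAC_def q_def by simp
qed

text \<open>Submodularity with a constant conditioning variable.\<close>

lemma H_unif_subadditive:
  assumes \<Omega>: "finite \<Omega>" "\<Omega> \<noteq> {}"
  shows "H_unif \<Omega> (\<lambda>w. (X w, Y w)) \<le> H_unif \<Omega> X + H_unif \<Omega> Y"
proof -
  have "H_unif \<Omega> (\<lambda>w. ()) = log 2 1"
    using \<Omega> by (intro H_unif_const_frac) (auto simp: agree_frac_def)
  moreover have "H_unif \<Omega> (\<lambda>w. ((), X w, Y w)) = H_unif \<Omega> (\<lambda>w. (X w, Y w))"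
    "H_unif \<Omega> (\<lambda>w. ((), X w)) = H_unif \<Omega> X" "H_unif \<Omega> (\<lambda>w. ((), Y w)) = H_unif \<Omega> Y"
    by (rule H_unif_cong[OF \<Omega>]; simp)+
  ultimately show ?thesis
    using H_unif_submodular[OF \<Omega>, of "\<lambda>_. ()" X Y] by simp
qed

lemma H_unif_mono:
  assumes \<Omega>: "finite \<Omega>" "\<Omega> \<noteq> {}" and "\<And>u v. u \<in> \<Omega> \<Longrightarrow> v \<in> \<Omega> \<Longrightarrow> Y u = Y v \<Longrightarrow> X u = X v"
  shows "H_unif \<Omega> X \<le> H_unif \<Omega> Y"
  unfolding H_unif_avg[OF \<Omega>]
proof (rule avg_mono)
  fix w assume w: "w \<in> \<Omega>"
  have "{v\<in>\<Omega>. Y v = Y w} \<subseteq> {v\<in>\<Omega>. X v = X w}"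
    using w assms(3) by blast
  then have "agree_frac \<Omega> Y w \<le> agree_frac \<Omega> X w"
    unfolding agree_frac_def using \<Omega>(1)
    by (intro divide_right_mono of_nat_mono card_mono) simp_all
  then show "- log 2 (agree_frac \<Omega> X w) \<le> - log 2 (agree_frac \<Omega> Y w)"
    using \<Omega> w by (simp add: agree_frac_pos)
qed

lemma H_unif_sum_le:
  fixes X :: "'i \<Rightarrow> 'w \<Rightarrow> 'a"
  assumes \<Omega>: "finite \<Omega>" "\<Omega> \<noteq> {}" and "finite I"
  shows "H_unif \<Omega> (\<lambda>w i. if i \<in> I then X i w else d) \<le> (\<Sum>i\<in>I. H_unif \<Omega> (X i))"
  using assms(3)
proof (induction I rule: finite_induct)
  case empty
  have "H_unif \<Omega> (\<lambda>w (i::'i). d) = log 2 1"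
    using \<Omega> by (intro H_unif_const_frac) (auto simp: agree_frac_def)
  then show ?case by simp
next
  case (insert j I)
  have "H_unif \<Omega> (\<lambda>w i. if i \<in> insert j I then X i w else d)
     \<le> H_unif \<Omega> (\<lambda>w. (X j w, \<lambda>i. if i \<in> I then X i w else d))"
  proof (rule H_unif_mono[OF \<Omega>], rule ext)
    fix u v i
    assume "(X j u, \<lambda>i. if i \<in> I then X i u else d) = (X j v, \<lambda>i. if i \<in> I then X i v else d)"
    then have "X j u = X j v" "(if i \<in> I then X i u else d) = (if i \<in> I then X i v else d)"
      by (auto dest: fun_cong[of _ _ i])
    then show "(if i \<in> insert j I then X i u else d) = (if i \<in> insert j I then X i v else d)"
      by auto
  qed
  also have "\<dots> \<le> H_unif \<Omega> (X j) + H_unif \<Omega> (\<lambda>w i. if i \<in> I then X i w else d)"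
    using \<Omega> by (rule H_unif_subadditive)
  finally show ?case using insert by simp
qed

section \<open>Divergence of a random codebook\<close>

text \<open>The logarithm is bounded by its tangent at \<open>1 + 1 / (J * P)\<close>, which depends on the \<open>j\<close>-th
  codeword only. After averaging over that codeword, only pairwise independence matters.\<close>

lemma random_codebook_divergence:
  fixes J :: nat
  assumes K: "finite K" "K \<noteq> {}" and j: "j < J"
  shows "avg (PiE {..<J} (\<lambda>_. K))
      (\<lambda>\<kappa>. log 2 (agree_frac {..<J} (\<lambda>i. Y (\<kappa> i)) j / agree_frac K Y (\<kappa> j)))
    \<le> avg K (\<lambda>k. log 2 (1 + 1 / (J * agree_frac K Y k)))"
proof -
  define P where "P = agree_frac K Y"
  define G where "G = PiE {..<J} (\<lambda>_. K)"
  define t where "t = (\<lambda>k. 1 + 1 / (J * P k))"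
  define x where "x = (\<lambda>\<kappa>. agree_frac {..<J} (\<lambda>i. Y (\<kappa> i)) j / P (\<kappa> j))"
  have J: "real J > 0" using j by simp
  have G: "finite G" "G \<noteq> {}" unfolding G_def using K by (auto simp: finite_PiE PiE_eq_empty_iff)
  have P: "P k > 0" if "k \<in> K" for k using K that by (simp add: P_def agree_frac_pos)
  have GK: "\<kappa> j \<in> K" if "\<kappa> \<in> G" for \<kappa> using that j by (auto simp: G_def)
  have comp: "avg G (\<lambda>\<kappa>. f (\<kappa> j)) = avg K f" for f
    unfolding G_def using K j by (intro avg_PiE_component) auto
  \<comment> \<open>The \<open>j\<close>-th codeword is compared with every codeword
    \<open>i\<close>: it agrees with itself surely, and with any other one with probability
    \<open>P\<close>. The denominator comes from dividing by \<open>t\<close>.\<close>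
  have row: "avg G (\<lambda>\<kappa>. of_bool (Y (\<kappa> i) = Y (\<kappa> j)) / (J * P (\<kappa> j) + 1))
     = (if i = j then avg K (\<lambda>k. 1 / (J * P k + 1)) else avg K (\<lambda>k. P k / (J * P k + 1)))"
    if i: "i < J" for i
  proof (cases "i = j")
    case True
    then show ?thesis using comp[of "\<lambda>k. 1 / (J * P k + 1)"] by simp
  next
    case False
    have "avg G (\<lambda>\<kappa>. of_bool (Y (\<kappa> i) = Y (\<kappa> j)) / (J * P (\<kappa> j) + 1))
      = avg (K \<times> K) (\<lambda>(k, k'). of_bool (Y k' = Y k) / (J * P k + 1))"
      using avg_equidist[OF equidist_two_components[of "{..<J}" j i K],
          of "\<lambda>(k, k'). of_bool (Y k' = Y k) / (J * P k + 1)"] False i j K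
      by (simp add: G_def)
    also have "\<dots> = avg K (\<lambda>k. avg K (\<lambda>k'. (1 / (J * P k + 1)) * of_bool (Y k' = Y k)))"
      by (simp add: avg_times)
    also have "\<dots> = avg K (\<lambda>k. P k / (J * P k + 1))"
      unfolding avg_cmult agree_frac_avg[OF K(1), symmetric] by (simp add: P_def)
    finally show ?thesis using False by simp
  qed
  have "avg G (\<lambda>\<kappa>. x \<kappa> / t (\<kappa> j))
     = avg G (\<lambda>\<kappa>. \<Sum>i<J. of_bool (Y (\<kappa> i) = Y (\<kappa> j)) / (J * P (\<kappa> j) + 1))"
  proof (rule avg_cong)
    fix \<kappa> assume "\<kappa> \<in> G"
    then have p: "P (\<kappa> j) > 0" by (simp add: P GK)
    have "x \<kappa> / t (\<kappa> j) = real (card {i\<in>{..<J}. Y (\<kappa> i) = Y (\<kappa> j)}) / (J * P (\<kappa> j) + 1)"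
      unfolding x_def t_def agree_frac_def using p J by (simp add: field_simps)
    also have "real (card {i\<in>{..<J}. Y (\<kappa> i) = Y (\<kappa> j)}) = (\<Sum>i<J. of_bool (Y (\<kappa> i) = Y (\<kappa> j)))"
      by (simp add: Int_def)
    finally show "x \<kappa> / t (\<kappa> j) = (\<Sum>i<J. of_bool (Y (\<kappa> i) = Y (\<kappa> j)) / (J * P (\<kappa> j) + 1))"
      by (simp only: sum_divide_distrib)
  qed
  also have "\<dots> = (\<Sum>i<J. if i = j then avg K (\<lambda>k. 1 / (J * P k + 1)) else avg K (\<lambda>k. P k / (J * P k + 1)))"
    unfolding avg_sum by (intro sum.cong) (simp_all add: row)
  also have "\<dots> = avg K (\<lambda>k. 1 / (J * P k + 1)) + (\<Sum>i\<in>{..<J} - {j}. avg K (\<lambda>k. P k / (J * P k + 1)))"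
    using j by (subst sum.remove[of _ j]) auto
  also have "\<dots> = avg K (\<lambda>k. 1 / (J * P k + 1) + (real J - 1) * (P k / (J * P k + 1)))"
    unfolding avg_add avg_cmult using j by (simp add: of_nat_diff)
  \<comment> \<open>One certain agreement plus \<open>J - 1\<close> chance ones gives
    \<open>1 + (J - 1) * P\<close>, against the normaliser \<open>J * P + 1\<close>.\<close>
  also have "\<dots> \<le> 1"
  proof (rule avg_le_const[OF K])
    fix k assume "k \<in> K"
    then have p: "P k > 0" by (rule P)
    then have "1 / (J * P k + 1) + (real J - 1) * (P k / (J * P k + 1)) = (1 + (real J - 1) * P k) / (J * P k + 1)"
      by (simp add: add_divide_distrib)
    also have "\<dots> \<le> 1" using p J by (subst divide_le_eq_1_pos) (auto simp: add_pos_nonneg algebra_simps)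
    finally show "1 / (J * P k + 1) + (real J - 1) * (P k / (J * P k + 1)) \<le> 1" .
  qed
  finally have le1: "avg G (\<lambda>\<kappa>. x \<kappa> / t (\<kappa> j)) \<le> 1" .
  have tpos: "t k > 0" if "k \<in> K" for k using P[OF that] J by (simp add: t_def add_pos_nonneg)
  have xpos: "x \<kappa> > 0" if "\<kappa> \<in> G" for \<kappa>
    unfolding x_def using j P[OF GK[OF that]] by (auto intro!: divide_pos_pos agree_frac_pos)
  have "avg G (\<lambda>\<kappa>. log 2 (x \<kappa> / t (\<kappa> j))) \<le> 0"
    using G le1 xpos tpos GK by (intro avg_log_nonpos) auto
  also have "avg G (\<lambda>\<kappa>. log 2 (x \<kappa> / t (\<kappa> j))) = avg G (\<lambda>\<kappa>. log 2 (x \<kappa>) - log 2 (t (\<kappa> j)))"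
    using xpos tpos GK by (intro avg_cong log_divide_pos) auto
  finally have "avg G (\<lambda>\<kappa>. log 2 (x \<kappa>)) \<le> avg K (\<lambda>k. log 2 (t k))"
    unfolding avg_diff using comp[of "\<lambda>k. log 2 (t k)"] by simp
  then show ?thesis unfolding G_def x_def t_def P_def .
qed

text \<open>A power is multiplicative over independent blocks, which \<open>ln (1 + x)\<close> is
  not. Up to 1 the bound comes from \<open>ln (1 + x) \<le> x \<le> x powr \<theta>\<close>, beyond
  1 from \<open>ln x = ln (x powr \<theta>) / \<theta>\<close>; the factor 2 leaves room for the
  \<open>ln 2\<close> of \<open>1 + x \<le> 2 * x\<close>.\<close>

lemma ln_one_plus_le_powr:
  fixes x \<theta> :: real
  assumes x: "0 < x" and \<theta>: "0 < \<theta>" "\<theta> \<le> 1"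
  shows "ln (1 + x) \<le> 2 / \<theta> * x powr \<theta>"
proof -
  have inv: "1 \<le> 1 / \<theta>" using \<theta> by simp
  have le: "x powr \<theta> \<le> 1 / \<theta> * x powr \<theta>"
    using mult_right_mono[OF inv, of "x powr \<theta>"] by simp
  have nn: "0 \<le> 1 / \<theta> * x powr \<theta>" using \<theta> by simp
  show ?thesis
  proof (cases "x \<le> 1")
    case True
    have "ln (1 + x) \<le> x" using x by (intro ln_add_one_self_le_self) simp
    also have "x = x powr 1" using x by simp
    also have "\<dots> \<le> x powr \<theta>" using x True \<theta> by (intro powr_mono') auto
    finally show ?thesis using le nn by simp
  next
    case False
    then have x1: "1 < x" by simp
    have "ln (1 + x) \<le> ln (2 * x)" using x1 by (subst ln_le_cancel_iff) auto
    also have "\<dots> = ln 2 + ln x" using x by (simp add: ln_mult)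
    also have "ln 2 \<le> x powr \<theta>"
      using ge_one_powr_ge_zero[of x \<theta>] x1 \<theta> ln_le_minus_one[of "2::real"] by simp
    also have "ln x = 1 / \<theta> * ln (x powr \<theta>)" using x \<theta> by (simp add: ln_powr)
    also have "\<dots> \<le> 1 / \<theta> * x powr \<theta>"
      using x \<theta> by (intro mult_left_mono less_imp_le[OF ln_less_self]) auto
    finally show ?thesis using le by simp
  qed
qed

text \<open>The derivative at \<open>\<theta> = 0\<close> of \<open>avg A (\<lambda>a. p a powr (- \<theta>)) - 2 powr (R * \<theta>)\<close> is negative.\<close>

lemma exponential_moment_bound:
  fixes p :: "'a \<Rightarrow> real"
  assumes A: "finite A" "A \<noteq> {}" and p: "\<And>a. a \<in> A \<Longrightarrow> 0 < p a"
    and R: "avg A (\<lambda>a. - log 2 (p a)) < R"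
  shows "\<exists>\<theta>. 0 < \<theta> \<and> \<theta> \<le> 1 \<and> avg A (\<lambda>a. p a powr (- \<theta>)) \<le> 2 powr (R * \<theta>)"
proof -
  define f where "f = (\<lambda>\<theta>. avg A (\<lambda>a. p a powr (- \<theta>)) - 2 powr (R * \<theta>))"
  have f0: "f 0 = 0"
  proof -
    have "avg A (\<lambda>a. p a powr (- 0)) = avg A (\<lambda>a. 1)"
      by (intro avg_cong) (use p in force)
    then show ?thesis using A by (simp add: f_def avg_const)
  qed
  have "(f has_real_derivative (\<Sum>a\<in>A. - ln (p a) * p a powr (- 0)) / real (card A) - R * ln 2 * 2 powr (R * 0)) (at 0)"
    unfolding f_def avg_def using A
    by (auto intro!: derivative_eq_intros sum.cong simp: powr_def p)
  moreover have "(\<Sum>a\<in>A. - ln (p a) * p a powr (- 0)) / real (card A) = ln 2 * avg A (\<lambda>a. - log 2 (p a))"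
  proof -
    have "(\<Sum>a\<in>A. - ln (p a) * p a powr (- 0)) = (\<Sum>a\<in>A. ln 2 * (- log 2 (p a)))"
      by (intro sum.cong) (use p in \<open>force simp: log_def\<close>)+
    then show ?thesis by (simp add: avg_def sum_distrib_left)
  qed
  ultimately have d: "(f has_real_derivative ln 2 * (avg A (\<lambda>a. - log 2 (p a)) - R)) (at 0)"
    by (simp add: algebra_simps)
  have "ln 2 * (avg A (\<lambda>a. - log 2 (p a)) - R) < 0"
    using R by (simp add: mult_less_0_iff)
  from DERIV_neg_dec_right[OF d this] obtain e where e: "e > 0" "\<And>h. 0 < h \<Longrightarrow> h < e \<Longrightarrow> f h < 0"
    using f0 by auto
  have "f (min 1 (e / 2)) < 0" using e by (intro e(2)) auto
  then show ?thesis using e(1) by (intro exI[of _ "min 1 (e / 2)"]) (auto simp: f_def)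
qed

section \<open>Codes and their entropy vectors\<close>

lemma log2_prod:
  "finite I \<Longrightarrow> (\<And>i. i \<in> I \<Longrightarrow> f i \<noteq> 0) \<Longrightarrow> log 2 (\<Prod>i\<in>I. f i) = (\<Sum>i\<in>I. log 2 (f i))"
  for f :: "'i \<Rightarrow> real"
  by (simp add: log_def ln_prod sum_divide_distrib)

locale network =
  fixes V :: "'v set" and E :: "'e set" and tail head :: "'e \<Rightarrow> 'v"
    and S T :: "'v set" and beta :: "'v \<Rightarrow> 'v set"
    and c :: "'e \<Rightarrow> real" and A :: "'e set set"
  assumes net: "wiretap_network V E tail head S T beta c A"
begin

lemma finite_S: "finite S" and finite_E: "finite E"
  using net unfolding wiretap_network_def by (auto intro: finite_subset)

definition outcomes :: "('v \<Rightarrow> 'm set) \<Rightarrow> ('v \<Rightarrow> 'k set) \<Rightarrow> (('v \<Rightarrow> 'm) \<times> ('v \<Rightarrow> 'k)) set" where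
  "outcomes Ms Ks = PiE S Ms \<times> PiE S Ks"

text \<open>Functional dependence is expressed through agreement of outcomes. Only the source encoders \<open>F\<close>
  are kept explicit, because the codebook argument varies the key at a fixed message.\<close>

definition code :: "('v \<Rightarrow> 'm set) \<Rightarrow> ('v \<Rightarrow> 'k set) \<Rightarrow> ('e \<Rightarrow> 'm \<Rightarrow> 'k \<Rightarrow> 'a)
    \<Rightarrow> ('e \<Rightarrow> ('v \<Rightarrow> 'm) \<times> ('v \<Rightarrow> 'k) \<Rightarrow> 'a) \<Rightarrow> bool" where
  "code Ms Ks F W \<longleftrightarrow>
     (\<forall>s\<in>S. finite (Ms s) \<and> Ms s \<noteq> {} \<and> finite (Ks s) \<and> Ks s \<noteq> {}) \<and>
     (\<forall>s\<in>S. \<forall>e\<in>Out E tail s. \<forall>\<omega>\<in>outcomes Ms Ks. W e \<omega> = F e (fst \<omega> s) (snd \<omega> s)) \<and>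
     (\<forall>v\<in>V - (S \<union> T). \<forall>e\<in>Out E tail v. \<forall>\<omega>\<in>outcomes Ms Ks. \<forall>\<omega>'\<in>outcomes Ms Ks.
        (\<forall>e'\<in>In E head v. W e' \<omega> = W e' \<omega>') \<longrightarrow> W e \<omega> = W e \<omega>') \<and>
     (\<forall>t\<in>T. \<forall>s\<in>beta t. \<forall>\<omega>\<in>outcomes Ms Ks. \<forall>\<omega>'\<in>outcomes Ms Ks.
        (\<forall>e\<in>In E head t. W e \<omega> = W e \<omega>') \<longrightarrow> fst \<omega> s = fst \<omega>' s)"

lemma code_sets:
  assumes "code Ms Ks F W" "s \<in> S"
  shows "finite (Ms s)" "Ms s \<noteq> {}" "finite (Ks s)" "Ks s \<noteq> {}"
  using assms unfolding code_def by auto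

lemma code_source:
  "code Ms Ks F W \<Longrightarrow> s \<in> S \<Longrightarrow> e \<in> Out E tail s \<Longrightarrow> \<omega> \<in> outcomes Ms Ks
    \<Longrightarrow> W e \<omega> = F e (fst \<omega> s) (snd \<omega> s)"
  unfolding code_def by simp

lemma code_inner:
  "code Ms Ks F W \<Longrightarrow> v \<in> V - (S \<union> T) \<Longrightarrow> e \<in> Out E tail v \<Longrightarrow> \<omega> \<in> outcomes Ms Ks
    \<Longrightarrow> \<omega>' \<in> outcomes Ms Ks \<Longrightarrow> (\<And>e'. e' \<in> In E head v \<Longrightarrow> W e' \<omega> = W e' \<omega>') \<Longrightarrow> W e \<omega> = W e \<omega>'"
  unfolding code_def by blast

lemma code_decode:
  "code Ms Ks F W \<Longrightarrow> t \<in> T \<Longrightarrow> s \<in> beta t \<Longrightarrow> \<omega> \<in> outcomes Ms Ks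
    \<Longrightarrow> \<omega>' \<in> outcomes Ms Ks \<Longrightarrow> (\<And>e. e \<in> In E head t \<Longrightarrow> W e \<omega> = W e \<omega>') \<Longrightarrow> fst \<omega> s = fst \<omega>' s"
  unfolding code_def by blast

lemma outcomes_finite:
  assumes "code Ms Ks F W"
  shows "finite (outcomes Ms Ks)" "outcomes Ms Ks \<noteq> {}"
  using code_sets[OF assms] finite_S unfolding outcomes_def
  by (auto simp: PiE_eq_empty_iff intro!: finite_PiE)

lemma log_card_outcomes:
  assumes C: "code Ms Ks F W"
  shows "log 2 (card (outcomes Ms Ks)) = (\<Sum>s\<in>S. log 2 (card (Ms s)) + log 2 (card (Ks s)))"
proof -
  have pos: "card (Ms s) > 0" "card (Ks s) > 0" if "s \<in> S" for s
    using code_sets[OF C that] by (auto simp: card_gt_0_iff)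
  have "real (card (outcomes Ms Ks)) = (\<Prod>s\<in>S. real (card (Ms s)) * real (card (Ks s)))"
    by (simp add: outcomes_def card_cartesian_product card_PiE finite_S prod.distrib)
  also have "log 2 \<dots> = (\<Sum>s\<in>S. log 2 (real (card (Ms s)) * real (card (Ks s))))"
    using pos finite_S by (intro log2_prod) auto
  also have "\<dots> = (\<Sum>s\<in>S. log 2 (card (Ms s)) + log 2 (card (Ks s)))"
    using pos by (intro sum.cong refl log_mult_pos) auto
  finally show ?thesis .
qed

text \<open>Induction along the acyclic edge relation: the symbols leaving an inner vertex are fixed
  by those entering it, vertices of \<open>T\<close> have no outgoing edge, and sources are covered
  by \<open>agree\<close>. It is the reason why the effect of a codebook on any wiretap set can be
  measured at the sources.\<close>

lemma code_edges_determined: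
  assumes C: "code Ms Ks F W" and \<omega>: "\<omega> \<in> outcomes Ms Ks" "\<omega>' \<in> outcomes Ms Ks"
    and agree: "\<And>s e. s \<in> S \<Longrightarrow> e \<in> Out E tail s \<Longrightarrow> W e \<omega> = W e \<omega>'"
    and e: "e \<in> E"
  shows "W e \<omega> = W e \<omega>'"
proof -
  define r where "r = {(tail e, head e) | e. e \<in> E}"
  have "finite r" unfolding r_def using finite_E by simp
  moreover have "acyclic r" using net unfolding r_def wiretap_network_def by auto
  ultimately have wf: "wf r" by (rule finite_acyclic_wf)
  have "\<forall>e\<in>Out E tail v. W e \<omega> = W e \<omega>'" for v
  proof (induction v rule: wf_induct_rule[OF wf])
    case (1 v)
    show ?case
    proof
      fix e assume e: "e \<in> Out E tail v"
      then have v: "v \<in> V" using net by (auto simp: Out_def wiretap_network_def)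
      consider "v \<in> S" | "v \<in> T" | "v \<in> V - (S \<union> T)" using v by auto
      then show "W e \<omega> = W e \<omega>'"
      proof cases
        case 2
        then show ?thesis using e net by (auto simp: wiretap_network_def)
      next
        case 3
        show ?thesis
        proof (rule code_inner[OF C 3 e \<omega>])
          fix e' assume e': "e' \<in> In E head v"
          then have "(tail e', v) \<in> r" by (auto simp: In_def r_def)
          from 1[OF this] e' show "W e' \<omega> = W e' \<omega>'" by (auto simp: In_def Out_def)
        qed
      qed (use agree e in blast)
    qed
  qed
  then show ?thesis using e by (auto simp: Out_def)
qed

section \<open>The entropy vector of a code\<close>

text \<open>The sum type gives all labels one alphabet, so that a set of labels is a single random
  variable.\<close>

fun label_value :: "('e \<Rightarrow> ('v \<Rightarrow> 'm) \<times> ('v \<Rightarrow> 'k) \<Rightarrow> 'a) \<Rightarrow> ('v, 'e) label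
    \<Rightarrow> ('v \<Rightarrow> 'm) \<times> ('v \<Rightarrow> 'k) \<Rightarrow> 'm + 'k + 'a" where
  "label_value W (Msg s) \<omega> = Inl (fst \<omega> s)"
| "label_value W (Key s) \<omega> = Inr (Inl (snd \<omega> s))"
| "label_value W (Edge e) \<omega> = Inr (Inr (W e \<omega>))"

definition code_entropy :: "('v \<Rightarrow> 'm set) \<Rightarrow> ('v \<Rightarrow> 'k set)
    \<Rightarrow> ('e \<Rightarrow> ('v \<Rightarrow> 'm) \<times> ('v \<Rightarrow> 'k) \<Rightarrow> 'a) \<Rightarrow> ('v, 'e) label set \<Rightarrow> real" where
  "code_entropy Ms Ks W \<gamma> = (if \<gamma> \<subseteq> labels S E
     then H_unif (outcomes Ms Ks) (\<lambda>\<omega> l. if l \<in> \<gamma> then Some (label_value W l \<omega>) else None) else 0)"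

lemma code_entropy_eq:
  assumes C: "code Ms Ks F W" and \<gamma>: "\<gamma> \<subseteq> labels S E"
    and X: "\<And>\<omega> \<omega>'. \<omega> \<in> outcomes Ms Ks \<Longrightarrow> \<omega>' \<in> outcomes Ms Ks \<Longrightarrow>
      X \<omega> = X \<omega>' \<longleftrightarrow> (\<forall>l\<in>\<gamma>. label_value W l \<omega> = label_value W l \<omega>')"
  shows "code_entropy Ms Ks W \<gamma> = H_unif (outcomes Ms Ks) X"
proof -
  have "H_unif (outcomes Ms Ks) (\<lambda>\<omega> l. if l \<in> \<gamma> then Some (label_value W l \<omega>) else None)
     = H_unif (outcomes Ms Ks) X"
  proof (rule H_unif_cong[OF outcomes_finite[OF C]])
    fix w w' assume "w \<in> outcomes Ms Ks" "w' \<in> outcomes Ms Ks"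
    then show "((\<lambda>l. if l \<in> \<gamma> then Some (label_value W l w') else None)
        = (\<lambda>l. if l \<in> \<gamma> then Some (label_value W l w) else None)) \<longleftrightarrow> X w' = X w"
      using X by (simp add: fun_eq_iff) metis
  qed
  then show ?thesis using \<gamma> by (simp add: code_entropy_def)
qed

lemma code_entropy_cong:
  assumes C: "code Ms Ks F W" and \<gamma>: "\<gamma> \<subseteq> labels S E" "\<delta> \<subseteq> labels S E"
    and eq: "\<And>\<omega> \<omega>'. \<omega> \<in> outcomes Ms Ks \<Longrightarrow> \<omega>' \<in> outcomes Ms Ks \<Longrightarrow>
      (\<forall>l\<in>\<delta>. label_value W l \<omega> = label_value W l \<omega>') \<longleftrightarrow> (\<forall>l\<in>\<gamma>. label_value W l \<omega> = label_value W l \<omega>')"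
  shows "code_entropy Ms Ks W \<gamma> = code_entropy Ms Ks W \<delta>"
proof -
  have "code_entropy Ms Ks W \<gamma>
    = H_unif (outcomes Ms Ks) (\<lambda>\<omega> l. if l \<in> \<delta> then Some (label_value W l \<omega>) else None)"
  proof (rule code_entropy_eq[OF C \<gamma>(1)])
    fix w w' assume "w \<in> outcomes Ms Ks" "w' \<in> outcomes Ms Ks"
    from eq[OF this]
    show "((\<lambda>l. if l \<in> \<delta> then Some (label_value W l w) else None)
        = (\<lambda>l. if l \<in> \<delta> then Some (label_value W l w') else None))
        \<longleftrightarrow> (\<forall>l\<in>\<gamma>. label_value W l w = label_value W l w')"
      by (simp add: fun_eq_iff) metis
  qed
  then show ?thesis using \<gamma> by (simp add: code_entropy_def)
qed

text \<open>The upper bound is the logarithm of the number of outcomes. It confines all coordinates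
  to a box as soon as message and key alphabets are small.\<close>

lemma code_entropy_bounds:
  assumes C: "code Ms Ks F W"
  shows "0 \<le> code_entropy Ms Ks W \<gamma>"
    and "code_entropy Ms Ks W \<gamma> \<le> (\<Sum>s\<in>S. log 2 (card (Ms s)) + log 2 (card (Ks s)))"
proof -
  note fin = outcomes_finite[OF C]
  show "0 \<le> code_entropy Ms Ks W \<gamma>"
    by (simp add: code_entropy_def H_unif_nonneg[OF fin])
  have pos: "card (Ms s) > 0" "card (Ks s) > 0" if "s \<in> S" for s
    using code_sets[OF C that] by (auto simp: card_gt_0_iff)
  note log_card_outcomes[OF C]
  moreover have "0 \<le> (\<Sum>s\<in>S. log 2 (card (Ms s)) + log 2 (card (Ks s)))"
    using pos by (intro sum_nonneg add_nonneg_nonneg) (auto simp: zero_le_log_cancel_iff Suc_leI)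
  ultimately show "code_entropy Ms Ks W \<gamma> \<le> (\<Sum>s\<in>S. log 2 (card (Ms s)) + log 2 (card (Ks s)))"
    unfolding code_entropy_def by (auto intro: order_trans[OF H_unif_le[OF fin]])
qed

lemma agree_frac_msg:
  assumes C: "code Ms Ks F W" and s: "s \<in> S" and \<omega>: "\<omega> \<in> outcomes Ms Ks"
  shows "agree_frac (outcomes Ms Ks) (\<lambda>\<omega>. fst \<omega> s) \<omega> = 1 / card (Ms s)"
    and "agree_frac (outcomes Ms Ks) (\<lambda>\<omega>. snd \<omega> s) \<omega> = 1 / card (Ks s)"
proof -
  note sets = code_sets[OF C]
  have fin: "finite (PiE S Ms)" "PiE S Ms \<noteq> {}" "finite (PiE S Ks)" "PiE S Ks \<noteq> {}"
    using sets finite_S by (auto simp: PiE_eq_empty_iff intro!: finite_PiE)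
  have in_set: "fst \<omega> s \<in> Ms s" "snd \<omega> s \<in> Ks s" using \<omega> s by (auto simp: outcomes_def)
  have "agree_frac (outcomes Ms Ks) (\<lambda>\<omega>. fst \<omega> s) \<omega> = avg (PiE S Ms) (\<lambda>m. of_bool (m s = fst \<omega> s))"
    using fin by (simp add: agree_frac_avg outcomes_finite[OF C] outcomes_def avg_times avg_const)
  also have "\<dots> = avg (Ms s) (\<lambda>x. of_bool (x = fst \<omega> s))"
    using sets finite_S s by (intro avg_PiE_component) auto
  also have "\<dots> = 1 / card (Ms s)"
    using sets s in_set by (simp add: avg_def)
  finally show "agree_frac (outcomes Ms Ks) (\<lambda>\<omega>. fst \<omega> s) \<omega> = 1 / card (Ms s)" .
  have "agree_frac (outcomes Ms Ks) (\<lambda>\<omega>. snd \<omega> s) \<omega> = avg (PiE S Ks) (\<lambda>k. of_bool (k s = snd \<omega> s))"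
    using fin by (simp add: agree_frac_avg outcomes_finite[OF C] outcomes_def avg_times avg_const)
  also have "\<dots> = avg (Ks s) (\<lambda>x. of_bool (x = snd \<omega> s))"
    using sets finite_S s by (intro avg_PiE_component) auto
  also have "\<dots> = 1 / card (Ks s)"
    using sets s in_set by (simp add: avg_def)
  finally show "agree_frac (outcomes Ms Ks) (\<lambda>\<omega>. snd \<omega> s) \<omega> = 1 / card (Ks s)" .
qed

lemma code_entropy_Msg:
  assumes C: "code Ms Ks F W" and s: "s \<in> S"
  shows "code_entropy Ms Ks W {Msg s} = log 2 (card (Ms s))"
proof -
  have "code_entropy Ms Ks W {Msg s} = H_unif (outcomes Ms Ks) (\<lambda>\<omega>. fst \<omega> s)"
    using s by (intro code_entropy_eq[OF C]) (auto simp: labels_def)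
  also have "\<dots> = log 2 (card (Ms s))"
    using agree_frac_msg[OF C s] by (intro H_unif_const_frac outcomes_finite[OF C])
  finally show ?thesis .
qed

lemma code_entropy_Key:
  assumes C: "code Ms Ks F W" and s: "s \<in> S"
  shows "code_entropy Ms Ks W {Key s} = log 2 (card (Ks s))"
proof -
  have "code_entropy Ms Ks W {Key s} = H_unif (outcomes Ms Ks) (\<lambda>\<omega>. snd \<omega> s)"
    using s by (intro code_entropy_eq[OF C]) (auto simp: labels_def)
  also have "\<dots> = log 2 (card (Ks s))"
    using agree_frac_msg[OF C s] by (intro H_unif_const_frac outcomes_finite[OF C])
  finally show ?thesis .
qed

lemma outcomes_msg_eq_iff:
  assumes "\<omega> \<in> outcomes Ms Ks" "\<omega>' \<in> outcomes Ms Ks"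
  shows "fst \<omega> = fst \<omega>' \<longleftrightarrow> (\<forall>s\<in>S. fst \<omega> s = fst \<omega>' s)"
    and "snd \<omega> = snd \<omega>' \<longleftrightarrow> (\<forall>s\<in>S. snd \<omega> s = snd \<omega>' s)"
proof -
  have "fst \<omega> \<in> PiE S Ms" "fst \<omega>' \<in> PiE S Ms" "snd \<omega> \<in> PiE S Ks" "snd \<omega>' \<in> PiE S Ks"
    using assms by (auto simp: outcomes_def)
  then show "fst \<omega> = fst \<omega>' \<longleftrightarrow> (\<forall>s\<in>S. fst \<omega> s = fst \<omega>' s)"
    and "snd \<omega> = snd \<omega>' \<longleftrightarrow> (\<forall>s\<in>S. snd \<omega> s = snd \<omega>' s)"
    by (metis PiE_ext)+
qed

definition code_vectors :: "(('v, 'e) label set \<Rightarrow> real) set" where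
  "code_vectors = Gamma_star (labels S E) \<inter> Gamma1 S E \<inter> Gamma2 S E tail
        \<inter> Gamma3 V E tail head S T \<inter> Gamma4 S E head T beta"

lemma code_entropy_in_code_vectors:
  assumes C: "code Ms Ks F W"
  shows "code_entropy Ms Ks W \<in> code_vectors"
proof -
  let ?\<Omega> = "outcomes Ms Ks" and ?h = "code_entropy Ms Ks W"
  note fin = outcomes_finite[OF C] and sets = code_sets[OF C]
  have finL: "finite (labels S E)" by (simp add: labels_def finite_S finite_E)
  have HN: "?h \<in> HN (labels S E)"
  proof -
    have "?h {} = H_unif ?\<Omega> (\<lambda>_. ())" by (intro code_entropy_eq[OF C]) auto
    also have "\<dots> = log 2 1" using fin by (intro H_unif_const_frac) (auto simp: agree_frac_def)
    finally show ?thesis by (simp add: HN_def code_entropy_def)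
  qed
  \<comment> \<open>\<open>Gamma_star\<close> wants alphabets in \<open>nat\<close>, so the finitely
    many values that occur are numbered injectively. A value numbered 0 does not clash with the
    default 0, because the default occurs at the same labels for all outcomes.\<close>
  have "finite (\<Union>l\<in>labels S E. label_value W l ` ?\<Omega>)" using finL fin by auto
  then obtain g :: "'a + 'b + 'c \<Rightarrow> nat" where g: "inj_on g (\<Union>l\<in>labels S E. label_value W l ` ?\<Omega>)"
    using finite_imp_inj_to_nat_seg by metis
  define p where "p = map_pmf (\<lambda>\<omega> l. if l \<in> labels S E then g (label_value W l \<omega>) else 0) (pmf_of_set ?\<Omega>)"
  have "?h \<gamma> = entropy_pmf (map_pmf (\<lambda>u l. if l \<in> \<gamma> then u l else 0) p)" if \<gamma>: "\<gamma> \<subseteq> labels S E" for \<gamma>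
  proof -
    have "?h \<gamma> = H_unif ?\<Omega> (\<lambda>\<omega> l. if l \<in> \<gamma> then if l \<in> labels S E then g (label_value W l \<omega>) else 0 else 0)"
    proof (rule code_entropy_eq[OF C \<gamma>])
      fix w w' assume w: "w \<in> ?\<Omega>" "w' \<in> ?\<Omega>"
      have "g (label_value W l w) = g (label_value W l w') \<longleftrightarrow> label_value W l w = label_value W l w'"
        if "l \<in> \<gamma>" for l
        using that \<gamma> w by (intro inj_on_eq_iff[OF g]) auto
      then show "((\<lambda>l. if l \<in> \<gamma> then if l \<in> labels S E then g (label_value W l w) else 0 else 0)
        = (\<lambda>l. if l \<in> \<gamma> then if l \<in> labels S E then g (label_value W l w') else 0 else 0))
        \<longleftrightarrow> (\<forall>l\<in>\<gamma>. label_value W l w = label_value W l w')"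
        using \<gamma> by (simp add: fun_eq_iff) (metis subsetD)
    qed
    then show ?thesis by (simp add: p_def H_unif_def pmf.map_comp o_def)
  qed
  moreover have "finite (set_pmf p)" using fin by (simp add: p_def)
  ultimately have star: "?h \<in> Gamma_star (labels S E)"
    unfolding Gamma_star_def using HN by auto
  \<comment> \<open>Messages and keys together are the whole outcome, which is uniform on a product
    set.\<close>
  have G1: "?h \<in> Gamma1 S E"
  proof -
    have "?h (Msg ` S \<union> Key ` S) = H_unif ?\<Omega> (\<lambda>\<omega>. \<omega>)"
    proof (rule code_entropy_eq[OF C])
      fix w w' assume "w \<in> ?\<Omega>" "w' \<in> ?\<Omega>"
      from outcomes_msg_eq_iff[OF this]
      show "w = w' \<longleftrightarrow> (\<forall>l\<in>Msg ` S \<union> Key ` S. label_value W l w = label_value W l w')"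
        by (simp add: prod_eq_iff ball_Un)
    qed (auto simp: labels_def)
    also have "\<dots> = log 2 (card ?\<Omega>)"
    proof (rule H_unif_const_frac[OF fin])
      fix w assume "w \<in> ?\<Omega>"
      then have "{w'\<in>?\<Omega>. w' = w} = {w}" by auto
      then show "agree_frac ?\<Omega> (\<lambda>\<omega>. \<omega>) w = 1 / card ?\<Omega>" by (simp add: agree_frac_def)
    qed
    finally have "?h (Msg ` S \<union> Key ` S) = log 2 (card ?\<Omega>)" .
    then show ?thesis using HN
      by (simp add: Gamma1_def log_card_outcomes[OF C] code_entropy_Msg[OF C] code_entropy_Key[OF C])
  qed
  have sub: "Edge ` In E head v \<subseteq> labels S E" "Edge ` Out E tail v \<subseteq> labels S E" for v
    by (auto simp: labels_def In_def Out_def)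
  have G2: "?h \<in> Gamma2 S E tail"
  proof -
    have "?h ({Msg s, Key s} \<union> Edge ` Out E tail s) = ?h {Msg s, Key s}" if s: "s \<in> S" for s
    proof (rule code_entropy_cong[OF C])
      fix w w' assume w: "w \<in> ?\<Omega>" "w' \<in> ?\<Omega>"
      show "(\<forall>l\<in>{Msg s, Key s}. label_value W l w = label_value W l w')
       \<longleftrightarrow> (\<forall>l\<in>{Msg s, Key s} \<union> Edge ` Out E tail s. label_value W l w = label_value W l w')"
        using code_source[OF C s] w by auto
    qed (use s sub in \<open>auto simp: labels_def\<close>)
    then show ?thesis using HN by (simp add: Gamma2_def)
  qed
  have G3: "?h \<in> Gamma3 V E tail head S T"
  proof -
    have "?h (Edge ` (In E head v \<union> Out E tail v)) = ?h (Edge ` In E head v)" if v: "v \<in> V - (S \<union> T)" for v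
    proof (rule code_entropy_cong[OF C])
      fix w w' assume w: "w \<in> ?\<Omega>" "w' \<in> ?\<Omega>"
      have "W e w = W e w'" if "\<And>e. e \<in> In E head v \<Longrightarrow> W e w = W e w'" "e \<in> Out E tail v" for e
        using code_inner[OF C v that(2) w] that(1) by blast
      then show "(\<forall>l\<in>Edge ` In E head v. label_value W l w = label_value W l w')
       \<longleftrightarrow> (\<forall>l\<in>Edge ` (In E head v \<union> Out E tail v). label_value W l w = label_value W l w')"
        by auto
    qed (use sub in \<open>auto simp: image_Un\<close>)
    then show ?thesis using HN by (simp add: Gamma3_def)
  qed
  have G4: "?h \<in> Gamma4 S E head T beta"
  proof -
    have "?h (Msg ` beta t \<union> Edge ` In E head t) = ?h (Edge ` In E head t)" if t: "t \<in> T" for t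
    proof (rule code_entropy_cong[OF C])
      have "beta t \<subseteq> S" using net t by (auto simp: wiretap_network_def)
      then show "Msg ` beta t \<union> Edge ` In E head t \<subseteq> labels S E"
        using sub[of t] by (auto simp: labels_def)
      fix w w' assume w: "w \<in> ?\<Omega>" "w' \<in> ?\<Omega>"
      have "fst w s = fst w' s" if "\<And>e. e \<in> In E head t \<Longrightarrow> W e w = W e w'" "s \<in> beta t" for s
        using code_decode[OF C t that(2) w] that(1) by blast
      then show "(\<forall>l\<in>Edge ` In E head t. label_value W l w = label_value W l w')
       \<longleftrightarrow> (\<forall>l\<in>Msg ` beta t \<union> Edge ` In E head t. label_value W l w = label_value W l w')"
        by (auto simp: ball_Un)
    qed (use sub in auto)
    then show ?thesis using HN by (simp add: Gamma4_def)
  qed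
  show ?thesis unfolding code_vectors_def using star G1 G2 G3 G4 by simp
qed

end

section \<open>Replacing keys by random codebooks\<close>

lemma convex_vec_avg:
  assumes cv: "convex_vec C" and I: "finite I" "I \<noteq> {}" and h: "\<And>i. i \<in> I \<Longrightarrow> h i \<in> C"
  shows "(\<lambda>\<gamma>. avg I (\<lambda>i. h i \<gamma>)) \<in> C"
  using I h
proof (induction I rule: finite_ne_induct)
  case (singleton i)
  then show ?case by (simp add: avg_def)
next
  case (insert i I)
  let ?u = "1 / (1 + real (card I))"
  have in_C: "h i \<in> C" "(\<lambda>\<gamma>. avg I (\<lambda>i. h i \<gamma>)) \<in> C" using insert by auto
  have "(\<lambda>\<gamma>. ?u * h i \<gamma> + (1 - ?u) * avg I (\<lambda>i. h i \<gamma>)) \<in> C"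
    by (rule cv[unfolded convex_vec_def, rule_format, OF in_C]) (simp add: divide_le_eq)
  also have "(\<lambda>\<gamma>. ?u * h i \<gamma> + (1 - ?u) * avg I (\<lambda>i. h i \<gamma>)) = (\<lambda>\<gamma>. avg (insert i I) (\<lambda>i. h i \<gamma>))"
  proof
    fix \<gamma>
    have "1 - ?u = real (card I) / (1 + real (card I))" by (simp add: field_simps)
    moreover have "card I > 0" using insert by (simp add: card_gt_0_iff)
    ultimately show "?u * h i \<gamma> + (1 - ?u) * avg I (\<lambda>i. h i \<gamma>) = avg (insert i I) (\<lambda>i. h i \<gamma>)"
      using insert by (simp add: avg_def add_divide_distrib)
  qed
  finally show ?case .
qed

lemma cl_con_superset: "X \<subseteq> cl_con X"
  and cl_con_closed: "closed (cl_con X)"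
  and cl_con_convex: "convex_vec (cl_con X)"
  unfolding cl_con_def by (auto simp: convex_vec_def intro!: closed_Inter)

context network
begin

section \<open>Source symbols and their conditional law\<close>

definition edge_symbols :: "('e \<Rightarrow> 'w \<Rightarrow> 'a) \<Rightarrow> 'e set \<Rightarrow> 'w \<Rightarrow> 'e \<Rightarrow> 'a option" where
  "edge_symbols W \<alpha> \<omega> = (\<lambda>e. if e \<in> \<alpha> then Some (W e \<omega>) else None)"

lemma edge_symbols_eq_iff:
  "edge_symbols W \<alpha> \<omega> = edge_symbols W' \<alpha> \<omega>' \<longleftrightarrow> (\<forall>e\<in>\<alpha>. W e \<omega> = W' e \<omega>')"
  by (auto simp: edge_symbols_def fun_eq_iff)

lemma code_entropy_edges:
  assumes C: "code Ms Ks F W" and \<alpha>: "\<alpha> \<subseteq> E"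
  shows "code_entropy Ms Ks W (Edge ` \<alpha>) = H_unif (outcomes Ms Ks) (edge_symbols W \<alpha>)"
  using \<alpha> by (intro code_entropy_eq[OF C]) (auto simp: labels_def edge_symbols_eq_iff)

lemma code_entropy_msgs:
  assumes C: "code Ms Ks F W"
  shows "code_entropy Ms Ks W (Msg ` S) = H_unif (outcomes Ms Ks) fst"
  by (intro code_entropy_eq[OF C]) (auto simp: labels_def outcomes_msg_eq_iff)

lemma code_entropy_msgs_edges:
  assumes C: "code Ms Ks F W" and \<alpha>: "\<alpha> \<subseteq> E"
  shows "code_entropy Ms Ks W (Msg ` S \<union> Edge ` \<alpha>)
    = H_unif (outcomes Ms Ks) (\<lambda>\<omega>. (fst \<omega>, edge_symbols W \<alpha> \<omega>))"
  using \<alpha> by (intro code_entropy_eq[OF C])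
    (auto simp: labels_def outcomes_msg_eq_iff edge_symbols_eq_iff ball_Un)

text \<open>The conditional probability, given message \<open>m\<close>, of the symbols that key
  \<open>k\<close> puts on the edges leaving \<open>s\<close>. It is the \<open>P\<close> of
  \<open>random_codebook_divergence\<close>.\<close>

definition key_fraction :: "('v \<Rightarrow> 'k set) \<Rightarrow> ('e \<Rightarrow> 'm \<Rightarrow> 'k \<Rightarrow> 'a) \<Rightarrow> 'v \<Rightarrow> 'm \<Rightarrow> 'k \<Rightarrow> real" where
  "key_fraction Ks F s m k = agree_frac (Ks s) (edge_symbols (\<lambda>e. F e m) (Out E tail s)) k"

text \<open>A codebook influences the edges only through these symbols. The messages are included
  because leakage concerns their joint law with the tapped edges.\<close>

definition source_view :: "('e \<Rightarrow> ('v \<Rightarrow> 'm) \<times> ('v \<Rightarrow> 'k) \<Rightarrow> 'a)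
    \<Rightarrow> ('v \<Rightarrow> 'm) \<times> ('v \<Rightarrow> 'k) \<Rightarrow> ('v \<Rightarrow> 'm) \<times> ('e \<Rightarrow> 'a option)" where
  "source_view W \<omega> = (fst \<omega>, edge_symbols W (\<Union>s\<in>S. Out E tail s) \<omega>)"

text \<open>Given the messages, symbols of different sources are independent because the keys are;
  the fibre is one message tuple times a product of key sets. In a ratio of two such products the
  factors \<open>card (Ms s)\<close> cancel and the divergence splits over the sources.\<close>

lemma agree_frac_source_view:
  assumes C: "code Ms Ks F W" and \<omega>: "\<omega> \<in> outcomes Ms Ks"
  shows "agree_frac (outcomes Ms Ks) (source_view W) \<omega>
    = (\<Prod>s\<in>S. key_fraction Ks F s (fst \<omega> s) (snd \<omega> s) / card (Ms s))"
proof -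
  let ?K = "\<lambda>s. {k\<in>Ks s. edge_symbols (\<lambda>e. F e (fst \<omega> s)) (Out E tail s) k
      = edge_symbols (\<lambda>e. F e (fst \<omega> s)) (Out E tail s) (snd \<omega> s)}"
  have "{\<omega>'\<in>outcomes Ms Ks. source_view W \<omega>' = source_view W \<omega>} = {fst \<omega>} \<times> PiE S ?K"
  proof (intro equalityI subsetI)
    fix \<omega>' assume "\<omega>' \<in> {\<omega>'\<in>outcomes Ms Ks. source_view W \<omega>' = source_view W \<omega>}"
    then have \<omega>': "\<omega>' \<in> outcomes Ms Ks" and m: "fst \<omega>' = fst \<omega>"
      and w: "\<And>s e. s \<in> S \<Longrightarrow> e \<in> Out E tail s \<Longrightarrow> W e \<omega>' = W e \<omega>"
      by (auto simp: source_view_def edge_symbols_eq_iff)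
    have "F e (fst \<omega> s) (snd \<omega>' s) = F e (fst \<omega> s) (snd \<omega> s)" if "s \<in> S" "e \<in> Out E tail s" for s e
      using w[OF that] code_source[OF C that \<omega>'] code_source[OF C that \<omega>] m by simp
    then have "snd \<omega>' \<in> PiE S ?K"
      using \<omega>' by (auto simp: outcomes_def edge_symbols_eq_iff PiE_iff)
    then show "\<omega>' \<in> {fst \<omega>} \<times> PiE S ?K" using m by (cases \<omega>') auto
  next
    fix \<omega>' assume "\<omega>' \<in> {fst \<omega>} \<times> PiE S ?K"
    then have m: "fst \<omega>' = fst \<omega>" and k: "snd \<omega>' \<in> PiE S ?K" by auto
    have \<omega>': "\<omega>' \<in> outcomes Ms Ks"
      using m k \<omega> by (cases \<omega>') (auto simp: outcomes_def PiE_iff)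
    have "W e \<omega>' = W e \<omega>" if "s \<in> S" "e \<in> Out E tail s" for s e
      using PiE_mem[OF k that(1)] code_source[OF C that \<omega>'] code_source[OF C that \<omega>] m that(2)
      by (auto simp: edge_symbols_eq_iff)
    then show "\<omega>' \<in> {\<omega>'\<in>outcomes Ms Ks. source_view W \<omega>' = source_view W \<omega>}"
      using m \<omega>' by (auto simp: source_view_def edge_symbols_eq_iff)
  qed
  then show ?thesis
    unfolding agree_frac_def key_fraction_def
    by (simp add: card_cartesian_product card_PiE finite_S outcomes_def prod_dividef prod.distrib mult.commute)
qed

section \<open>Codebooks in place of keys\<close>

definition codebook_outcome :: "('v \<Rightarrow> nat \<Rightarrow> 'k) \<Rightarrow> ('v \<Rightarrow> 'm) \<times> ('v \<Rightarrow> nat)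
    \<Rightarrow> ('v \<Rightarrow> 'm) \<times> ('v \<Rightarrow> 'k)" where
  "codebook_outcome \<kappa> \<omega> = (fst \<omega>, \<lambda>s\<in>S. \<kappa> s (snd \<omega> s))"

definition codebooks :: "('v \<Rightarrow> nat) \<Rightarrow> ('v \<Rightarrow> 'k set) \<Rightarrow> ('v \<Rightarrow> nat \<Rightarrow> 'k) set" where
  "codebooks J Ks = PiE S (\<lambda>s. PiE {..<J s} (\<lambda>_. Ks s))"

lemma fst_codebook_outcome [simp]: "fst (codebook_outcome \<kappa> \<omega>) = fst \<omega>"
  by (simp add: codebook_outcome_def)

text \<open>Relative entropy of the law of \<open>X\<close> under codebook \<open>\<kappa>\<close>
  with respect to its law under the original keys.\<close>

definition divergence :: "('v \<Rightarrow> 'm set) \<Rightarrow> ('v \<Rightarrow> 'k set) \<Rightarrow> ('v \<Rightarrow> nat)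
    \<Rightarrow> (('v \<Rightarrow> 'm) \<times> ('v \<Rightarrow> 'k) \<Rightarrow> 'x) \<Rightarrow> ('v \<Rightarrow> nat \<Rightarrow> 'k) \<Rightarrow> real" where
  "divergence Ms Ks J X \<kappa> = avg (outcomes Ms (\<lambda>s. {..<J s}))
     (\<lambda>\<omega>. log 2 (agree_frac (outcomes Ms (\<lambda>s. {..<J s})) (\<lambda>\<omega>. X (codebook_outcome \<kappa> \<omega>)) \<omega>
       / agree_frac (outcomes Ms Ks) X (codebook_outcome \<kappa> \<omega>)))"

text \<open>The bound of \<open>random_codebook_divergence\<close>, averaged over the message of
  each source and summed over the sources.\<close>

definition codebook_loss :: "('v \<Rightarrow> 'm set) \<Rightarrow> ('v \<Rightarrow> 'k set) \<Rightarrow> ('e \<Rightarrow> 'm \<Rightarrow> 'k \<Rightarrow> 'a)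
    \<Rightarrow> ('v \<Rightarrow> nat) \<Rightarrow> real" where
  "codebook_loss Ms Ks F J =
     (\<Sum>s\<in>S. avg (Ms s) (\<lambda>m. avg (Ks s) (\<lambda>k. log 2 (1 + 1 / (J s * key_fraction Ks F s m k)))))"

definition codebook_vector :: "('v \<Rightarrow> 'm set) \<Rightarrow> ('v \<Rightarrow> 'k set)
    \<Rightarrow> ('e \<Rightarrow> ('v \<Rightarrow> 'm) \<times> ('v \<Rightarrow> 'k) \<Rightarrow> 'a) \<Rightarrow> ('v \<Rightarrow> nat) \<Rightarrow> ('v, 'e) label set \<Rightarrow> real" where
  "codebook_vector Ms Ks W J \<gamma> = avg (codebooks J Ks)
     (\<lambda>\<kappa>. code_entropy Ms (\<lambda>s. {..<J s}) (\<lambda>e \<omega>. W e (codebook_outcome \<kappa> \<omega>)) \<gamma>)"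

context
  fixes Ms :: "'v \<Rightarrow> 'm set" and Ks :: "'v \<Rightarrow> 'k set" and F :: "'e \<Rightarrow> 'm \<Rightarrow> 'k \<Rightarrow> 'a" and W
    and J :: "'v \<Rightarrow> nat"
  assumes C: "code Ms Ks F W" and J: "\<And>s. s \<in> S \<Longrightarrow> J s > 0"
begin

abbreviation "\<Omega> \<equiv> outcomes Ms Ks"
abbreviation "\<Omega>J \<equiv> outcomes Ms (\<lambda>s. {..<J s}) :: (('v \<Rightarrow> 'm) \<times> ('v \<Rightarrow> nat)) set"
abbreviation "FJ \<kappa> \<equiv> \<lambda>e m j. F e m (\<kappa> (tail e) j)"
abbreviation "WJ \<kappa> \<equiv> \<lambda>e \<omega>. W e (codebook_outcome \<kappa> \<omega>)"

lemma codebook_outcome_in: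
  "\<kappa> \<in> codebooks J Ks \<Longrightarrow> \<omega> \<in> \<Omega>J \<Longrightarrow> codebook_outcome \<kappa> \<omega> \<in> \<Omega>"
  by (fastforce simp: codebooks_def outcomes_def codebook_outcome_def PiE_iff)

lemma codebooks_finite: "finite (codebooks J Ks)" "codebooks J Ks \<noteq> {}"
  using code_sets[OF C] finite_S unfolding codebooks_def
  by (auto simp: PiE_eq_empty_iff intro!: finite_PiE)

text \<open>\<open>codebook_outcome \<kappa>\<close> sends new outcomes to outcomes of the given
  code with the same messages, so all coding and decoding constraints are inherited, whether or not
  codewords are distinct. The new encoder finds its codebook through \<open>tail e\<close>.\<close>

lemma code_codebook:
  assumes \<kappa>: "\<kappa> \<in> codebooks J Ks"
  shows "code Ms (\<lambda>s. {..<J s}) (FJ \<kappa>) (WJ \<kappa>)"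
  unfolding code_def
proof (intro conjI ballI impI)
  fix s assume s: "s \<in> S"
  show "finite (Ms s)" "Ms s \<noteq> {}" "finite {..<J s}" "{..<J s} \<noteq> {}"
    using code_sets[OF C s] J[OF s] by auto
  fix e \<omega> assume e: "e \<in> Out E tail s" and \<omega>: "\<omega> \<in> \<Omega>J"
  have "tail e = s" using e by (simp add: Out_def)
  then show "WJ \<kappa> e \<omega> = FJ \<kappa> e (fst \<omega> s) (snd \<omega> s)"
    using code_source[OF C s e codebook_outcome_in[OF \<kappa> \<omega>]] s by (simp add: codebook_outcome_def)
next
  fix v e \<omega> \<omega>' assume v: "v \<in> V - (S \<union> T)" and e: "e \<in> Out E tail v"
    and \<omega>: "\<omega> \<in> \<Omega>J" "\<omega>' \<in> \<Omega>J"
    and "\<forall>e'\<in>In E head v. WJ \<kappa> e' \<omega> = WJ \<kappa> e' \<omega>'"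
  then show "WJ \<kappa> e \<omega> = WJ \<kappa> e \<omega>'"
    using code_inner[OF C v e codebook_outcome_in[OF \<kappa> \<omega>(1)] codebook_outcome_in[OF \<kappa> \<omega>(2)]] by blast
next
  fix t s \<omega> \<omega>' assume "t \<in> T" "s \<in> beta t" "\<omega> \<in> \<Omega>J" "\<omega>' \<in> \<Omega>J"
    "\<forall>e\<in>In E head t. WJ \<kappa> e \<omega> = WJ \<kappa> e \<omega>'"
  then have "fst (codebook_outcome \<kappa> \<omega>) s = fst (codebook_outcome \<kappa> \<omega>') s"
    using codebook_outcome_in[OF \<kappa>] by (intro code_decode[OF C]) auto
  then show "fst \<omega> s = fst \<omega>' s" by (simp add: codebook_outcome_def)
qed

lemma \<Omega>J_finite: "finite \<Omega>J" "\<Omega>J \<noteq> {}"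
  using codebooks_finite(2) outcomes_finite[OF code_codebook] by blast+

text \<open>For a fixed index tuple, the selected codewords of a uniformly random codebook form a
  uniform key tuple; swapping the averages exposes this.\<close>

lemma avg_codebook_outcome:
  "avg (codebooks J Ks) (\<lambda>\<kappa>. avg \<Omega>J (\<lambda>\<omega>. f (codebook_outcome \<kappa> \<omega>))) = avg \<Omega> f"
proof -
  have ne: "PiE S (\<lambda>s. {..<J s}) \<noteq> {}" "finite (PiE S (\<lambda>s. {..<J s}))"
    using J finite_S by (auto simp: PiE_eq_empty_iff finite_PiE)
  have "avg (codebooks J Ks) (\<lambda>\<kappa>. avg \<Omega>J (\<lambda>\<omega>. f (codebook_outcome \<kappa> \<omega>)))
    = avg (PiE S Ms) (\<lambda>m. avg (PiE S (\<lambda>s. {..<J s})) (\<lambda>j.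
        avg (codebooks J Ks) (\<lambda>\<kappa>. f (m, \<lambda>s\<in>S. \<kappa> s (j s)))))"
    unfolding outcomes_def by (subst avg_swap) (simp add: avg_times codebook_outcome_def)
  also have "\<dots> = avg (PiE S Ms) (\<lambda>m. avg (PiE S (\<lambda>s. {..<J s})) (\<lambda>j. avg (PiE S Ks) (\<lambda>k. f (m, k))))"
  proof (intro avg_cong)
    fix m j assume j: "j \<in> PiE S (\<lambda>s. {..<J s})"
    have "equidist (codebooks J Ks) (\<lambda>\<kappa>. \<lambda>s\<in>S. \<kappa> s (j s)) (PiE S Ks)"
      unfolding codebooks_def using j code_sets[OF C]
      by (intro equidist_PiE[OF finite_S, where f = "\<lambda>s x. x (j s)"] equidist_component) auto
    from avg_equidist[OF this, of "\<lambda>k. f (m, k)"]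
    show "avg (codebooks J Ks) (\<lambda>\<kappa>. f (m, \<lambda>s\<in>S. \<kappa> s (j s))) = avg (PiE S Ks) (\<lambda>k. f (m, k))" .
  qed
  also have "\<dots> = avg \<Omega> f"
    using ne by (simp add: avg_const outcomes_def avg_times)
  finally show ?thesis .
qed

text \<open>For each codebook, the entropy is the cross-entropy to the original law minus the
  divergence. The cross-entropy averages to \<open>H_unif \<Omega> X\<close> by
  \<open>avg_codebook_outcome\<close>.\<close>

lemma avg_codebook_entropy:
  "avg (codebooks J Ks) (\<lambda>\<kappa>. H_unif \<Omega>J (\<lambda>\<omega>. X (codebook_outcome \<kappa> \<omega>)))
    = H_unif \<Omega> X - avg (codebooks J Ks) (divergence Ms Ks J X)"
proof -
  have "H_unif \<Omega>J (\<lambda>\<omega>. X (codebook_outcome \<kappa> \<omega>))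
    = avg \<Omega>J (\<lambda>\<omega>. - log 2 (agree_frac \<Omega> X (codebook_outcome \<kappa> \<omega>))) - divergence Ms Ks J X \<kappa>"
    if \<kappa>: "\<kappa> \<in> codebooks J Ks" for \<kappa>
    unfolding H_unif_avg[OF \<Omega>J_finite] divergence_def avg_diff[symmetric]
  proof (rule avg_cong)
    fix \<omega> assume \<omega>: "\<omega> \<in> \<Omega>J"
    have "agree_frac \<Omega>J (\<lambda>\<omega>. X (codebook_outcome \<kappa> \<omega>)) \<omega> > 0"
      "agree_frac \<Omega> X (codebook_outcome \<kappa> \<omega>) > 0"
      using \<Omega>J_finite \<omega> outcomes_finite[OF C] codebook_outcome_in[OF \<kappa> \<omega>] by (auto intro: agree_frac_pos)
    then show "- log 2 (agree_frac \<Omega>J (\<lambda>\<omega>. X (codebook_outcome \<kappa> \<omega>)) \<omega>)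
      = - log 2 (agree_frac \<Omega> X (codebook_outcome \<kappa> \<omega>))
        - log 2 (agree_frac \<Omega>J (\<lambda>\<omega>. X (codebook_outcome \<kappa> \<omega>)) \<omega> / agree_frac \<Omega> X (codebook_outcome \<kappa> \<omega>))"
      by (simp add: log_divide_pos)
  qed
  then have "avg (codebooks J Ks) (\<lambda>\<kappa>. H_unif \<Omega>J (\<lambda>\<omega>. X (codebook_outcome \<kappa> \<omega>)))
    = avg (codebooks J Ks) (\<lambda>\<kappa>. avg \<Omega>J (\<lambda>\<omega>. - log 2 (agree_frac \<Omega> X (codebook_outcome \<kappa> \<omega>))) - divergence Ms Ks J X \<kappa>)"
    by (rule avg_cong)
  also have "\<dots> = H_unif \<Omega> X - avg (codebooks J Ks) (divergence Ms Ks J X)"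
    unfolding avg_diff avg_codebook_outcome[of "\<lambda>\<omega>. - log 2 (agree_frac \<Omega> X \<omega>)"]
      H_unif_avg[OF outcomes_finite[OF C]] ..
  finally show ?thesis .
qed

lemma avg_codebook_entropy_le:
  "avg (codebooks J Ks) (\<lambda>\<kappa>. H_unif \<Omega>J (\<lambda>\<omega>. X (codebook_outcome \<kappa> \<omega>))) \<le> H_unif \<Omega> X"
proof -
  have "0 \<le> divergence Ms Ks J X \<kappa>" if "\<kappa> \<in> codebooks J Ks" for \<kappa>
    unfolding divergence_def
    by (rule divergence_nonneg[OF \<Omega>J_finite outcomes_finite(1)[OF C] codebook_outcome_in[OF that]])
  then have "0 \<le> avg (codebooks J Ks) (divergence Ms Ks J X)"
    using codebooks_finite by (intro avg_ge_const) auto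
  then show ?thesis unfolding avg_codebook_entropy by simp
qed

text \<open>The product form of the source view turns the logarithm into a sum over sources. The
  summand of \<open>s\<close> involves only the codebook of \<open>s\<close>, so the others average
  out and \<open>random_codebook_divergence\<close> applies with message and index held
  fixed.\<close>

lemma avg_divergence_source_view:
  "avg (codebooks J Ks) (divergence Ms Ks J (source_view W)) \<le> codebook_loss Ms Ks F J"
proof -
  note sets = code_sets[OF C]
  have div: "divergence Ms Ks J (source_view W) \<kappa> = avg \<Omega>J (\<lambda>\<omega>. \<Sum>s\<in>S.
      log 2 (agree_frac {..<J s} (\<lambda>j. edge_symbols (\<lambda>e. F e (fst \<omega> s)) (Out E tail s) (\<kappa> s j)) (snd \<omega> s)
        / key_fraction Ks F s (fst \<omega> s) (\<kappa> s (snd \<omega> s))))"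
    if \<kappa>: "\<kappa> \<in> codebooks J Ks" for \<kappa>
    unfolding divergence_def
  proof (rule avg_cong)
    fix \<omega> assume \<omega>: "\<omega> \<in> \<Omega>J"
    let ?p = "\<lambda>s. agree_frac {..<J s} (\<lambda>j. edge_symbols (\<lambda>e. F e (fst \<omega> s)) (Out E tail s) (\<kappa> s j)) (snd \<omega> s)"
    let ?q = "\<lambda>s. key_fraction Ks F s (fst \<omega> s) (\<kappa> s (snd \<omega> s))"
    have view: "(\<lambda>\<omega>. source_view W (codebook_outcome \<kappa> \<omega>)) = source_view (WJ \<kappa>)"
      by (simp add: fun_eq_iff source_view_def codebook_outcome_def edge_symbols_def)
    have key: "key_fraction (\<lambda>s. {..<J s}) (FJ \<kappa>) s (fst \<omega> s) (snd \<omega> s) = ?p s" for s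
      unfolding key_fraction_def
      by (rule agree_frac_cong) (auto simp: edge_symbols_eq_iff Out_def)
    have p: "agree_frac \<Omega>J (\<lambda>\<omega>. source_view W (codebook_outcome \<kappa> \<omega>)) \<omega> = (\<Prod>s\<in>S. ?p s / card (Ms s))"
      unfolding view agree_frac_source_view[OF code_codebook[OF \<kappa>] \<omega>] key ..
    have q: "agree_frac \<Omega> (source_view W) (codebook_outcome \<kappa> \<omega>) = (\<Prod>s\<in>S. ?q s / card (Ms s))"
      unfolding agree_frac_source_view[OF C codebook_outcome_in[OF \<kappa> \<omega>]]
      by (intro prod.cong) (auto simp: codebook_outcome_def)
    have pos: "?p s > 0" "?q s > 0" "card (Ms s) > 0" if s: "s \<in> S" for s
    proof -
      have j: "snd \<omega> s < J s" using \<omega> s by (auto simp: outcomes_def PiE_iff)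
      then show "?p s > 0" by (intro agree_frac_pos) auto
      have "\<kappa> s (snd \<omega> s) \<in> Ks s" using \<kappa> s j by (auto simp: codebooks_def PiE_iff)
      then show "?q s > 0" unfolding key_fraction_def using sets[OF s] by (intro agree_frac_pos) auto
      show "card (Ms s) > 0" using sets[OF s] by (auto simp: card_gt_0_iff)
    qed
    have "(\<Prod>s\<in>S. ?p s / card (Ms s)) / (\<Prod>s\<in>S. ?q s / card (Ms s)) = (\<Prod>s\<in>S. ?p s / ?q s)"
      unfolding prod_dividef[symmetric] using pos by (intro prod.cong) auto
    then show "log 2 (agree_frac \<Omega>J (\<lambda>\<omega>. source_view W (codebook_outcome \<kappa> \<omega>)) \<omega>
        / agree_frac \<Omega> (source_view W) (codebook_outcome \<kappa> \<omega>)) = (\<Sum>s\<in>S. log 2 (?p s / ?q s))"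
      unfolding p q using pos finite_S by (simp add: log2_prod less_imp_neq[symmetric])
  qed
  define D where "D s m j \<kappa> = log 2 (agree_frac {..<J s} (\<lambda>j. edge_symbols (\<lambda>e. F e m) (Out E tail s) (\<kappa> j)) j
        / key_fraction Ks F s m (\<kappa> j))" for s m j \<kappa>
  define l where "l s m = avg (Ks s) (\<lambda>k. log 2 (1 + 1 / (J s * key_fraction Ks F s m k)))" for s m
  have fin: "PiE S (\<lambda>s. {..<J s}) \<noteq> {}" "finite (PiE S (\<lambda>s. {..<J s}))"
    using J finite_S by (auto simp: PiE_eq_empty_iff finite_PiE)
  have "avg (codebooks J Ks) (divergence Ms Ks J (source_view W))
     = avg (codebooks J Ks) (\<lambda>\<kappa>. avg \<Omega>J (\<lambda>\<omega>. \<Sum>s\<in>S. D s (fst \<omega> s) (snd \<omega> s) (\<kappa> s)))"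
    unfolding D_def using div by (rule avg_cong)
  also have "\<dots> = (\<Sum>s\<in>S. avg \<Omega>J (\<lambda>\<omega>. avg (codebooks J Ks) (\<lambda>\<kappa>. D s (fst \<omega> s) (snd \<omega> s) (\<kappa> s))))"
    unfolding avg_sum by (intro sum.cong refl avg_swap)
  also have "\<dots> \<le> (\<Sum>s\<in>S. avg \<Omega>J (\<lambda>\<omega>. l s (fst \<omega> s)))"
  proof (intro sum_mono avg_mono)
    fix s \<omega> assume s: "s \<in> S" and \<omega>: "\<omega> \<in> \<Omega>J"
    have j: "snd \<omega> s < J s" using \<omega> s by (auto simp: outcomes_def PiE_iff)
    have "avg (codebooks J Ks) (\<lambda>\<kappa>. D s (fst \<omega> s) (snd \<omega> s) (\<kappa> s))
      = avg (PiE {..<J s} (\<lambda>_. Ks s)) (D s (fst \<omega> s) (snd \<omega> s))"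
      unfolding codebooks_def using finite_S s sets
      by (intro avg_PiE_component) (auto simp: PiE_eq_empty_iff intro!: finite_PiE)
    also have "\<dots> \<le> l s (fst \<omega> s)"
      unfolding D_def l_def key_fraction_def using sets[OF s] j
      by (intro random_codebook_divergence) auto
    finally show "avg (codebooks J Ks) (\<lambda>\<kappa>. D s (fst \<omega> s) (snd \<omega> s) (\<kappa> s)) \<le> l s (fst \<omega> s)" .
  qed
  also have "\<dots> = (\<Sum>s\<in>S. avg (Ms s) (l s))"
  proof (rule sum.cong[OF refl])
    fix s assume s: "s \<in> S"
    have "avg \<Omega>J (\<lambda>\<omega>. l s (fst \<omega> s)) = avg (PiE S Ms) (\<lambda>m. l s (m s))"
      using fin by (simp add: outcomes_def avg_times avg_const)
    also have "\<dots> = avg (Ms s) (l s)"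
      using finite_S s sets by (intro avg_PiE_component) auto
    finally show "avg \<Omega>J (\<lambda>\<omega>. l s (fst \<omega> s)) = avg (Ms s) (l s)" .
  qed
  finally show ?thesis unfolding codebook_loss_def l_def .
qed

text \<open>By data processing, a function of the source view has at most the divergence of the
  source view itself.\<close>

lemma avg_codebook_entropy_ge:
  assumes X: "\<And>\<omega> \<omega>'. \<omega> \<in> \<Omega> \<Longrightarrow> \<omega>' \<in> \<Omega> \<Longrightarrow> source_view W \<omega> = source_view W \<omega>' \<Longrightarrow> X \<omega> = X \<omega>'"
  shows "H_unif \<Omega> X - codebook_loss Ms Ks F J
    \<le> avg (codebooks J Ks) (\<lambda>\<kappa>. H_unif \<Omega>J (\<lambda>\<omega>. X (codebook_outcome \<kappa> \<omega>)))"
proof -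
  have "avg (codebooks J Ks) (divergence Ms Ks J X) \<le> avg (codebooks J Ks) (divergence Ms Ks J (source_view W))"
    unfolding divergence_def
    by (intro avg_mono divergence_data_processing[OF \<Omega>J_finite outcomes_finite(1)[OF C] _ X])
      (auto intro: codebook_outcome_in)
  then show ?thesis unfolding avg_codebook_entropy using avg_divergence_source_view by linarith
qed

section \<open>Bounds on the averaged entropy vector\<close>

lemma codebook_vector_in_cl_con: "codebook_vector Ms Ks W J \<in> cl_con code_vectors"
  unfolding codebook_vector_def
  using codebooks_finite code_entropy_in_code_vectors[OF code_codebook] cl_con_superset
  by (intro convex_vec_avg[OF cl_con_convex]) blast+

lemma codebook_vector_bounds:
  "0 \<le> codebook_vector Ms Ks W J \<gamma>" "codebook_vector Ms Ks W J \<gamma> \<le> (\<Sum>s\<in>S. log 2 (card (Ms s)) + log 2 (J s))"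
  unfolding codebook_vector_def
  using codebooks_finite code_entropy_bounds[OF code_codebook]
  by (auto intro!: avg_ge_const avg_le_const)

lemma codebook_vector_trivial:
  "codebook_vector Ms Ks W J {} = 0" "\<not> \<gamma> \<subseteq> labels S E \<Longrightarrow> codebook_vector Ms Ks W J \<gamma> = 0"
proof -
  have "code_entropy Ms (\<lambda>s. {..<J s}) (WJ \<kappa>) \<in> HN (labels S E)" if "\<kappa> \<in> codebooks J Ks" for \<kappa>
    using code_entropy_in_code_vectors[OF code_codebook[OF that]]
    by (simp add: code_vectors_def Gamma1_def)
  then have "codebook_vector Ms Ks W J {} = avg (codebooks J Ks) (\<lambda>_. 0)"
    "\<not> \<gamma> \<subseteq> labels S E \<Longrightarrow> codebook_vector Ms Ks W J \<gamma> = avg (codebooks J Ks) (\<lambda>_. 0)"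
    unfolding codebook_vector_def HN_def by (auto intro!: avg_cong)
  then show "codebook_vector Ms Ks W J {} = 0" "\<not> \<gamma> \<subseteq> labels S E \<Longrightarrow> codebook_vector Ms Ks W J \<gamma> = 0"
    by (simp_all add: avg_def)
qed

lemma codebook_vector_Msg: "s \<in> S \<Longrightarrow> codebook_vector Ms Ks W J {Msg s} = log 2 (card (Ms s))"
  unfolding codebook_vector_def
  using codebooks_finite code_entropy_Msg[OF code_codebook]
  by (simp add: avg_const cong: avg_cong)

lemma edge_symbols_WJ: "edge_symbols (WJ \<kappa>) \<alpha> \<omega> = edge_symbols W \<alpha> (codebook_outcome \<kappa> \<omega>)"
  by (simp add: edge_symbols_def)

lemma codebook_vector_edges:
  assumes \<alpha>: "\<alpha> \<subseteq> E"
  shows "codebook_vector Ms Ks W J (Edge ` \<alpha>) \<le> H_unif \<Omega> (edge_symbols W \<alpha>)"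
proof -
  have "codebook_vector Ms Ks W J (Edge ` \<alpha>)
    = avg (codebooks J Ks) (\<lambda>\<kappa>. H_unif \<Omega>J (\<lambda>\<omega>. edge_symbols W \<alpha> (codebook_outcome \<kappa> \<omega>)))"
    unfolding codebook_vector_def edge_symbols_WJ[symmetric]
    by (intro avg_cong code_entropy_edges[OF code_codebook \<alpha>])
  also have "\<dots> \<le> H_unif \<Omega> (edge_symbols W \<alpha>)" by (rule avg_codebook_entropy_le)
  finally show ?thesis .
qed

lemma codebook_vector_msgs: "codebook_vector Ms Ks W J (Msg ` S) \<le> H_unif \<Omega> fst"
proof -
  have "codebook_vector Ms Ks W J (Msg ` S)
    = avg (codebooks J Ks) (\<lambda>\<kappa>. H_unif \<Omega>J (\<lambda>\<omega>. fst (codebook_outcome \<kappa> \<omega>)))"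
    unfolding codebook_vector_def
  proof (rule avg_cong)
    fix \<kappa> assume "\<kappa> \<in> codebooks J Ks"
    from code_entropy_msgs[OF code_codebook[OF this]]
    show "code_entropy Ms (\<lambda>s. {..<J s}) (WJ \<kappa>) (Msg ` S) = H_unif \<Omega>J (\<lambda>\<omega>. fst (codebook_outcome \<kappa> \<omega>))"
      by simp
  qed
  also have "\<dots> \<le> H_unif \<Omega> fst" by (rule avg_codebook_entropy_le)
  finally show ?thesis .
qed

text \<open>Here the loss enters. With the upper bounds for messages and for edges, it shows that
  the leakage grows by at most \<open>codebook_loss\<close>.\<close>

lemma codebook_vector_msgs_edges:
  assumes \<alpha>: "\<alpha> \<subseteq> E"
  shows "H_unif \<Omega> (\<lambda>\<omega>. (fst \<omega>, edge_symbols W \<alpha> \<omega>)) - codebook_loss Ms Ks F J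
    \<le> codebook_vector Ms Ks W J (Msg ` S \<union> Edge ` \<alpha>)"
proof -
  have "H_unif \<Omega> (\<lambda>\<omega>. (fst \<omega>, edge_symbols W \<alpha> \<omega>)) - codebook_loss Ms Ks F J
    \<le> avg (codebooks J Ks) (\<lambda>\<kappa>. H_unif \<Omega>J
        (\<lambda>\<omega>. (fst (codebook_outcome \<kappa> \<omega>), edge_symbols W \<alpha> (codebook_outcome \<kappa> \<omega>))))"
  proof (rule avg_codebook_entropy_ge)
    fix \<omega> \<omega>' assume \<omega>: "\<omega> \<in> \<Omega>" "\<omega>' \<in> \<Omega>" and eq: "source_view W \<omega> = source_view W \<omega>'"
    have "W e \<omega> = W e \<omega>'" if "e \<in> \<alpha>" for e
      by (rule code_edges_determined[OF C \<omega>])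
        (use eq \<alpha> that in \<open>auto simp: source_view_def edge_symbols_eq_iff\<close>)
    then show "(fst \<omega>, edge_symbols W \<alpha> \<omega>) = (fst \<omega>', edge_symbols W \<alpha> \<omega>')"
      using eq by (simp add: edge_symbols_eq_iff source_view_def)
  qed
  also have "\<dots> = codebook_vector Ms Ks W J (Msg ` S \<union> Edge ` \<alpha>)"
    unfolding codebook_vector_def
  proof (rule avg_cong)
    fix \<kappa> assume "\<kappa> \<in> codebooks J Ks"
    from code_entropy_msgs_edges[OF code_codebook[OF this] \<alpha>]
    show "H_unif \<Omega>J (\<lambda>\<omega>. (fst (codebook_outcome \<kappa> \<omega>), edge_symbols W \<alpha> (codebook_outcome \<kappa> \<omega>)))
      = code_entropy Ms (\<lambda>s. {..<J s}) (WJ \<kappa>) (Msg ` S \<union> Edge ` \<alpha>)"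
      by (simp add: edge_symbols_WJ)
  qed
  finally show ?thesis .
qed

text \<open>Supplies the other direction of \<open>Gamma6\<close> without error term: subadditivity
  holds for each codebook and survives averaging.\<close>

lemma codebook_vector_subadditive:
  assumes \<alpha>: "\<alpha> \<subseteq> E"
  shows "codebook_vector Ms Ks W J (Msg ` S \<union> Edge ` \<alpha>) \<le> codebook_vector Ms Ks W J (Msg ` S) + codebook_vector Ms Ks W J (Edge ` \<alpha>)"
  unfolding codebook_vector_def avg_add[symmetric]
proof (rule avg_mono)
  fix \<kappa> assume "\<kappa> \<in> codebooks J Ks"
  note C' = code_codebook[OF this]
  show "code_entropy Ms (\<lambda>s. {..<J s}) (WJ \<kappa>) (Msg ` S \<union> Edge ` \<alpha>)
    \<le> code_entropy Ms (\<lambda>s. {..<J s}) (WJ \<kappa>) (Msg ` S) + code_entropy Ms (\<lambda>s. {..<J s}) (WJ \<kappa>) (Edge ` \<alpha>)"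
    unfolding code_entropy_msgs[OF C'] code_entropy_edges[OF C' \<alpha>] code_entropy_msgs_edges[OF C' \<alpha>]
    by (rule H_unif_subadditive[OF \<Omega>J_finite])
qed

end

end

section \<open>Repetition of a code\<close>

lemma avg_PiE_prod:
  assumes I: "finite I" and D: "\<And>i. i \<in> I \<Longrightarrow> finite (D i)"
  shows "avg (PiE I D) (\<lambda>g. \<Prod>i\<in>I. f i (g i)) = (\<Prod>i\<in>I. avg (D i) (f i))"
  unfolding avg_def prod_dividef using I D
  by (simp add: card_PiE prod_sum_PiE)

lemma restrict_eq_iff: "restrict f A = restrict g A \<longleftrightarrow> (\<forall>x\<in>A. f x = g x)"
  by (auto simp: fun_eq_iff restrict_def)

lemma agree_frac_PiE:
  assumes I: "finite I"
  shows "agree_frac (PiE I D) (\<lambda>g. \<lambda>i\<in>I. X i (g i)) g = (\<Prod>i\<in>I. agree_frac (D i) (X i) (g i))"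
proof -
  have "{h \<in> PiE I D. (\<lambda>i\<in>I. X i (h i)) = (\<lambda>i\<in>I. X i (g i))} = PiE I (\<lambda>i. {x\<in>D i. X i x = X i (g i)})"
    by (auto simp: PiE_iff restrict_eq_iff extensional_def)
  then show ?thesis using I by (simp add: agree_frac_def card_PiE prod_dividef)
qed

lemma H_unif_PiE_power:
  assumes \<Omega>: "finite \<Omega>" "\<Omega> \<noteq> {}"
  shows "H_unif (PiE {..<L} (\<lambda>_. \<Omega>)) (\<lambda>g. \<lambda>i\<in>{..<L}. X (g i)) = real L * H_unif \<Omega> X"
proof -
  let ?P = "PiE {..<L} (\<lambda>_. \<Omega>)"
  have fin: "finite ?P" "?P \<noteq> {}" using \<Omega> by (auto simp: PiE_eq_empty_iff finite_PiE)
  have "H_unif ?P (\<lambda>g. \<lambda>i\<in>{..<L}. X (g i)) = avg ?P (\<lambda>g. \<Sum>i<L. - log 2 (agree_frac \<Omega> X (g i)))"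
    unfolding H_unif_avg[OF fin]
  proof (rule avg_cong)
    fix g assume g: "g \<in> ?P"
    have "agree_frac \<Omega> X (g i) \<noteq> 0" if "i < L" for i
      using agree_frac_pos[OF \<Omega>(1), of "g i" X] PiE_mem[OF g, of i] that by simp
    then show "- log 2 (agree_frac ?P (\<lambda>g. \<lambda>i\<in>{..<L}. X (g i)) g) = (\<Sum>i<L. - log 2 (agree_frac \<Omega> X (g i)))"
      unfolding agree_frac_PiE[of "{..<L}" "\<lambda>_. \<Omega>" "\<lambda>_. X" g, OF finite_lessThan]
      by (subst log2_prod) (auto simp: sum_negf)
  qed
  also have "\<dots> = (\<Sum>i<L. avg \<Omega> (\<lambda>w. - log 2 (agree_frac \<Omega> X w)))"
    unfolding avg_sum using \<Omega> by (intro sum.cong refl avg_PiE_component) auto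
  finally show ?thesis by (simp add: H_unif_avg[OF \<Omega>])
qed

context network
begin

lemma outcomes_mem:
  "\<omega> \<in> outcomes Ms Ks \<Longrightarrow> s \<in> S \<Longrightarrow> fst \<omega> s \<in> Ms s"
  "\<omega> \<in> outcomes Ms Ks \<Longrightarrow> s \<in> S \<Longrightarrow> snd \<omega> s \<in> Ks s"
  by (auto simp: outcomes_def)

lemma avg_outcomes_source:
  assumes C: "code Ms Ks F W" and s: "s \<in> S"
  shows "avg (outcomes Ms Ks) (\<lambda>\<omega>. f (fst \<omega> s) (snd \<omega> s)) = avg (Ms s) (\<lambda>m. avg (Ks s) (f m))"
proof -
  note sets = code_sets[OF C]
  have "avg (outcomes Ms Ks) (\<lambda>\<omega>. f (fst \<omega> s) (snd \<omega> s))
    = avg (PiE S Ms) (\<lambda>m. avg (PiE S Ks) (\<lambda>k. f (m s) (k s)))"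
    by (simp add: outcomes_def avg_times)
  also have "\<dots> = avg (PiE S Ms) (\<lambda>m. avg (Ks s) (f (m s)))"
    using finite_S s sets by (intro avg_cong avg_PiE_component) auto
  also have "\<dots> = avg (Ms s) (\<lambda>m. avg (Ks s) (f m))"
    using finite_S s sets by (intro avg_PiE_component) auto
  finally show ?thesis .
qed

lemma key_fraction_pos:
  assumes "code Ms Ks F W" "s \<in> S" "k \<in> Ks s"
  shows "0 < key_fraction Ks F s m k"
  unfolding key_fraction_def using assms code_sets[OF assms(1,2)] by (intro agree_frac_pos) auto

text \<open>The left side is the entropy of the source symbols given the message. It equals
  \<open>H(M_s, W_Out) - H(M_s)\<close>, hence is at most \<open>H(W_Out)\<close>; this is how
  capacities come to bound the key rate that a codebook must supply.\<close>

lemma key_fraction_bits: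
  assumes C: "code Ms Ks F W" and s: "s \<in> S"
  shows "avg (Ms s) (\<lambda>m. avg (Ks s) (\<lambda>k. - log 2 (key_fraction Ks F s m k)))
    \<le> (\<Sum>e\<in>Out E tail s. H_unif (outcomes Ms Ks) (W e))"
proof -
  let ?\<Omega> = "outcomes Ms Ks" and ?O = "Out E tail s"
  let ?f = "key_fraction Ks F s"
  note fin = outcomes_finite[OF C] and sets = code_sets[OF C s]
  have card_pos: "card (Ms s) > 0" using sets by (simp add: card_gt_0_iff)
  \<comment> \<open>Message and key of \<open>s\<close> are independent and the message is uniform,
    so the joint fraction is the conditional one over the number of messages.\<close>
  have frac: "agree_frac ?\<Omega> (\<lambda>\<omega>. (fst \<omega> s, edge_symbols W ?O \<omega>)) \<omega> = ?f (fst \<omega> s) (snd \<omega> s) / card (Ms s)"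
    if \<omega>: "\<omega> \<in> ?\<Omega>" for \<omega>
  proof -
    let ?Y = "edge_symbols (\<lambda>e. F e (fst \<omega> s)) ?O"
    have "agree_frac ?\<Omega> (\<lambda>\<omega>. (fst \<omega> s, edge_symbols W ?O \<omega>)) \<omega>
      = avg ?\<Omega> (\<lambda>\<omega>'. of_bool (fst \<omega>' s = fst \<omega> s) * of_bool (?Y (snd \<omega>' s) = ?Y (snd \<omega> s)))"
      unfolding agree_frac_avg[OF fin(1)]
    proof (rule avg_cong)
      fix \<omega>' assume \<omega>': "\<omega>' \<in> ?\<Omega>"
      show "of_bool ((fst \<omega>' s, edge_symbols W ?O \<omega>') = (fst \<omega> s, edge_symbols W ?O \<omega>))
        = (of_bool (fst \<omega>' s = fst \<omega> s) * of_bool (?Y (snd \<omega>' s) = ?Y (snd \<omega> s)) :: real)"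
        using code_source[OF C s _ \<omega>] code_source[OF C s _ \<omega>'] by (auto simp: edge_symbols_eq_iff)
    qed
    also have "\<dots> = avg (Ms s) (\<lambda>m. avg (Ks s) (\<lambda>k. of_bool (m = fst \<omega> s) * of_bool (?Y k = ?Y (snd \<omega> s))))"
      by (rule avg_outcomes_source[OF C s])
    also have "\<dots> = avg (Ms s) (\<lambda>m. ?f (fst \<omega> s) (snd \<omega> s) * of_bool (m = fst \<omega> s))"
      unfolding avg_cmult[of "Ks s"] key_fraction_def agree_frac_avg[OF sets(3)]
      by (intro avg_cong mult.commute)
    also have "\<dots> = ?f (fst \<omega> s) (snd \<omega> s) / card (Ms s)"
    proof -
      have "fst \<omega> s \<in> Ms s" using \<omega> s by (auto simp: outcomes_def)
      then show ?thesis unfolding avg_cmult using sets by (simp add: avg_def)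
    qed
    finally show ?thesis .
  qed
  have "H_unif ?\<Omega> (\<lambda>\<omega>. (fst \<omega> s, edge_symbols W ?O \<omega>))
     = avg ?\<Omega> (\<lambda>\<omega>. log 2 (card (Ms s)) + - log 2 (?f (fst \<omega> s) (snd \<omega> s)))"
    unfolding H_unif_avg[OF fin]
  proof (rule avg_cong)
    fix \<omega> assume \<omega>: "\<omega> \<in> ?\<Omega>"
    have "?f (fst \<omega> s) (snd \<omega> s) > 0"
      using \<omega> s by (intro key_fraction_pos[OF C s]) (auto simp: outcomes_def)
    then show "- log 2 (agree_frac ?\<Omega> (\<lambda>\<omega>. (fst \<omega> s, edge_symbols W ?O \<omega>)) \<omega>)
      = log 2 (card (Ms s)) + - log 2 (?f (fst \<omega> s) (snd \<omega> s))"
      unfolding frac[OF \<omega>] using card_pos by (simp add: log_divide_pos)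
  qed
  also have "\<dots> = log 2 (card (Ms s)) + avg (Ms s) (\<lambda>m. avg (Ks s) (\<lambda>k. - log 2 (?f m k)))"
    unfolding avg_add avg_outcomes_source[OF C s, of "\<lambda>m k. - log 2 (?f m k)"]
    using fin by (simp add: avg_const)
  finally have "log 2 (card (Ms s)) + avg (Ms s) (\<lambda>m. avg (Ks s) (\<lambda>k. - log 2 (?f m k)))
    \<le> H_unif ?\<Omega> (\<lambda>\<omega>. fst \<omega> s) + H_unif ?\<Omega> (edge_symbols W ?O)"
    using H_unif_subadditive[OF fin, of "\<lambda>\<omega>. fst \<omega> s" "edge_symbols W ?O"] by simp
  moreover have "H_unif ?\<Omega> (\<lambda>\<omega>. fst \<omega> s) = log 2 (card (Ms s))"
    using agree_frac_msg[OF C s] fin by (intro H_unif_const_frac)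
  moreover have "H_unif ?\<Omega> (edge_symbols W ?O) \<le> (\<Sum>e\<in>?O. H_unif ?\<Omega> (W e))"
  proof -
    have "finite ?O" using finite_E by (simp add: Out_def)
    then have "H_unif ?\<Omega> (edge_symbols W ?O) \<le> (\<Sum>e\<in>?O. H_unif ?\<Omega> (\<lambda>\<omega>. Some (W e \<omega>)))"
      using H_unif_sum_le[OF fin, of ?O "\<lambda>e \<omega>. Some (W e \<omega>)" None]
      by (simp add: edge_symbols_def[abs_def])
    also have "\<dots> = (\<Sum>e\<in>?O. H_unif ?\<Omega> (W e))"
      by (intro sum.cong refl H_unif_cong[OF fin]) simp
    finally show ?thesis .
  qed
  ultimately show ?thesis by linarith
qed

section \<open>Independent repetitions\<close>

definition block :: "nat \<Rightarrow> ('v \<Rightarrow> nat \<Rightarrow> 'm) \<times> ('v \<Rightarrow> nat \<Rightarrow> 'k) \<Rightarrow> ('v \<Rightarrow> 'm) \<times> ('v \<Rightarrow> 'k)" where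
  "block i \<omega> = (\<lambda>s\<in>S. fst \<omega> s i, \<lambda>s\<in>S. snd \<omega> s i)"

context
  fixes Ms :: "'v \<Rightarrow> 'm set" and Ks :: "'v \<Rightarrow> 'k set" and F :: "'e \<Rightarrow> 'm \<Rightarrow> 'k \<Rightarrow> 'a" and W
    and L :: nat
  assumes C: "code Ms Ks F W"
begin

abbreviation "MsL \<equiv> \<lambda>s. PiE {..<L} (\<lambda>_. Ms s)"
abbreviation "KsL \<equiv> \<lambda>s. PiE {..<L} (\<lambda>_. Ks s)"
abbreviation "FL \<equiv> \<lambda>e m k. \<lambda>i\<in>{..<L}. F e (m i) (k i)"
abbreviation "WL \<equiv> \<lambda>e \<omega>. \<lambda>i\<in>{..<L}. W e (block i \<omega>)"

lemma block_in: "\<omega> \<in> outcomes MsL KsL \<Longrightarrow> i < L \<Longrightarrow> block i \<omega> \<in> outcomes Ms Ks"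
  by (auto simp: outcomes_def block_def PiE_iff)

lemma WL_eq_iff: "WL e \<omega> = WL e \<omega>' \<longleftrightarrow> (\<forall>i<L. W e (block i \<omega>) = W e (block i \<omega>'))"
  by (auto simp: fun_eq_iff restrict_def)

lemma code_power: "code MsL KsL FL WL"
  unfolding code_def
proof (intro conjI ballI impI)
  fix s assume s: "s \<in> S"
  show "finite (MsL s)" "MsL s \<noteq> {}" "finite (KsL s)" "KsL s \<noteq> {}"
    using code_sets[OF C s] by (auto simp: PiE_eq_empty_iff intro!: finite_PiE)
  fix e \<omega> assume e: "e \<in> Out E tail s" and \<omega>: "\<omega> \<in> outcomes MsL KsL"
  show "WL e \<omega> = FL e (fst \<omega> s) (snd \<omega> s)"
    using code_source[OF C s e block_in[OF \<omega>]] s by (auto simp: block_def restrict_def)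
next
  fix v e \<omega> \<omega>' assume v: "v \<in> V - (S \<union> T)" and e: "e \<in> Out E tail v"
    and \<omega>: "\<omega> \<in> outcomes MsL KsL" "\<omega>' \<in> outcomes MsL KsL"
    and eq: "\<forall>e'\<in>In E head v. WL e' \<omega> = WL e' \<omega>'"
  show "WL e \<omega> = WL e \<omega>'"
    unfolding WL_eq_iff
  proof (intro allI impI)
    fix i assume i: "i < L"
    show "W e (block i \<omega>) = W e (block i \<omega>')"
      by (rule code_inner[OF C v e block_in[OF \<omega>(1) i] block_in[OF \<omega>(2) i]])
        (use eq i in \<open>simp add: WL_eq_iff\<close>)
  qed
next
  fix t s \<omega> \<omega>' assume t: "t \<in> T" and s: "s \<in> beta t"
    and \<omega>: "\<omega> \<in> outcomes MsL KsL" "\<omega>' \<in> outcomes MsL KsL"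
    and eq: "\<forall>e\<in>In E head t. WL e \<omega> = WL e \<omega>'"
  have sS: "s \<in> S" using net t s by (auto simp: wiretap_network_def)
  have "fst \<omega> s i = fst \<omega>' s i" if i: "i < L" for i
  proof -
    have "fst (block i \<omega>) s = fst (block i \<omega>') s"
      by (rule code_decode[OF C t s block_in[OF \<omega>(1) i] block_in[OF \<omega>(2) i]])
        (use eq i in \<open>simp add: WL_eq_iff\<close>)
    then show ?thesis using sS by (simp add: block_def)
  qed
  moreover note outcomes_mem(1)[OF \<omega>(1) sS] outcomes_mem(1)[OF \<omega>(2) sS]
  ultimately show "fst \<omega> s = fst \<omega>' s" by (intro PiE_ext[of "fst \<omega> s"]) auto
qed

text \<open>Transposes a sequence for each source into a sequence of outcomes, so that the
  repetitions become independent copies on a uniform product space.\<close>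

lemma bij_blocks:
  "bij_betw (\<lambda>\<omega>. \<lambda>i\<in>{..<L}. block i \<omega>) (outcomes MsL KsL) (PiE {..<L} (\<lambda>_. outcomes Ms Ks))"
proof (rule bij_betw_byWitness[where
      f' = "\<lambda>g. (\<lambda>s\<in>S. \<lambda>i\<in>{..<L}. fst (g i) s, \<lambda>s\<in>S. \<lambda>i\<in>{..<L}. snd (g i) s)"])
  show "\<forall>\<omega>\<in>outcomes MsL KsL.
      (\<lambda>s\<in>S. \<lambda>i\<in>{..<L}. fst ((\<lambda>i\<in>{..<L}. block i \<omega>) i) s,
       \<lambda>s\<in>S. \<lambda>i\<in>{..<L}. snd ((\<lambda>i\<in>{..<L}. block i \<omega>) i) s) = \<omega>"
  proof
    fix \<omega> :: "('v \<Rightarrow> nat \<Rightarrow> 'm) \<times> ('v \<Rightarrow> nat \<Rightarrow> 'k)"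
    assume \<omega>: "\<omega> \<in> outcomes MsL KsL"
    have "(\<lambda>s\<in>S. \<lambda>i\<in>{..<L}. fst ((\<lambda>i\<in>{..<L}. block i \<omega>) i) s) = (\<lambda>s\<in>S. \<lambda>i\<in>{..<L}. fst \<omega> s i)"
      "(\<lambda>s\<in>S. \<lambda>i\<in>{..<L}. snd ((\<lambda>i\<in>{..<L}. block i \<omega>) i) s) = (\<lambda>s\<in>S. \<lambda>i\<in>{..<L}. snd \<omega> s i)"
      by (auto simp: fun_eq_iff block_def restrict_def)
    moreover have "(\<lambda>s\<in>S. \<lambda>i\<in>{..<L}. fst \<omega> s i) = fst \<omega>" "(\<lambda>s\<in>S. \<lambda>i\<in>{..<L}. snd \<omega> s i) = snd \<omega>"
      using \<omega> by (auto simp: outcomes_def fun_eq_iff PiE_iff extensional_def restrict_def)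
    ultimately show "(\<lambda>s\<in>S. \<lambda>i\<in>{..<L}. fst ((\<lambda>i\<in>{..<L}. block i \<omega>) i) s,
       \<lambda>s\<in>S. \<lambda>i\<in>{..<L}. snd ((\<lambda>i\<in>{..<L}. block i \<omega>) i) s) = \<omega>"
      by simp
  qed
  show "\<forall>g\<in>PiE {..<L} (\<lambda>_. outcomes Ms Ks). (\<lambda>i\<in>{..<L}. block i
      (\<lambda>s\<in>S. \<lambda>i\<in>{..<L}. fst (g i) s, \<lambda>s\<in>S. \<lambda>i\<in>{..<L}. snd (g i) s)) = g"
  proof
    fix g assume g: "g \<in> PiE {..<L} (\<lambda>_. outcomes Ms Ks)"
    have "block i (\<lambda>s\<in>S. \<lambda>i\<in>{..<L}. fst (g i) s, \<lambda>s\<in>S. \<lambda>i\<in>{..<L}. snd (g i) s) = g i"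
      if i: "i < L" for i
    proof -
      have "g i \<in> outcomes Ms Ks" using g i by auto
      then have "fst (g i) \<in> extensional S" "snd (g i) \<in> extensional S"
        by (auto simp: outcomes_def PiE_iff)
      then show ?thesis using i
        by (auto simp: block_def prod_eq_iff fun_eq_iff restrict_def extensional_def)
    qed
    then show "(\<lambda>i\<in>{..<L}. block i
      (\<lambda>s\<in>S. \<lambda>i\<in>{..<L}. fst (g i) s, \<lambda>s\<in>S. \<lambda>i\<in>{..<L}. snd (g i) s)) = g"
      using g by (auto simp: fun_eq_iff restrict_def PiE_iff extensional_def)
  qed
  show "(\<lambda>\<omega>. \<lambda>i\<in>{..<L}. block i \<omega>) ` outcomes MsL KsL \<subseteq> PiE {..<L} (\<lambda>_. outcomes Ms Ks)"
    by (rule image_subsetI, rule restrict_PiE_iff[THEN iffD2]) (simp add: block_in)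
  show "(\<lambda>g. (\<lambda>s\<in>S. \<lambda>i\<in>{..<L}. fst (g i) s, \<lambda>s\<in>S. \<lambda>i\<in>{..<L}. snd (g i) s)) `
      PiE {..<L} (\<lambda>_. outcomes Ms Ks) \<subseteq> outcomes MsL KsL"
  proof (rule image_subsetI)
    fix g assume g: "g \<in> PiE {..<L} (\<lambda>_. outcomes Ms Ks)"
    have "fst (g i) s \<in> Ms s" "snd (g i) s \<in> Ks s" if "i < L" "s \<in> S" for i s
      using outcomes_mem[of "g i" Ms Ks s] PiE_mem[OF g, of i] that by simp_all
    then show "(\<lambda>s\<in>S. \<lambda>i\<in>{..<L}. fst (g i) s, \<lambda>s\<in>S. \<lambda>i\<in>{..<L}. snd (g i) s) \<in> outcomes MsL KsL"
      by (simp add: outcomes_def restrict_PiE_iff)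
  qed
qed

text \<open>The hypothesis only asks that \<open>XL\<close> separate the same outcomes as the tuple
  of block values, since message sequences and edge sequences are stored in different
  shapes.\<close>

lemma H_unif_power:
  assumes X: "\<And>\<omega> \<omega>'. \<omega> \<in> outcomes MsL KsL \<Longrightarrow> \<omega>' \<in> outcomes MsL KsL \<Longrightarrow>
      XL \<omega> = XL \<omega>' \<longleftrightarrow> (\<forall>i<L. X (block i \<omega>) = X (block i \<omega>'))"
  shows "H_unif (outcomes MsL KsL) XL = real L * H_unif (outcomes Ms Ks) X"
proof -
  note fin = outcomes_finite[OF code_power]
  have "H_unif (outcomes MsL KsL) XL
    = H_unif (outcomes MsL KsL) (\<lambda>\<omega>. \<lambda>i\<in>{..<L}. X ((\<lambda>i\<in>{..<L}. block i \<omega>) i))"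
    by (rule H_unif_cong[OF fin]) (auto simp: X fun_eq_iff restrict_def)
  also have "\<dots> = H_unif (PiE {..<L} (\<lambda>_. outcomes Ms Ks)) (\<lambda>g. \<lambda>i\<in>{..<L}. X (g i))"
    by (rule H_unif_bij[OF bij_blocks fin])
  also have "\<dots> = real L * H_unif (outcomes Ms Ks) X"
    by (rule H_unif_PiE_power[OF outcomes_finite[OF C]])
  finally show ?thesis .
qed

lemma fst_eq_iff_blocks:
  assumes "\<omega> \<in> outcomes MsL KsL" "\<omega>' \<in> outcomes MsL KsL"
  shows "fst \<omega> = fst \<omega>' \<longleftrightarrow> (\<forall>i<L. fst (block i \<omega>) = fst (block i \<omega>'))"
proof
  assume eq: "\<forall>i<L. fst (block i \<omega>) = fst (block i \<omega>')"
  have "fst \<omega> s = fst \<omega>' s" if s: "s \<in> S" for s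
  proof (rule PiE_ext)
    show "fst \<omega> s \<in> MsL s" "fst \<omega>' s \<in> MsL s"
      using outcomes_mem(1)[OF assms(1) s] outcomes_mem(1)[OF assms(2) s] by simp_all
    fix i assume "i \<in> {..<L}"
    then have "fst (block i \<omega>) s = fst (block i \<omega>') s" using eq by simp
    then show "fst \<omega> s i = fst \<omega>' s i" using s by (simp add: block_def)
  qed
  then show "fst \<omega> = fst \<omega>'" using outcomes_msg_eq_iff(1)[OF assms] by blast
qed (simp add: block_def)

lemma H_unif_power_msgs:
  "H_unif (outcomes MsL KsL) fst = real L * H_unif (outcomes Ms Ks) fst"
  by (rule H_unif_power) (rule fst_eq_iff_blocks)

lemma H_unif_power_edges:
  "H_unif (outcomes MsL KsL) (edge_symbols WL \<alpha>) = real L * H_unif (outcomes Ms Ks) (edge_symbols W \<alpha>)"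
  by (rule H_unif_power) (auto simp: edge_symbols_eq_iff WL_eq_iff)

lemma H_unif_power_msgs_edges:
  "H_unif (outcomes MsL KsL) (\<lambda>\<omega>. (fst \<omega>, edge_symbols WL \<alpha> \<omega>))
    = real L * H_unif (outcomes Ms Ks) (\<lambda>\<omega>. (fst \<omega>, edge_symbols W \<alpha> \<omega>))"
  by (rule H_unif_power) (auto simp: edge_symbols_eq_iff WL_eq_iff fst_eq_iff_blocks)

text \<open>The blocks of a uniform key are independent, and the repeated encoder acts on each block
  separately.\<close>

lemma key_fraction_power:
  "key_fraction KsL FL s m k = (\<Prod>i<L. key_fraction Ks F s (m i) (k i))"
proof -
  have "key_fraction KsL FL s m k = agree_frac (PiE {..<L} (\<lambda>_. Ks s))
      (\<lambda>k. \<lambda>i\<in>{..<L}. edge_symbols (\<lambda>e. F e (m i)) (Out E tail s) (k i)) k"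
    unfolding key_fraction_def
    by (rule agree_frac_cong) (unfold edge_symbols_eq_iff restrict_eq_iff, blast)
  also have "\<dots> = (\<Prod>i<L. key_fraction Ks F s (m i) (k i))"
    unfolding key_fraction_def by (rule agree_frac_PiE) simp
  finally show ?thesis .
qed

text \<open>The power from \<open>ln_one_plus_le_powr\<close> factors over the blocks, with
  \<open>(2 ^ a) ^ L\<close> shared evenly among them. By \<open>moment\<close> each factor averages
  to at most 1, so the bound does not depend on \<open>L\<close>.\<close>

lemma codebook_loss_power_term:
  fixes a :: nat
  assumes s: "s \<in> S" and \<theta>: "0 < \<theta>" "\<theta> \<le> 1"
    and moment: "avg (Ms s) (\<lambda>m. avg (Ks s) (\<lambda>k. key_fraction Ks F s m k powr (- \<theta>))) \<le> 2 powr (real a * \<theta>)"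
  shows "avg (MsL s) (\<lambda>m. avg (KsL s) (\<lambda>k. log 2 (1 + 1 / (real ((2 ^ a) ^ L) * key_fraction KsL FL s m k))))
    \<le> 2 / (\<theta> * ln 2)"
proof -
  note sets = code_sets[OF C s]
  define f where "f m k = (1 / (2 ^ a * key_fraction Ks F s m k)) powr \<theta>" for m k
  have "avg (MsL s) (\<lambda>m. avg (KsL s) (\<lambda>k. log 2 (1 + 1 / (real ((2 ^ a) ^ L) * key_fraction KsL FL s m k))))
    \<le> avg (MsL s) (\<lambda>m. avg (KsL s) (\<lambda>k. 2 / (\<theta> * ln 2) * (\<Prod>i<L. f (m i) (k i))))"
  proof (intro avg_mono)
    fix m k assume k: "k \<in> KsL s"
    have pos: "key_fraction Ks F s (m i) (k i) > 0" if "i < L" for i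
      using k that by (intro key_fraction_pos[OF C s]) auto
    define x where "x = 1 / (real ((2 ^ a) ^ L) * key_fraction KsL FL s m k)"
    have x: "x = (\<Prod>i<L. 1 / (2 ^ a * key_fraction Ks F s (m i) (k i)))"
      unfolding x_def key_fraction_power by (simp add: prod_dividef prod.distrib)
    have xpos: "x > 0" unfolding x using pos by (intro prod_pos) auto
    have "log 2 (1 + x) \<le> 2 / \<theta> * x powr \<theta> / ln 2"
      unfolding log_def by (intro divide_right_mono ln_one_plus_le_powr[OF xpos \<theta>]) simp
    also have "x powr \<theta> = (\<Prod>i<L. f (m i) (k i))"
      unfolding x f_def by (rule prod_powr_distrib)
    finally show "log 2 (1 + 1 / (real ((2 ^ a) ^ L) * key_fraction KsL FL s m k))
      \<le> 2 / (\<theta> * ln 2) * (\<Prod>i<L. f (m i) (k i))"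
      unfolding x_def by simp
  qed
  also have "\<dots> = 2 / (\<theta> * ln 2) * (avg (Ms s) (\<lambda>m. avg (Ks s) (f m))) ^ L"
  proof -
    have "avg (KsL s) (\<lambda>k. \<Prod>i<L. f (m i) (k i)) = (\<Prod>i<L. avg (Ks s) (f (m i)))" for m
      using sets by (intro avg_PiE_prod) auto
    moreover have "avg (MsL s) (\<lambda>m. \<Prod>i<L. avg (Ks s) (f (m i))) = (\<Prod>i<L. avg (Ms s) (\<lambda>m. avg (Ks s) (f m)))"
      using sets by (intro avg_PiE_prod) auto
    ultimately show ?thesis unfolding avg_cmult by simp
  qed
  also have "\<dots> \<le> 2 / (\<theta> * ln 2) * 1"
  proof (intro mult_left_mono power_le_one)
    show "0 \<le> avg (Ms s) (\<lambda>m. avg (Ks s) (f m))"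
      using sets by (intro avg_ge_const) (auto simp: f_def)
    have "avg (Ms s) (\<lambda>m. avg (Ks s) (f m))
       = avg (Ms s) (\<lambda>m. avg (Ks s) (\<lambda>k. 2 powr (- (real a * \<theta>)) * key_fraction Ks F s m k powr (- \<theta>)))"
    proof (intro avg_cong)
      fix m k assume "k \<in> Ks s"
      then have "key_fraction Ks F s m k > 0" by (rule key_fraction_pos[OF C s])
      then show "f m k = 2 powr (- (real a * \<theta>)) * key_fraction Ks F s m k powr (- \<theta>)"
        by (simp add: f_def powr_divide powr_mult powr_minus powr_realpow[symmetric] powr_powr field_simps)
    qed
    also have "\<dots> \<le> 2 powr (- (real a * \<theta>)) * 2 powr (real a * \<theta>)"
      unfolding avg_cmult by (intro mult_left_mono moment) simp
    also have "\<dots> = 1" by (simp flip: powr_add)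
    finally show "avg (Ms s) (\<lambda>m. avg (Ks s) (f m)) \<le> 1" .
  qed (use \<theta> in simp)
  finally show ?thesis by simp
qed

end

text \<open>The strict inequality in \<open>a\<close> leaves room for an exponent
  \<open>\<theta>\<close> from \<open>exponential_moment_bound\<close>. That exponent depends on the
  code and the source but not on \<open>L\<close>, and the same holds for the constant.\<close>

lemma codebook_loss_power_bounded:
  fixes a :: "'v \<Rightarrow> nat"
  assumes C: "code Ms Ks F W"
    and a: "\<And>s. s \<in> S \<Longrightarrow> (\<Sum>e\<in>Out E tail s. H_unif (outcomes Ms Ks) (W e)) < a s"
  shows "\<exists>D. \<forall>L. codebook_loss (MsL Ms L) (KsL Ks L) (FL F L) (\<lambda>s. (2 ^ a s) ^ L) \<le> D"
proof -
  have "\<exists>\<theta>. 0 < \<theta> \<and> \<theta> \<le> 1 \<and>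
      avg (Ms s) (\<lambda>m. avg (Ks s) (\<lambda>k. key_fraction Ks F s m k powr (- \<theta>))) \<le> 2 powr (real (a s) * \<theta>)"
    if s: "s \<in> S" for s
  proof -
    note sets = code_sets[OF C s]
    have "avg (Ms s \<times> Ks s) (\<lambda>z. - log 2 (key_fraction Ks F s (fst z) (snd z))) < real (a s)"
      using order_le_less_trans[OF key_fraction_bits[OF C s] a[OF s]] by (simp add: avg_times)
    from exponential_moment_bound[OF _ _ _ this] show ?thesis
      using sets key_fraction_pos[OF C s] by (auto simp: avg_times)
  qed
  then obtain \<theta> where \<theta>: "\<And>s. s \<in> S \<Longrightarrow> 0 < \<theta> s" "\<And>s. s \<in> S \<Longrightarrow> \<theta> s \<le> 1"
    "\<And>s. s \<in> S \<Longrightarrow> avg (Ms s) (\<lambda>m. avg (Ks s) (\<lambda>k. key_fraction Ks F s m k powr (- \<theta> s))) \<le> 2 powr (real (a s) * \<theta> s)"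
    by metis
  have "codebook_loss (MsL Ms L) (KsL Ks L) (FL F L) (\<lambda>s. (2 ^ a s) ^ L) \<le> (\<Sum>s\<in>S. 2 / (\<theta> s * ln 2))" for L
    unfolding codebook_loss_def
    using \<theta> by (intro sum_mono codebook_loss_power_term[OF C])
  then show ?thesis by blast
qed


section \<open>Bounded message rates and the limit\<close>

text \<open>Witnessed by the code whose alphabets all have one letter.\<close>

lemma zero_in_cl_con: "(\<lambda>_. 0) \<in> cl_con code_vectors"
proof -
  define U :: "'v \<Rightarrow> unit set" where "U = (\<lambda>_. UNIV)"
  have C: "code U U (\<lambda>_ _ _. ()) (\<lambda>_ _. ())"
    by (simp add: code_def U_def)
  have "code_entropy U U (\<lambda>_ _. ()) \<gamma> = 0" for \<gamma>
    using code_entropy_bounds[OF C, of \<gamma>] by (simp add: U_def)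
  then have "code_entropy U U (\<lambda>_ _. ()) = (\<lambda>_. 0)" by auto
  then show ?thesis
    using code_entropy_in_code_vectors[OF C] cl_con_superset by auto
qed

text \<open>Division by the total blocklength is a convex combination with the zero vector; an
  entropic vector need not stay entropic when scaled.\<close>

lemma cl_con_scale:
  assumes h: "h \<in> cl_con code_vectors" and u: "0 \<le> u" "u \<le> 1"
  shows "(\<lambda>\<gamma>. u * h \<gamma>) \<in> cl_con code_vectors"
  using cl_con_convex[of code_vectors, unfolded convex_vec_def, rule_format, OF h zero_in_cl_con, of u] u
  by simp

section \<open>Surplus message bits as key\<close>

text \<open>Recovers the old outcome from the new one: the new message is the low \<open>a s\<close>
  bits of the old message, and the new key pairs the remaining high bits with the old key.\<close>

definition recode :: "('v \<Rightarrow> nat) \<Rightarrow> ('v \<Rightarrow> nat) \<times> ('v \<Rightarrow> nat \<times> nat) \<Rightarrow> ('v \<Rightarrow> nat) \<times> ('v \<Rightarrow> nat)" where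
  "recode a \<omega> = (\<lambda>s\<in>S. fst \<omega> s + 2 ^ a s * fst (snd \<omega> s), \<lambda>s\<in>S. snd (snd \<omega> s))"

context
  fixes n :: nat and rm rk :: "'v \<Rightarrow> real" and W :: "'e \<Rightarrow> ('v \<Rightarrow> nat) \<times> ('v \<Rightarrow> nat) \<Rightarrow> nat"
    and a :: "'v \<Rightarrow> nat"
  assumes W: "is_code V E tail head S T beta n rm rk W"
    and a: "\<And>s. s \<in> S \<Longrightarrow> a s \<le> nat \<lfloor>real n * rm s\<rfloor>"
begin

abbreviation "space0 \<equiv> code_space S n rm rk"
abbreviation "MsR \<equiv> \<lambda>s. {..<2 ^ a s} :: nat set"
abbreviation "KsR \<equiv> \<lambda>s. {..<2 ^ (nat \<lfloor>real n * rm s\<rfloor> - a s)} \<times> {..<2 ^ nat \<lfloor>real n * rk s\<rfloor>} :: (nat \<times> nat) set"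
abbreviation "WR \<equiv> \<lambda>e \<omega>. W e (recode a \<omega>)"

lemma bij_recode: "bij_betw (recode a) (outcomes MsR KsR) space0"
proof (rule bij_betw_byWitness[where
      f' = "\<lambda>\<omega>. (\<lambda>s\<in>S. fst \<omega> s mod 2 ^ a s, \<lambda>s\<in>S. (fst \<omega> s div 2 ^ a s, snd \<omega> s))"])
  show "\<forall>\<omega>\<in>outcomes MsR KsR. (\<lambda>s\<in>S. fst (recode a \<omega>) s mod 2 ^ a s,
      \<lambda>s\<in>S. (fst (recode a \<omega>) s div 2 ^ a s, snd (recode a \<omega>) s)) = \<omega>"
  proof
    fix \<omega> assume \<omega>: "\<omega> \<in> outcomes MsR KsR"
    have lt: "fst \<omega> s < 2 ^ a s" if "s \<in> S" for s using outcomes_mem[OF \<omega> that] by simp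
    have ext: "fst \<omega> \<in> extensional S" "snd \<omega> \<in> extensional S"
      using \<omega> by (auto simp: outcomes_def PiE_iff)
    show "(\<lambda>s\<in>S. fst (recode a \<omega>) s mod 2 ^ a s,
      \<lambda>s\<in>S. (fst (recode a \<omega>) s div 2 ^ a s, snd (recode a \<omega>) s)) = \<omega>"
      using lt ext by (auto simp: recode_def prod_eq_iff fun_eq_iff restrict_def extensional_def)
  qed
  show "\<forall>\<omega>\<in>space0. recode a (\<lambda>s\<in>S. fst \<omega> s mod 2 ^ a s, \<lambda>s\<in>S. (fst \<omega> s div 2 ^ a s, snd \<omega> s)) = \<omega>"
  proof
    fix \<omega> assume "\<omega> \<in> space0"
    then have "fst \<omega> \<in> extensional S" "snd \<omega> \<in> extensional S"
      by (auto simp: code_space_def PiE_iff)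
    then show "recode a (\<lambda>s\<in>S. fst \<omega> s mod 2 ^ a s, \<lambda>s\<in>S. (fst \<omega> s div 2 ^ a s, snd \<omega> s)) = \<omega>"
      by (auto simp: recode_def prod_eq_iff fun_eq_iff restrict_def extensional_def)
  qed
  show "recode a ` outcomes MsR KsR \<subseteq> space0"
  proof (rule image_subsetI)
    fix \<omega> assume \<omega>: "\<omega> \<in> outcomes MsR KsR"
    have "fst \<omega> s + 2 ^ a s * fst (snd \<omega> s) < 2 ^ nat \<lfloor>real n * rm s\<rfloor>" if s: "s \<in> S" for s
    proof -
      have "fst \<omega> s < 2 ^ a s" "fst (snd \<omega> s) < 2 ^ (nat \<lfloor>real n * rm s\<rfloor> - a s)"
        using outcomes_mem[OF \<omega> s] by auto
      then have "fst \<omega> s + 2 ^ a s * fst (snd \<omega> s) < 2 ^ a s * Suc (fst (snd \<omega> s))"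
        and le: "Suc (fst (snd \<omega> s)) \<le> 2 ^ (nat \<lfloor>real n * rm s\<rfloor> - a s)"
        by simp_all
      note this(1)
      also have "2 ^ a s * Suc (fst (snd \<omega> s)) \<le> 2 ^ a s * 2 ^ (nat \<lfloor>real n * rm s\<rfloor> - a s)"
        using le by (intro mult_left_mono) simp_all
      also have "(2::nat) ^ a s * 2 ^ (nat \<lfloor>real n * rm s\<rfloor> - a s) = 2 ^ nat \<lfloor>real n * rm s\<rfloor>"
        using a[OF s] by (simp flip: power_add)
      finally show ?thesis .
    qed
    moreover have "snd (snd \<omega> s) < 2 ^ nat \<lfloor>real n * rk s\<rfloor>" if "s \<in> S" for s
      using outcomes_mem(2)[OF \<omega> that] by auto
    ultimately show "recode a \<omega> \<in> space0"
      by (simp add: recode_def code_space_def restrict_PiE_iff)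
  qed
  show "(\<lambda>\<omega>. (\<lambda>s\<in>S. fst \<omega> s mod 2 ^ a s, \<lambda>s\<in>S. (fst \<omega> s div 2 ^ a s, snd \<omega> s))) ` space0 \<subseteq> outcomes MsR KsR"
  proof (rule image_subsetI)
    fix \<omega> assume \<omega>: "\<omega> \<in> space0"
    have "fst \<omega> s div 2 ^ a s < 2 ^ (nat \<lfloor>real n * rm s\<rfloor> - a s)" if s: "s \<in> S" for s
    proof (rule less_mult_imp_div_less)
      have "fst \<omega> s < 2 ^ nat \<lfloor>real n * rm s\<rfloor>" using \<omega> s by (auto simp: code_space_def PiE_iff)
      also have "\<dots> = 2 ^ (nat \<lfloor>real n * rm s\<rfloor> - a s) * 2 ^ a s"
        using a[OF s] by (simp flip: power_add)
      finally show "fst \<omega> s < 2 ^ (nat \<lfloor>real n * rm s\<rfloor> - a s) * 2 ^ a s" .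
    qed
    moreover have "snd \<omega> s < 2 ^ nat \<lfloor>real n * rk s\<rfloor>" if "s \<in> S" for s
      using \<omega> that by (auto simp: code_space_def PiE_iff)
    ultimately show "(\<lambda>s\<in>S. fst \<omega> s mod 2 ^ a s, \<lambda>s\<in>S. (fst \<omega> s div 2 ^ a s, snd \<omega> s)) \<in> outcomes MsR KsR"
      by (simp add: outcomes_def restrict_PiE_iff)
  qed
qed

lemma recode_in: "\<omega> \<in> outcomes MsR KsR \<Longrightarrow> recode a \<omega> \<in> space0"
  using bij_recode by (auto simp: bij_betw_def)

lemma recode_message:
  assumes "\<omega> \<in> outcomes MsR KsR" "s \<in> S"
  shows "fst \<omega> s = fst (recode a \<omega>) s mod 2 ^ a s"
  using outcomes_mem(1)[OF assms] assms(2) by (simp add: recode_def)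

lemma code_recode: "\<exists>F. code MsR KsR F WR"
proof -
  have "\<forall>s\<in>S. \<forall>e\<in>Out E tail s. \<exists>eta. \<forall>\<omega>\<in>space0. W e \<omega> = eta (fst \<omega> s, snd \<omega> s)"
    using W unfolding is_code_def by blast
  then have "\<forall>e. \<exists>eta. tail e \<in> S \<and> e \<in> E \<longrightarrow> (\<forall>\<omega>\<in>space0. W e \<omega> = eta (fst \<omega> (tail e), snd \<omega> (tail e)))"
    by (auto simp: Out_def)
  from choice[OF this] obtain eta where eta: "\<And>e \<omega>. tail e \<in> S \<Longrightarrow> e \<in> E \<Longrightarrow> \<omega> \<in> space0 \<Longrightarrow>
      W e \<omega> = eta e (fst \<omega> (tail e), snd \<omega> (tail e))"
    by blast
  define F where "F e m k = eta e (m + 2 ^ a (tail e) * fst k, snd k)" for e m and k :: "nat \<times> nat"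
  have "code MsR KsR F WR"
    unfolding code_def
  proof (intro conjI ballI impI)
    fix s assume s: "s \<in> S"
    show "finite (MsR s)" "MsR s \<noteq> {}" "finite (KsR s)" "KsR s \<noteq> {}"
      by (auto simp: lessThan_empty_iff)
    fix e \<omega> assume e: "e \<in> Out E tail s" and \<omega>: "\<omega> \<in> outcomes MsR KsR"
    then have "tail e = s" "e \<in> E" by (auto simp: Out_def)
    then show "WR e \<omega> = F e (fst \<omega> s) (snd \<omega> s)"
      using eta[of e "recode a \<omega>"] recode_in[OF \<omega>] s by (simp add: F_def recode_def)
  next
    fix v e \<omega> \<omega>' assume v: "v \<in> V - (S \<union> T)" and e: "e \<in> Out E tail v"
      and \<omega>: "\<omega> \<in> outcomes MsR KsR" "\<omega>' \<in> outcomes MsR KsR"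
      and eq: "\<forall>e'\<in>In E head v. WR e' \<omega> = WR e' \<omega>'"
    from W v e obtain eta where eta: "\<And>\<omega>. \<omega> \<in> space0 \<Longrightarrow> W e \<omega> = eta (\<lambda>e'. if e' \<in> In E head v then W e' \<omega> else 0)"
      unfolding is_code_def by blast
    have "(\<lambda>e'. if e' \<in> In E head v then WR e' \<omega> else 0) = (\<lambda>e'. if e' \<in> In E head v then WR e' \<omega>' else 0)"
      using eq by auto
    then show "WR e \<omega> = WR e \<omega>'"
      using eta[OF recode_in[OF \<omega>(1)]] eta[OF recode_in[OF \<omega>(2)]] by simp
  next
    fix t s \<omega> \<omega>' assume t: "t \<in> T" and s: "s \<in> beta t"
      and \<omega>: "\<omega> \<in> outcomes MsR KsR" "\<omega>' \<in> outcomes MsR KsR"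
      and eq: "\<forall>e\<in>In E head t. WR e \<omega> = WR e \<omega>'"
    from W t s obtain dec where dec: "\<And>\<omega>. \<omega> \<in> space0 \<Longrightarrow> dec (\<lambda>e. if e \<in> In E head t then W e \<omega> else 0) = fst \<omega> s"
      unfolding is_code_def by blast
    have "(\<lambda>e. if e \<in> In E head t then WR e \<omega> else 0) = (\<lambda>e. if e \<in> In E head t then WR e \<omega>' else 0)"
      using eq by auto
    then have "fst (recode a \<omega>) s = fst (recode a \<omega>') s"
      using dec[OF recode_in[OF \<omega>(1)]] dec[OF recode_in[OF \<omega>(2)]] by simp
    moreover have "s \<in> S" using net t s by (auto simp: wiretap_network_def)
    ultimately show "fst \<omega> s = fst \<omega>' s"
      using recode_message[OF \<omega>(1)] recode_message[OF \<omega>(2)] by simp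
  qed
  then show ?thesis by (rule exI[of _ F])
qed

lemma H_unif_recode: "H_unif (outcomes MsR KsR) (\<lambda>\<omega>. X (recode a \<omega>)) = H_unif space0 X"
  using code_recode outcomes_finite by (blast intro: H_unif_bij[OF bij_recode])

text \<open>The new message is a function of the old one and so reveals no more. This is
  submodularity with the new message as \<open>A\<close>, the old message as \<open>B\<close> and
  the tapped symbols as \<open>C\<close>.\<close>

lemma mutual_information_recode:
  "H_unif (outcomes MsR KsR) fst + H_unif (outcomes MsR KsR) (edge_symbols WR \<alpha>)
     - H_unif (outcomes MsR KsR) (\<lambda>\<omega>. (fst \<omega>, edge_symbols WR \<alpha> \<omega>))
   \<le> MI_unif space0 fst (\<lambda>\<omega>. (\<lambda>e. if e \<in> \<alpha> then W e \<omega> else 0))"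
proof -
  let ?\<Omega> = "outcomes MsR KsR"
  have fin: "finite ?\<Omega>" "?\<Omega> \<noteq> {}" using code_recode outcomes_finite by blast+
  have det: "fst \<omega> = fst \<omega>'" if "\<omega> \<in> ?\<Omega>" "\<omega>' \<in> ?\<Omega>" "fst (recode a \<omega>) = fst (recode a \<omega>')" for \<omega> \<omega>'
    unfolding outcomes_msg_eq_iff(1)[OF that(1,2)]
    using that(3) recode_message[OF that(1)] recode_message[OF that(2)] by simp
  let ?B = "\<lambda>\<omega>. fst (recode a \<omega>)" and ?C = "\<lambda>\<omega>. \<lambda>e. if e \<in> \<alpha> then WR e \<omega> else 0"
  have C_eq: "?C \<omega> = ?C \<omega>' \<longleftrightarrow> edge_symbols WR \<alpha> \<omega> = edge_symbols WR \<alpha> \<omega>'" for \<omega> \<omega>'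
    by (auto simp: edge_symbols_def fun_eq_iff)
  have "H_unif ?\<Omega> (\<lambda>\<omega>. (fst \<omega>, ?B \<omega>, ?C \<omega>)) = H_unif ?\<Omega> (\<lambda>\<omega>. (?B \<omega>, ?C \<omega>))"
    by (rule H_unif_cong[OF fin]) (use det in blast)
  also have "\<dots> = H_unif space0 (\<lambda>\<omega>. (fst \<omega>, \<lambda>e. if e \<in> \<alpha> then W e \<omega> else 0))"
    by (rule H_unif_recode)
  finally have 1: "H_unif ?\<Omega> (\<lambda>\<omega>. (fst \<omega>, ?B \<omega>, ?C \<omega>)) = \<dots>" .
  have "H_unif ?\<Omega> (\<lambda>\<omega>. (fst \<omega>, ?B \<omega>)) = H_unif ?\<Omega> ?B"
    by (rule H_unif_cong[OF fin]) (use det in blast)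
  also have "\<dots> = H_unif space0 fst" by (rule H_unif_recode)
  finally have 2: "H_unif ?\<Omega> (\<lambda>\<omega>. (fst \<omega>, ?B \<omega>)) = \<dots>" .
  have 3: "H_unif ?\<Omega> (\<lambda>\<omega>. (fst \<omega>, ?C \<omega>)) = H_unif ?\<Omega> (\<lambda>\<omega>. (fst \<omega>, edge_symbols WR \<alpha> \<omega>))"
    by (rule H_unif_cong[OF fin]) (simp add: C_eq)
  have "H_unif ?\<Omega> (edge_symbols WR \<alpha>) = H_unif ?\<Omega> ?C"
    by (rule H_unif_cong[OF fin]) (simp add: C_eq)
  also have "\<dots> = H_unif space0 (\<lambda>\<omega>. \<lambda>e. if e \<in> \<alpha> then W e \<omega> else 0)"
    by (rule H_unif_recode)
  finally have 4: "H_unif ?\<Omega> (edge_symbols WR \<alpha>) = \<dots>" .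
  show ?thesis
    using H_unif_submodular[OF fin, of fst ?B ?C] unfolding 1 2 3 4 MI_unif_def by linarith
qed

end

section \<open>The compact box and the limit\<close>

text \<open>Depends on neither the tolerance nor any blocklength. The 1 pays for rounding up the
  message bits, the 2 for rounding up the codebook bits and making their bound strict; both shrink
  further on division by \<open>n \<ge> 1\<close>.\<close>

definition rate_bound :: "('v \<Rightarrow> real) \<Rightarrow> real" where
  "rate_bound r = (\<Sum>s\<in>S. (\<bar>r s\<bar> + 1) + ((\<Sum>e\<in>Out E tail s. c e) + 2))"

text \<open>The tolerance enters only in the rates and in one direction of \<open>Gamma6\<close>.
  Beyond membership in \<open>cl_con\<close>, all conditions are equations and non-strict
  inequalities in finitely many coordinates each, hence closed in the product topology.\<close>

definition near_solutions :: "('v \<Rightarrow> real) \<Rightarrow> real \<Rightarrow> (('v, 'e) label set \<Rightarrow> real) set" where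
  "near_solutions r \<epsilon> = cl_con code_vectors
     \<inter> (\<Inter>\<gamma>\<in>insert {} {\<gamma>. \<not> \<gamma> \<subseteq> labels S E}. {h. h \<gamma> = 0})
     \<inter> (\<Inter>s\<in>S. {h. r s - \<epsilon> \<le> h {Msg s}})
     \<inter> (\<Inter>e\<in>E. {h. h {Edge e} \<le> c e})
     \<inter> (\<Inter>\<alpha>\<in>A. {h. h (Msg ` S \<union> Edge ` \<alpha>) \<le> h (Msg ` S) + h (Edge ` \<alpha>)})
     \<inter> (\<Inter>\<alpha>\<in>A. {h. h (Msg ` S) + h (Edge ` \<alpha>) - \<epsilon> \<le> h (Msg ` S \<union> Edge ` \<alpha>)})"

lemma near_solution_exists:
  assumes r: "achievable_w V E tail head S T beta c A r" and \<epsilon>: "0 < \<epsilon>" "\<epsilon> \<le> 1"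
  shows "\<exists>h \<in> near_solutions r \<epsilon>. \<forall>\<gamma>. 0 \<le> h \<gamma> \<and> h \<gamma> \<le> rate_bound r"
proof -
  \<comment> \<open>Half of the tolerance is for the leakage of the given code, half for the
    codebook loss.\<close>
  have "\<epsilon> / 2 > 0" using \<epsilon> by simp
  from r[unfolded achievable_w_def, THEN spec, THEN mp, OF this] obtain N where N: "\<forall>n\<ge>N. \<exists>rm rk W.
        is_code V E tail head S T beta n rm rk W \<and>
        (\<forall>s\<in>S. real (nat \<lfloor>real n * rm s\<rfloor>) / real n \<ge> r s - \<epsilon> / 2) \<and>
        (\<forall>e\<in>E. H_unif (code_space S n rm rk) (W e) / real n \<le> c e) \<and>
        (\<forall>\<alpha>\<in>A. MI_unif (code_space S n rm rk) fst
                   (\<lambda>\<omega>. (\<lambda>e. if e \<in> \<alpha> then W e \<omega> else 0)) / real n \<le> \<epsilon> / 2)"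
    by (rule exE)
  \<comment> \<open>One blocklength is enough, and \<open>N\<close> itself qualifies;
    \<open>n > 0\<close> comes from \<open>is_code\<close>.\<close>
  define n where "n = N"
  obtain rm rk W where W: "is_code V E tail head S T beta n rm rk W"
    and rate: "\<And>s. s \<in> S \<Longrightarrow> r s - \<epsilon> / 2 \<le> real (nat \<lfloor>real n * rm s\<rfloor>) / real n"
    and cap: "\<And>e. e \<in> E \<Longrightarrow> H_unif (code_space S n rm rk) (W e) / real n \<le> c e"
    and sec: "\<And>\<alpha>. \<alpha> \<in> A \<Longrightarrow> MI_unif (code_space S n rm rk) fst
                   (\<lambda>\<omega>. (\<lambda>e. if e \<in> \<alpha> then W e \<omega> else 0)) / real n \<le> \<epsilon> / 2"
    using N[rule_format, of n] unfolding n_def by blast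
  have n: "real n > 0" using W by (simp add: is_code_def)
  \<comment> \<open>Enough bits for the target rate, as far as the code provides them, and no more.
    A negative \<open>r s\<close> yields 0 bits.\<close>
  define a where "a s = min (nat \<lfloor>real n * rm s\<rfloor>) (nat \<lceil>real n * r s\<rceil>)" for s
  have a_le: "a s \<le> nat \<lfloor>real n * rm s\<rfloor>" for s by (simp add: a_def)
  have a_rate: "r s - \<epsilon> \<le> real (a s) / real n" if "s \<in> S" for s
  proof -
    have "real n * r s \<le> real (nat \<lceil>real n * r s\<rceil>)" by linarith
    then have "r s \<le> real (nat \<lceil>real n * r s\<rceil>) / real n"
      using n by (simp add: le_divide_eq mult.commute)
    then show ?thesis using rate[OF that] \<epsilon> unfolding a_def min_def by auto
  qed
  have a_bound: "real (a s) / real n \<le> \<bar>r s\<bar> + 1" for s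
  proof -
    have "real (a s) \<le> real (nat \<lceil>real n * r s\<rceil>)" by (simp add: a_def)
    also have "\<dots> \<le> \<bar>real n * r s\<bar> + 1" by linarith
    also have "\<dots> \<le> (\<bar>r s\<bar> + 1) * real n" using n by (simp add: abs_mult algebra_simps)
    finally show ?thesis using n by (simp add: divide_le_eq)
  qed
  let ?Ms = "MsR a" and ?Ks = "KsR n rm rk a" and ?W = "WR W a"
  let ?\<Omega> = "outcomes ?Ms ?Ks"
  obtain F where C: "code ?Ms ?Ks F ?W" using code_recode[OF W a_le] by blast
  have H_edge: "H_unif ?\<Omega> (?W e) \<le> real n * c e" if "e \<in> E" for e
    using cap[OF that] n H_unif_recode[OF W a_le, of "W e"] by (simp add: divide_le_eq mult.commute)
  define Cs where "Cs s = (\<Sum>e\<in>Out E tail s. c e)" for s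
  \<comment> \<open>The added 1 makes the bound on the entropy of the source symbols strict, as
    \<open>codebook_loss_power_bounded\<close> requires.\<close>
  define b where "b s = nat \<lceil>real n * Cs s\<rceil> + 1" for s
  have Cs_nonneg: "0 \<le> Cs s" for s
    unfolding Cs_def
  proof (rule sum_nonneg)
    fix e assume "e \<in> Out E tail s"
    then have "e \<in> E" by (simp add: Out_def)
    from order_trans[OF H_unif_nonneg[OF outcomes_finite[OF C]] H_edge[OF this]]
    show "0 \<le> c e" using n by (simp add: zero_le_mult_iff)
  qed
  have "(\<Sum>e\<in>Out E tail s. H_unif ?\<Omega> (?W e)) < b s" for s
  proof -
    have "(\<Sum>e\<in>Out E tail s. H_unif ?\<Omega> (?W e)) \<le> (\<Sum>e\<in>Out E tail s. real n * c e)"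
      by (intro sum_mono H_edge) (simp add: Out_def)
    also have "\<dots> = real n * Cs s" by (simp add: Cs_def sum_distrib_left)
    also have "\<dots> < b s" unfolding b_def by linarith
    finally show ?thesis .
  qed
  from codebook_loss_power_bounded[OF C this] obtain D where
    D: "\<And>L. codebook_loss (MsL ?Ms L) (KsL ?Ks L) (FL F L) (\<lambda>s. (2 ^ b s) ^ L) \<le> D" by blast
  have b_bound: "real (b s) / real n \<le> Cs s + 2" for s
  proof -
    have "real (b s) \<le> real n * Cs s + 2"
      unfolding b_def using Cs_nonneg[of s] n by (simp add: of_nat_nat) linarith
    also have "\<dots> \<le> (Cs s + 2) * real n" using W by (simp add: is_code_def algebra_simps)
    finally show ?thesis using n by (simp add: divide_le_eq)
  qed
  \<comment> \<open>\<open>D\<close> depends on the code, hence on \<open>n\<close>, but it is fixed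
    before \<open>L\<close>; enough repetitions therefore absorb it.\<close>
  obtain L0 :: nat where L0: "D \<le> real L0 * (\<epsilon> / 2)" using \<epsilon> by (metis half_gt_zero reals_Archimedean3 less_imp_le)
  define L where "L = Suc L0"
  have L: "real L > 0" "D \<le> real L * (\<epsilon> / 2)"
    using L0 \<epsilon> unfolding L_def by (auto simp: algebra_simps)
  define J :: "'v \<Rightarrow> nat" where "J = (\<lambda>s. (2 ^ b s) ^ L)"
  have J: "J s > 0" for s by (simp add: J_def)
  note CL = code_power[OF C, of L]
  define u where "u = 1 / (real n * real L)"
  have u: "0 < u" "u \<le> 1" "u * (real n * real L) = 1"
    using n L(1) W unfolding u_def L_def
    by (auto simp: is_code_def divide_le_eq) (use mult_mono[of 1 "real n" 1 "1 + real L0"] in auto)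
  define h0 where "h0 = codebook_vector (MsL ?Ms L) (KsL ?Ks L) (WL ?W L) J"
  define h where "h \<gamma> = u * h0 \<gamma>" for \<gamma>
  have log_card: "log 2 (card (MsL ?Ms L s)) = real L * real (a s)" "log 2 (J s) = real L * real (b s)" for s
    by (simp_all add: card_PiE J_def log_nat_power)
  have scale: "u * (real L * x) = x / real n" for x
    using n L(1) by (simp add: u_def)
  have h_msg: "h {Msg s} = real (a s) / real n" if "s \<in> S" for s
    unfolding h_def h0_def codebook_vector_Msg[OF CL J that] log_card scale ..
  have h_bounds: "0 \<le> h \<gamma>" "h \<gamma> \<le> rate_bound r" for \<gamma>
  proof -
    show "0 \<le> h \<gamma>" unfolding h_def h0_def using u codebook_vector_bounds(1)[OF CL J] by simp
    have "h \<gamma> \<le> u * (\<Sum>s\<in>S. log 2 (card (MsL ?Ms L s)) + log 2 (J s))"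
      unfolding h_def h0_def using u by (intro mult_left_mono codebook_vector_bounds(2)[OF CL J]) auto
    also have "\<dots> = (\<Sum>s\<in>S. real (a s) / real n + real (b s) / real n)"
      unfolding log_card sum_distrib_left distrib_left scale ..
    also have "\<dots> \<le> rate_bound r"
      unfolding rate_bound_def using b_bound a_bound by (intro sum_mono add_mono) (auto simp: Cs_def)
    finally show "h \<gamma> \<le> rate_bound r" .
  qed
  have h_edges: "h (Edge ` \<alpha>) \<le> H_unif ?\<Omega> (edge_symbols ?W \<alpha>) / real n" if "\<alpha> \<subseteq> E" for \<alpha>
    using mult_left_mono[OF codebook_vector_edges[OF CL J that], of u] u
    unfolding H_unif_power_edges[OF C] h_def h0_def scale by simp
  have h_msgs: "h (Msg ` S) \<le> H_unif ?\<Omega> fst / real n"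
    using mult_left_mono[OF codebook_vector_msgs[OF CL J], of u] u
    unfolding H_unif_power_msgs[OF C] h_def h0_def scale by simp
  have h_msgs_edges: "(H_unif ?\<Omega> (\<lambda>\<omega>. (fst \<omega>, edge_symbols ?W \<alpha> \<omega>))) / real n - \<epsilon> / 2 \<le> h (Msg ` S \<union> Edge ` \<alpha>)"
    if \<alpha>: "\<alpha> \<subseteq> E" for \<alpha>
  proof -
    let ?l = "codebook_loss (MsL ?Ms L) (KsL ?Ks L) (FL F L) J"
    let ?H = "H_unif ?\<Omega> (\<lambda>\<omega>. (fst \<omega>, edge_symbols ?W \<alpha> \<omega>))"
    have "?l \<le> real L * (\<epsilon> / 2)" using D[of L] L(2) unfolding J_def by simp
    then have "u * ?l \<le> u * (real L * (\<epsilon> / 2))" using u by (intro mult_left_mono) auto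
    \<comment> \<open>The left side is \<open>\<epsilon> / 2\<close> divided by \<open>n\<close>,
      and \<open>n \<ge> 1\<close>.\<close>
    also have "\<dots> \<le> \<epsilon> / 2" unfolding scale using W \<epsilon> by (auto simp: is_code_def divide_le_eq)
    finally have "u * ?l \<le> \<epsilon> / 2" .
    moreover have "u * (real L * ?H - ?l) \<le> h (Msg ` S \<union> Edge ` \<alpha>)"
      using mult_left_mono[OF codebook_vector_msgs_edges[OF CL J \<alpha>], of u] u
      unfolding H_unif_power_msgs_edges[OF C] h_def h0_def by simp
    ultimately show ?thesis unfolding right_diff_distrib scale by linarith
  qed
  have A: "\<alpha> \<subseteq> E" if "\<alpha> \<in> A" for \<alpha> using net that by (auto simp: wiretap_network_def)
  have "h \<in> cl_con code_vectors"
    unfolding h_def h0_def using codebook_vector_in_cl_con[OF CL J] u by (intro cl_con_scale) auto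
  moreover have "h \<gamma> = 0" if "\<gamma> \<in> insert {} {\<gamma>. \<not> \<gamma> \<subseteq> labels S E}" for \<gamma>
    using that codebook_vector_trivial[OF CL, where J = J, OF J] unfolding h_def h0_def by auto
  moreover have "h {Edge e} \<le> c e" if e: "e \<in> E" for e
  proof -
    have "h {Edge e} \<le> H_unif ?\<Omega> (edge_symbols ?W {e}) / real n" using h_edges[of "{e}"] e by simp
    also have "H_unif ?\<Omega> (edge_symbols ?W {e}) = H_unif ?\<Omega> (?W e)"
      by (rule H_unif_cong[OF outcomes_finite[OF C]]) (simp add: edge_symbols_eq_iff)
    also have "\<dots> / real n \<le> c e" using H_edge[OF e] n by (simp add: divide_le_eq mult.commute)
    finally show ?thesis .
  qed
  moreover have "h (Msg ` S \<union> Edge ` \<alpha>) \<le> h (Msg ` S) + h (Edge ` \<alpha>)" if "\<alpha> \<in> A" for \<alpha>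
    using mult_left_mono[OF codebook_vector_subadditive[OF CL J A[OF that]], of u] u
    unfolding h_def h0_def distrib_left by simp
  moreover have "h (Msg ` S) + h (Edge ` \<alpha>) - \<epsilon> \<le> h (Msg ` S \<union> Edge ` \<alpha>)" if \<alpha>: "\<alpha> \<in> A" for \<alpha>
  proof -
    have "(H_unif ?\<Omega> fst + H_unif ?\<Omega> (edge_symbols ?W \<alpha>)
      - H_unif ?\<Omega> (\<lambda>\<omega>. (fst \<omega>, edge_symbols ?W \<alpha> \<omega>))) / real n \<le> \<epsilon> / 2"
      by (rule order_trans[OF divide_right_mono[OF mutual_information_recode[OF W a_le]] sec[OF \<alpha>]]) simp
    then show ?thesis
      using h_msgs h_edges[OF A[OF \<alpha>]] h_msgs_edges[OF A[OF \<alpha>]]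
      unfolding diff_divide_distrib add_divide_distrib by linarith
  qed
  ultimately have "h \<in> near_solutions r \<epsilon>"
    unfolding near_solutions_def using h_msg a_rate by auto
  then show ?thesis using h_bounds by blast
qed

lemma closed_near_solutions: "closed (near_solutions r \<epsilon>)"
  unfolding near_solutions_def
  by (intro closed_Int closed_INT ballI cl_con_closed closed_Collect_le closed_Collect_eq
      continuous_intros continuous_on_product_coordinates)

lemma near_solutions_mono: "\<epsilon> \<le> \<delta> \<Longrightarrow> near_solutions r \<epsilon> \<subseteq> near_solutions r \<delta>"
  unfolding near_solutions_def by fastforce

text \<open>The box is a product of intervals over all sets of labels, compact by Tychonoff's
  theorem even if the label type is infinite.\<close>

lemma exact_solution_exists:
  assumes r: "achievable_w V E tail head S T beta c A r"
  shows "\<exists>h. \<forall>\<epsilon>. 0 < \<epsilon> \<longrightarrow> \<epsilon> \<le> 1 \<longrightarrow> h \<in> near_solutions r \<epsilon>"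
proof -
  define B where "B = PiE UNIV (\<lambda>_ :: ('v, 'e) label set. {0..rate_bound r})"
  have "compactin (product_topology (\<lambda>_. euclidean) UNIV) B"
    unfolding B_def by (auto simp: compactin_PiE)
  then have B: "compact B" by (simp add: euclidean_product_topology)
  have "B \<inter> (\<Inter>\<epsilon>\<in>{0<..1}. near_solutions r \<epsilon>) \<noteq> {}"
  proof (rule compact_imp_fip_image[OF B closed_near_solutions])
    fix I' :: "real set" assume I': "finite I'" "I' \<subseteq> {0<..1}"
    \<comment> \<open>Inserting 1 keeps the minimum defined for the empty family.\<close>
    define \<delta> where "\<delta> = Min (insert 1 I')"
    have \<delta>: "0 < \<delta>" "\<delta> \<le> 1" using I' by (auto simp: \<delta>_def)
    obtain h where h: "h \<in> near_solutions r \<delta>" "\<forall>\<gamma>. 0 \<le> h \<gamma> \<and> h \<gamma> \<le> rate_bound r"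
      using near_solution_exists[OF r \<delta>] by blast
    have "\<delta> \<le> \<epsilon>" if "\<epsilon> \<in> I'" for \<epsilon> using I' that by (simp add: \<delta>_def)
    then have "h \<in> (\<Inter>\<epsilon>\<in>I'. near_solutions r \<epsilon>)" using h(1) near_solutions_mono by blast
    moreover have "h \<in> B" using h(2) by (auto simp: B_def)
    ultimately show "B \<inter> (\<Inter>\<epsilon>\<in>I'. near_solutions r \<epsilon>) \<noteq> {}" by blast
  qed
  then obtain h where "h \<in> (\<Inter>\<epsilon>\<in>{0<..1}. near_solutions r \<epsilon>)" by blast
  then show ?thesis by (intro exI[of _ h]) simp
qed

lemma R0w_subset_R0o: "R0w V E tail head S T beta c A \<subseteq> R0o V E tail head S T beta c A"
proof
  fix r assume "r \<in> R0w V E tail head S T beta c A"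
  then have r: "achievable_w V E tail head S T beta c A r" "\<And>s. s \<notin> S \<Longrightarrow> r s = 0"
    by (auto simp: R0w_def)
  obtain h where h: "\<And>\<epsilon>. 0 < \<epsilon> \<Longrightarrow> \<epsilon> \<le> 1 \<Longrightarrow> h \<in> near_solutions r \<epsilon>"
    using exact_solution_exists[OF r(1)] by blast
  have lim: "x \<le> y" if "\<And>\<epsilon>. 0 < \<epsilon> \<Longrightarrow> \<epsilon> \<le> 1 \<Longrightarrow> x - \<epsilon> \<le> y" for x y :: real
  proof (rule field_le_epsilon)
    fix e :: real assume "e > 0"
    then show "x \<le> y + e" using that[of "min e 1"] by (cases "e \<le> 1") auto
  qed
  have h1: "h \<in> near_solutions r 1" using h by simp
  have HN: "h \<in> HN (labels S E)" using h1 unfolding near_solutions_def HN_def by blast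
  have G5: "h \<in> Gamma5 S E c" using h1 HN unfolding near_solutions_def Gamma5_def by blast
  have G6: "h \<in> Gamma6 S E A"
  proof -
    have "h (Msg ` S \<union> Edge ` \<alpha>) = h (Msg ` S) + h (Edge ` \<alpha>)" if \<alpha>: "\<alpha> \<in> A" for \<alpha>
    proof (rule antisym)
      show "h (Msg ` S \<union> Edge ` \<alpha>) \<le> h (Msg ` S) + h (Edge ` \<alpha>)"
        using h1 \<alpha> unfolding near_solutions_def by blast
      show "h (Msg ` S) + h (Edge ` \<alpha>) \<le> h (Msg ` S \<union> Edge ` \<alpha>)"
      proof (rule lim)
        fix \<epsilon> :: real assume "0 < \<epsilon>" "\<epsilon> \<le> 1"
        from h[OF this] \<alpha> show "h (Msg ` S) + h (Edge ` \<alpha>) - \<epsilon> \<le> h (Msg ` S \<union> Edge ` \<alpha>)"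
          unfolding near_solutions_def by blast
      qed
    qed
    then show ?thesis using HN by (simp add: Gamma6_def)
  qed
  have "r s \<le> h {Msg s}" if s: "s \<in> S" for s
  proof (rule lim)
    fix \<epsilon> :: real assume "0 < \<epsilon>" "\<epsilon> \<le> 1"
    from h[OF this] s show "r s - \<epsilon> \<le> h {Msg s}"
      unfolding near_solutions_def by blast
  qed
  moreover have "h \<in> cl_con code_vectors" using h1 by (simp add: near_solutions_def)
  ultimately show "r \<in> R0o V E tail head S T beta c A"
    unfolding R0o_def Lambda_low_def using G5 G6 r(2)
    by (auto simp: code_vectors_def ProjS_def intro!: bexI[of _ h])
qed

end

theorem theorem3:
  fixes V :: "'v set" and E :: "'e set" and tail head :: "'e \<Rightarrow> 'v"
    and S T :: "'v set" and beta :: "'v \<Rightarrow> 'v set"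
    and c :: "'e \<Rightarrow> real" and A :: "'e set set"
  assumes "wiretap_network V E tail head S T beta c A"
  shows "R0w V E tail head S T beta c A \<subseteq> R0o V E tail head S T beta c A"
proof -
  interpret network V E tail head S T beta c A by unfold_locales (rule assms)
  show ?thesis by (rule R0w_subset_R0o)
qed

end
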